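(* Under the Markovian switching setup in the context: (i) If $\beta>\frac{1}{2f_M\pi_{\min}}\big(\frac{\gamma\lambda_G^2}{\lambda_2^3}+\gamma\alpha\big)$, then for all $i\in\{1,\dots,N\}$ and $j\in N_i'$, $$\lim_{t\to\infty}E[(K_2x_i(t)-K_2\bar x(t))^2]=0,\qquad\lim_{t\to\infty}E[(\hat z_{ij}(t)-K_2x_j(t))^2]=0.$$ (ii) If $\gamma>\frac1{\lambda_2}$ and $\beta>\frac{1}{2f_M\pi_{\min}}\big(\frac{\gamma^2\lambda_G^2}{\lambda_2^2(\gamma\lambda_2-1)}+\gamma\alpha+1\big)$, then there is $C>0$ such that for all $i$, $j\in N_i'$, $t\ge t_0+1$, $$E[(K_2x_i(t)-K_2\bar x(t))^2]\le\frac Ct,\qquad E[(\hat z_{ij}(t)-K_2x_j(t))^2]\le\frac Ct.$$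
   Context: Fix integers $n\ge 2$ and $N\ge 2$. Let $a_1,\dots,a_n\in\mathbb{R}$, let $A\in\mathbb{R}^{n\times n}$ be the matrix with $A_{k,k+1}=1$ for $k=1,\dots,n-1$, last row $(a_1,a_2,\dots,a_n)$, and all other entries $0$, and let $B=(0,\dots,0,1)^T\in\mathbb{R}^n$. There are $N$ agents with dynamics $x_i(t+1)=Ax_i(t)+Bu_i(t)$, $i=1,\dots,N$, where $x_i(t)\in\mathbb{R}^n$ and $u_i(t)\in\mathbb{R}$; write $\bar x(t)=\frac1N\sum_{i=1}^N x_i(t)$. Gains: real numbers $b_1,\dots,b_{n-1}$, $K_2=[b_1,\dots,b_{n-1},1]$, $K_1=[-a_1+b_1,\,-a_2+b_2-b_1,\,\dots,\,-a_{n-1}+b_{n-1}-b_{n-2},\,-a_n-b_{n-1}+1]$. Switching topologies: $G_1,\dots,G_h$ are undirected graphs on $\{1,\dots,N\}$ with edge sets $E_1,\dots,E_h$ and Laplacians $L_1,\dots,L_h$; their union $G'$ (edge set $E_1\cup\dots\cup E_h$) is connected. $N_i'$ is the neighbor set of $i$ in $G'$, $d_i'=|N_i'|$, $d'_{\max}=\max_i d_i'$; $N_i^{(u)}$ is the neighbor set of $i$ in $G_u$. $\{m(t)\}$ is a homogeneous Markov chain on $\{1,\dots,h\}$ with irreducible aperiodic transition matrix, stationary distribution $\pi=(\pi_1,\dots,\pi_h)$, $\pi_{\min}=\min_u\pi_u$, independent of the noises. $\check L=\sum_u\pi_uL_u$ has eigenvalues $0=\lambda_1<\lambda_2\le\dots\le\lambda_N$.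 Communication: for every ordered pair $(i,j)$ with $j\in N_i'$ and every $t$, $s_{ij}(t)=1$ if $K_2x_j(t)+d_{ij}(t)\le c_{ij}$ and $0$ otherwise, with fixed thresholds $c_{ij}\in\mathbb R$ and noises $d_{ij}(t)$ i.i.d. $N(0,\sigma^2)$, $\sigma>0$; $F,f$ are the distribution function and density of $N(0,\sigma^2)$. Algorithm: fix $\beta>0$, $\gamma>0$, an integer $t_0>\gamma d'_{\max}-1$, deterministic $x_i(t_0+1)=x_i^0$, $\hat z_{ij}(t_0)=\hat z^0_{ij}$ ($j\in N_i'$), and $M>0$ with $|K_2x_i^0|\le M$, $|\hat z^0_{ij}|\le M$. $\Pi_M(\zeta)=\max\{-M,\min\{M,\zeta\}\}$. For $t\ge t_0+1$, all $i$ and $j\in N_i'$: $\hat z_{ij}(t)=\Pi_M\big(\hat z_{ij}(t-1)+\tfrac{\beta}{t}\mathbb 1\{j\in N_i^{(m(t))}\}(F(c_{ij}-\hat z_{ij}(t-1))-s_{ij}(t))\big)$, $u_i(t)=K_1x_i(t)+\frac{\gamma}{t+1}\sum_{j\in N_i^{(m(t))}}(\hat z_{ij}(t)-K_2x_i(t))$. Constants: enumerate the $d'=\sum_id_i'$ ordered pairs $(i,j)$, $j\in N_i'$, as $p=1,\dots,d'$. $Q\in\mathbb R^{d'\times N}$ with $Q_{p,k}=1$ if pair $p$ has second component $k$, else $0$; $W_u\in\mathbb R^{N\times d'}$ with $(W_u)_{k,p}=1$ if pair $p=(k,j)$ has first component $k$ and $\{k,j\}\in E_u$, else $0$; $J_N=I_N-\frac1N\mathbf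 1\mathbf 1^T$. With spectral norm $\|\cdot\|$: $\lambda_G=\max_u\|J_NW_u\|^2$, $\lambda_{QW}=\max_u\|QW_u\|^2$, $\lambda_{QL}=\max_u\|QL_u\|^2$, $\alpha=2\sqrt{\lambda_{QW}}+\lambda_{QL}\lambda_2/\lambda_G$, $f_M=\min_{(i,j):\,j\in N_i'}f(|c_{ij}|+M)$. *)

theory Defs
  imports "HOL-Probability.Probability" "Jordan_Normal_Form.Matrix" "Jordan_Normal_Form.Char_Poly"
begin

text \<open>Conventions: agents are indexed 0..N-1, states of the Markov chain (topologies) 0..h-1,
  components of the state vectors 0..n-1 (i.e. everything is shifted by one w.r.t. the paper).
  Coefficients: a k = a_{k+1} (k < n), b k = b_{k+1} (k < n-1).
  Graph u (u < h) is given by its edge set E u, a set of two-element sets {i,j}.\<close>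

section \<open>Agent dynamics and gains\<close>

definition Amat :: "nat \<Rightarrow> (nat \<Rightarrow> real) \<Rightarrow> real mat" where
  "Amat n a = mat n n (\<lambda>(r,c). if r < n - 1 then (if c = r + 1 then 1 else 0) else a c)"

definition Bvec :: "nat \<Rightarrow> real vec" where
  "Bvec n = unit_vec n (n - 1)"

definition K2v :: "nat \<Rightarrow> (nat \<Rightarrow> real) \<Rightarrow> real vec" where
  "K2v n b = vec n (\<lambda>c. if c < n - 1 then b c else 1)"

definition K1v :: "nat \<Rightarrow> (nat \<Rightarrow> real) \<Rightarrow> (nat \<Rightarrow> real) \<Rightarrow> real vec" where
  "K1v n a b = vec n (\<lambda>c. if c = 0 then - a 0 + b 0
                         else if c < n - 1 then - a c + b c - b (c - 1)
                         else - a (n - 1) - b (n - 2) + 1)"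

section \<open>Graphs\<close>

text \<open>Neighbour set of i in G_u.\<close>
definition nbr :: "(nat \<Rightarrow> nat set set) \<Rightarrow> nat \<Rightarrow> nat \<Rightarrow> nat set" where
  "nbr E u i = {j. {i, j} \<in> E u}"

text \<open>Neighbour set N_i' of i in the union graph G'.\<close>
definition nbrU :: "nat \<Rightarrow> (nat \<Rightarrow> nat set set) \<Rightarrow> nat \<Rightarrow> nat set" where
  "nbrU h E i = {j. \<exists>u<h. {i, j} \<in> E u}"

definition valid_graphs :: "nat \<Rightarrow> nat \<Rightarrow> (nat \<Rightarrow> nat set set) \<Rightarrow> bool" where
  "valid_graphs N h E \<longleftrightarrow>
     (\<forall>u<h. \<forall>e\<in>E u. \<exists>i j. e = {i, j} \<and> i \<noteq> j \<and> i < N \<and> j < N)"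

definition union_connected :: "nat \<Rightarrow> nat \<Rightarrow> (nat \<Rightarrow> nat set set) \<Rightarrow> bool" where
  "union_connected N h E \<longleftrightarrow>
     (\<forall>i<N. \<forall>j<N. (i, j) \<in> {(k, l). \<exists>u<h. {k, l} \<in> E u}\<^sup>*)"

text \<open>Ordered pairs (i,j) with j in N_i'.\<close>
definition pairs :: "nat \<Rightarrow> nat \<Rightarrow> (nat \<Rightarrow> nat set set) \<Rightarrow> (nat \<times> nat) set" where
  "pairs N h E = {(i, j). i < N \<and> j \<in> nbrU h E i}"

definition dmax :: "nat \<Rightarrow> nat \<Rightarrow> (nat \<Rightarrow> nat set set) \<Rightarrow> nat" where
  "dmax N h E = Max ((\<lambda>i. card (nbrU h E i)) ` {..<N})"

definition laplacian :: "nat \<Rightarrow> (nat \<Rightarrow> nat set set) \<Rightarrow> nat \<Rightarrow> real mat" where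
  "laplacian N E u = mat N N (\<lambda>(i, j). if i = j then real (card (nbr E u i))
                                     else if {i, j} \<in> E u then -1 else 0)"

section \<open>Matrix notions\<close>

text \<open>Spectral norm = operator norm induced by the Euclidean norm.\<close>
definition spec_norm :: "real mat \<Rightarrow> real" where
  "spec_norm A = Sup {sqrt (scalar_prod (mult_mat_vec A v) (mult_mat_vec A v)) | v.
                        v \<in> carrier_vec (dim_col A) \<and> scalar_prod v v = 1}"

text \<open>Eigenvalues with algebraic multiplicity (roots of the characteristic polynomial),
  listed in increasing order; eig_sorted A ! 1 is the second smallest eigenvalue.\<close>
definition eig_mset :: "real mat \<Rightarrow> real multiset" where
  "eig_mset A = (\<Sum>x\<in>{x. poly (char_poly A) x = 0}. replicate_mset (order x (char_poly A)) x)"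

definition eig_sorted :: "real mat \<Rightarrow> real list" where
  "eig_sorted A = sorted_list_of_multiset (eig_mset A)"

section \<open>Constants of the theorem\<close>

definition pair_list :: "nat \<Rightarrow> nat \<Rightarrow> (nat \<Rightarrow> nat set set) \<Rightarrow> (nat \<times> nat) list" where
  "pair_list N h E = concat (map (\<lambda>i. map (\<lambda>j. (i, j)) (sorted_list_of_set (nbrU h E i))) [0..<N])"

definition Qmat :: "nat \<Rightarrow> nat \<Rightarrow> (nat \<Rightarrow> nat set set) \<Rightarrow> real mat" where
  "Qmat N h E = (let ps = pair_list N h E in
     mat (length ps) N (\<lambda>(p, k). if snd (ps ! p) = k then 1 else 0))"

definition Wmat :: "nat \<Rightarrow> nat \<Rightarrow> (nat \<Rightarrow> nat set set) \<Rightarrow> nat \<Rightarrow> real mat" where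
  "Wmat N h E u = (let ps = pair_list N h E in
     mat N (length ps) (\<lambda>(k, p). if fst (ps ! p) = k \<and> {k, snd (ps ! p)} \<in> E u then 1 else 0))"

definition Jmat :: "nat \<Rightarrow> real mat" where
  "Jmat N = 1\<^sub>m N - (1 / real N) \<cdot>\<^sub>m mat N N (\<lambda>_. 1)"

definition Lcheck :: "nat \<Rightarrow> nat \<Rightarrow> (nat \<Rightarrow> nat set set) \<Rightarrow> (nat \<Rightarrow> real) \<Rightarrow> real mat" where
  "Lcheck N h E \<pi> = mat N N (\<lambda>(i, j). \<Sum>u<h. \<pi> u * laplacian N E u $$ (i, j))"

definition lambda2 :: "nat \<Rightarrow> nat \<Rightarrow> (nat \<Rightarrow> nat set set) \<Rightarrow> (nat \<Rightarrow> real) \<Rightarrow> real" where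
  "lambda2 N h E \<pi> = eig_sorted (Lcheck N h E \<pi>) ! 1"

definition lambdaG :: "nat \<Rightarrow> nat \<Rightarrow> (nat \<Rightarrow> nat set set) \<Rightarrow> real" where
  "lambdaG N h E = Max ((\<lambda>u. (spec_norm (Jmat N * Wmat N h E u))\<^sup>2) ` {..<h})"

definition lambdaQW :: "nat \<Rightarrow> nat \<Rightarrow> (nat \<Rightarrow> nat set set) \<Rightarrow> real" where
  "lambdaQW N h E = Max ((\<lambda>u. (spec_norm (Qmat N h E * Wmat N h E u))\<^sup>2) ` {..<h})"

definition lambdaQL :: "nat \<Rightarrow> nat \<Rightarrow> (nat \<Rightarrow> nat set set) \<Rightarrow> real" where
  "lambdaQL N h E = Max ((\<lambda>u. (spec_norm (Qmat N h E * laplacian N E u))\<^sup>2) ` {..<h})"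

definition alpha_const :: "nat \<Rightarrow> nat \<Rightarrow> (nat \<Rightarrow> nat set set) \<Rightarrow> (nat \<Rightarrow> real) \<Rightarrow> real" where
  "alpha_const N h E \<pi> = 2 * sqrt (lambdaQW N h E)
      + lambdaQL N h E * lambda2 N h E \<pi> / lambdaG N h E"

definition fM_const :: "nat \<Rightarrow> nat \<Rightarrow> (nat \<Rightarrow> nat set set) \<Rightarrow> (nat \<Rightarrow> nat \<Rightarrow> real) \<Rightarrow> real \<Rightarrow> real \<Rightarrow> real" where
  "fM_const N h E c \<sigma> Mb = Min ((\<lambda>(i, j). normal_density 0 \<sigma> (\<bar>c i j\<bar> + Mb)) ` pairs N h E)"

section \<open>Noise distribution function and the algorithm\<close>

text \<open>Distribution function of N(0, sigma^2).\<close>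
definition Fcdf :: "real \<Rightarrow> real \<Rightarrow> real" where
  "Fcdf \<sigma> x = cdf (density lborel (\<lambda>y. ennreal (normal_density 0 \<sigma> y))) x"

definition projM :: "real \<Rightarrow> real \<Rightarrow> real" where
  "projM Mb z = max (- Mb) (min Mb z)"

text \<open>traj ... k = (x(t0+1+k), zhat(t0+k)) along a fixed realisation ms (of the chain m)
  and dp (dp i j t = d_ij(t)).\<close>
primrec traj :: "nat \<Rightarrow> (nat \<Rightarrow> real) \<Rightarrow> (nat \<Rightarrow> real) \<Rightarrow> (nat \<Rightarrow> nat set set)
   \<Rightarrow> (nat \<Rightarrow> nat \<Rightarrow> real) \<Rightarrow> real \<Rightarrow> real \<Rightarrow> real \<Rightarrow> nat \<Rightarrow> real
   \<Rightarrow> (nat \<Rightarrow> real vec) \<Rightarrow> (nat \<Rightarrow> nat \<Rightarrow> real)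
   \<Rightarrow> (nat \<Rightarrow> nat) \<Rightarrow> (nat \<Rightarrow> nat \<Rightarrow> nat \<Rightarrow> real)
   \<Rightarrow> nat \<Rightarrow> (nat \<Rightarrow> real vec) \<times> (nat \<Rightarrow> nat \<Rightarrow> real)" where
  "traj n a b E c \<sigma> \<beta> \<gamma> t0 Mb x0 z0 ms dp 0 = (x0, z0)"
| "traj n a b E c \<sigma> \<beta> \<gamma> t0 Mb x0 z0 ms dp (Suc k) =
    (let t = t0 + 1 + k;
         x = fst (traj n a b E c \<sigma> \<beta> \<gamma> t0 Mb x0 z0 ms dp k);
         zp = snd (traj n a b E c \<sigma> \<beta> \<gamma> t0 Mb x0 z0 ms dp k);
         u = ms t;
         s = (\<lambda>i j. if scalar_prod (K2v n b) (x j) + dp i j t \<le> c i j then 1 else 0 :: real);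
         z = (\<lambda>i j. projM Mb (zp i j + \<beta> / real t * (if j \<in> nbr E u i then 1 else 0)
                                         * (Fcdf \<sigma> (c i j - zp i j) - s i j)));
         uc = (\<lambda>i. scalar_prod (K1v n a b) (x i)
                 + \<gamma> / real (t + 1) * (\<Sum>j\<in>nbr E u i. z i j - scalar_prod (K2v n b) (x i)))
     in (\<lambda>i. mult_mat_vec (Amat n a) (x i) + uc i \<cdot>\<^sub>v Bvec n, z))"

text \<open>x_i(t) for t \<ge> t0+1 and zhat_ij(t) for t \<ge> t0.\<close>
definition xstate where
  "xstate n a b E c \<sigma> \<beta> \<gamma> t0 Mb x0 z0 ms dp t i =
     fst (traj n a b E c \<sigma> \<beta> \<gamma> t0 Mb x0 z0 ms dp (t - t0 - 1)) i"

definition zstate where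
  "zstate n a b E c \<sigma> \<beta> \<gamma> t0 Mb x0 z0 ms dp t i j =
     snd (traj n a b E c \<sigma> \<beta> \<gamma> t0 Mb x0 z0 ms dp (t - t0)) i j"

text \<open>Average state bar x(t).\<close>
definition xbar :: "nat \<Rightarrow> nat \<Rightarrow> (nat \<Rightarrow> real vec) \<Rightarrow> real vec" where
  "xbar n N x = vec n (\<lambda>k. (1 / real N) * (\<Sum>i<N. vec_index (x i) k))"

section \<open>Markov chain\<close>

definition stochastic_mat :: "nat \<Rightarrow> real mat \<Rightarrow> bool" where
  "stochastic_mat h P \<longleftrightarrow> P \<in> carrier_mat h h \<and> (\<forall>u<h. \<forall>v<h. P $$ (u, v) \<ge> 0)
     \<and> (\<forall>u<h. (\<Sum>v<h. P $$ (u, v)) = 1)"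

definition irreducible_mat :: "nat \<Rightarrow> real mat \<Rightarrow> bool" where
  "irreducible_mat h P \<longleftrightarrow> (\<forall>u<h. \<forall>v<h. \<exists>k. (P ^\<^sub>m k) $$ (u, v) > 0)"

definition aperiodic_mat :: "nat \<Rightarrow> real mat \<Rightarrow> bool" where
  "aperiodic_mat h P \<longleftrightarrow> (\<forall>u<h. Gcd {k. 0 < k \<and> (P ^\<^sub>m k) $$ (u, u) > 0} = (1::nat))"

definition stationary_dist :: "nat \<Rightarrow> real mat \<Rightarrow> (nat \<Rightarrow> real) \<Rightarrow> bool" where
  "stationary_dist h P \<pi> \<longleftrightarrow> (\<forall>u<h. \<pi> u \<ge> 0) \<and> (\<Sum>u<h. \<pi> u) = 1
     \<and> (\<forall>v<h. (\<Sum>u<h. \<pi> u * P $$ (u, v)) = \<pi> v)"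

text \<open>m is a homogeneous Markov chain on {0..<h} with transition matrix P.\<close>
definition markov_chain :: "'a measure \<Rightarrow> nat \<Rightarrow> real mat \<Rightarrow> (nat \<Rightarrow> 'a \<Rightarrow> nat) \<Rightarrow> bool" where
  "markov_chain M h P m \<longleftrightarrow>
     (\<forall>t. m t \<in> measurable M (count_space UNIV)) \<and>
     (\<forall>t. \<forall>\<omega>\<in>space M. m t \<omega> < h) \<and>
     (\<forall>t (s :: nat \<Rightarrow> nat). (\<forall>k. s k < h) \<longrightarrow>
        measure M {\<omega>\<in>space M. \<forall>k\<le>Suc t. m k \<omega> = s k}
        = measure M {\<omega>\<in>space M. \<forall>k\<le>t. m k \<omega> = s k} * P $$ (s t, s (Suc t)))"

end

theory Submission
  imports Defs
begin

text \<open>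
  The gains satisfy \<open>K\<^sub>2 A + K\<^sub>1 = K\<^sub>2\<close> and \<open>K\<^sub>2 B = 1\<close>, so the scalars \<open>y\<^sub>i = K\<^sub>2 x\<^sub>i\<close> follow a
  first-order consensus recursion driven by the estimates, and all of them stay in \<open>[-M, M]\<close>. Put
  \<open>V = |y - avg y|\<^sup>2\<close> and \<open>R = |z - Q y|\<^sup>2\<close>. Up to \<open>O(1/t\<^sup>2)\<close> and a term of mean zero coming from the
  noise, one step changes \<open>V + w R\<close> by \<open>1/t\<close> times a drift depending on the current graph.
  Averaging that drift over the stationary law of the chain, Young's inequality bounds it by
  \<open>-\<kappa> (V + w R)\<close>; a weight \<open>w > 0\<close> with \<open>\<kappa> > 0\<close> (respectively \<open>\<kappa> > 1\<close>) exists exactly under the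
  assumption on \<open>\<beta>\<close> in part (i) (respectively (ii)).
  The difference between the drift of the current graph and its stationary average is removed by
  the Poisson equation \<open>(I - P) G = g - \<pi> g\<close>: since the state moves by \<open>O(1/t)\<close> per step, that
  difference has the expectation of a telescoping term plus \<open>O(1/t)\<close>. This leaves the scalar
  recursion \<open>T(t+1) \<le> (1 - \<kappa>/t) T(t) + C/t\<^sup>2\<close>.
\<close>

section \<open>Spectral norm\<close>

text \<open>At a given time the graph may be disconnected, so a single step need not contract
  \<open>V\<close>, and the current graph is correlated with the state. Hence the graph-dependent
  part of the drift is kept exactly (\<open>sw_drift\<close>) until it can be averaged; only the
  cross terms are estimated graph by graph, with constants uniform over the graphs. Put
  \<open>a = \<gamma> * lambda2\<close>, \<open>b = \<gamma> * lambdaG / lambda2\<close> and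
  \<open>d = 2 * \<beta> * fM * pimin - \<gamma> * \<alpha>\<close>. Young's inequality makes the
  averaged drift at most \<open>- (a - w * b) * V - (w * d - b) * R\<close>. A weight
  \<open>w\<close> with rate above \<kappa>0 exists when \<open>a > \<kappa>0\<close> and
  \<open>b^2 < (a - \<kappa>0) * (d - \<kappa>0)\<close>; solved for \<beta>, the cases \<kappa>0 =
  0 and \<kappa>0 = 1 are the two thresholds. The value 1 is critical because a forcing of order
  \<open>1/t^2\<close> lets the recursion decay like \<open>1/t\<close> only if \<kappa> > 1.
  Conditioning on the chain is replaced by finite sums over its histories: for a frozen history the
  state is a function of the noise alone, and independence factorises every summand.\<close>

lemma index_mult_mat_sum:
  fixes A B :: "'a::semiring_0 mat"
  assumes "A \<in> carrier_mat r q" "B \<in> carrier_mat q s" "i < r" "j < s"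
  shows "(A * B) $$ (i, j) = (\<Sum>k<q. A $$ (i, k) * B $$ (k, j))"
  using assms by (auto simp: scalar_prod_def atLeast0LessThan intro!: sum.cong)

lemma index_mult_mat_vec_sum:
  fixes A :: "'a::semiring_0 mat"
  assumes "A \<in> carrier_mat r q" "v \<in> carrier_vec q" "i < r"
  shows "vec_index (A *\<^sub>v v) i = (\<Sum>k<q. A $$ (i, k) * vec_index v k)"
  using assms by (auto simp: scalar_prod_def atLeast0LessThan intro!: sum.cong)

lemma scalar_prod_sum:
  assumes "w \<in> carrier_vec q"
  shows "scalar_prod v w = (\<Sum>k<q. vec_index v k * vec_index w k)"
  using assms by (auto simp: scalar_prod_def atLeast0LessThan)

text \<open>A crude Frobenius bound. It makes the set under the supremum in \<open>spec_norm\<close>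
  bounded, and it settles the case of a zero vector, which cannot be normalised.\<close>

lemma mult_mat_vec_norm_bound:
  fixes A :: "real mat"
  assumes A: "A \<in> carrier_mat r q" and v: "v \<in> carrier_vec q"
  shows "scalar_prod (A *\<^sub>v v) (A *\<^sub>v v) \<le> (\<Sum>i<r. \<Sum>j<q. (A $$ (i, j))\<^sup>2) * scalar_prod v v"
proof -
  have "scalar_prod (A *\<^sub>v v) (A *\<^sub>v v) = (\<Sum>i<r. (\<Sum>j<q. A $$ (i, j) * vec_index v j)\<^sup>2)"
    using A v by (subst scalar_prod_sum[where q=r])
      (auto simp: index_mult_mat_vec_sum[OF A v] power2_eq_square simp del: index_mult_mat_vec intro!: sum.cong)
  also have "\<dots> \<le> (\<Sum>i<r. (\<Sum>j<q. (A $$ (i, j))\<^sup>2) * (\<Sum>j<q. (vec_index v j)\<^sup>2))"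
    by (intro sum_mono Cauchy_Schwarz_ineq_sum)
  also have "\<dots> = (\<Sum>i<r. \<Sum>j<q. (A $$ (i, j))\<^sup>2) * scalar_prod v v"
    by (simp add: scalar_prod_sum[OF v] power2_eq_square sum_distrib_right)
  finally show ?thesis .
qed

lemma spec_norm_mult_mat_vec:
  assumes A: "A \<in> carrier_mat r q" and v: "v \<in> carrier_vec q"
  shows "sqrt (scalar_prod (A *\<^sub>v v) (A *\<^sub>v v)) \<le> spec_norm A * sqrt (scalar_prod v v)"
proof (cases "scalar_prod v v = 0")
  case True
  then show ?thesis using mult_mat_vec_norm_bound[OF A v] by simp
next
  case False
  let ?S = "{sqrt (scalar_prod (A *\<^sub>v v) (A *\<^sub>v v)) | v. v \<in> carrier_vec (dim_col A) \<and> scalar_prod v v = 1}"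
  have bdd: "bdd_above ?S"
  proof (rule bdd_aboveI)
    fix s assume "s \<in> ?S"
    then obtain v where "v \<in> carrier_vec q" "scalar_prod v v = 1" "s = sqrt (scalar_prod (A *\<^sub>v v) (A *\<^sub>v v))"
      using A by auto
    then show "s \<le> sqrt (\<Sum>i<r. \<Sum>j<q. (A $$ (i, j))\<^sup>2)"
      using mult_mat_vec_norm_bound[OF A, of v] by simp
  qed
  define c where "c = sqrt (scalar_prod v v)"
  have nn: "scalar_prod v v \<ge> 0"
    by (simp add: scalar_prod_sum[OF v] sum_nonneg)
  have c: "c > 0" "c * c = scalar_prod v v" using False nn by (auto simp: c_def)
  define w where "w = (1 / c) \<cdot>\<^sub>v v"
  have w: "w \<in> carrier_vec q" using v by (simp add: w_def)
  have "scalar_prod w w = 1"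
    using v c False by (simp add: w_def)
  then have "sqrt (scalar_prod (A *\<^sub>v w) (A *\<^sub>v w)) \<le> spec_norm A"
    unfolding spec_norm_def using A w by (intro cSup_upper bdd) auto
  moreover have "A *\<^sub>v w = (1 / c) \<cdot>\<^sub>v (A *\<^sub>v v)"
    unfolding w_def by (rule mult_mat_vec[OF A v])
  then have "scalar_prod (A *\<^sub>v w) (A *\<^sub>v w) = scalar_prod (A *\<^sub>v v) (A *\<^sub>v v) / c\<^sup>2"
    using A v by (simp add: power2_eq_square)
  then have "sqrt (scalar_prod (A *\<^sub>v w) (A *\<^sub>v w)) = sqrt (scalar_prod (A *\<^sub>v v) (A *\<^sub>v v)) / c"
    using c by (simp add: real_sqrt_divide)
  ultimately show ?thesis using c(1) by (simp add: c_def[symmetric] field_simps)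
qed

text \<open>The form in which all spectral constants enter: Cauchy-Schwarz plus the operator norm,
  for coordinates given as plain functions rather than vectors.\<close>

lemma spec_norm_bilinear:
  assumes A: "A \<in> carrier_mat r q"
  shows "\<bar>\<Sum>i<r. x i * (\<Sum>j<q. A $$ (i, j) * y j)\<bar>
    \<le> spec_norm A * sqrt (\<Sum>i<r. (x i)\<^sup>2) * sqrt (\<Sum>j<q. (y j)\<^sup>2)"
proof -
  define v where "v = vec q y"
  have v: "v \<in> carrier_vec q" by (simp add: v_def)
  let ?Av = "\<lambda>i. \<Sum>j<q. A $$ (i, j) * y j"
  have Av: "vec_index (A *\<^sub>v v) i = ?Av i" if "i < r" for i
    using index_mult_mat_vec_sum[OF A v that] by (simp add: v_def)
  have sq: "scalar_prod (A *\<^sub>v v) (A *\<^sub>v v) = (\<Sum>i<r. (?Av i)\<^sup>2)"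
    using A v by (subst scalar_prod_sum[where q=r]) (auto simp: Av power2_eq_square simp del: index_mult_mat_vec)
  have sv: "scalar_prod v v = (\<Sum>j<q. (y j)\<^sup>2)"
    by (simp add: scalar_prod_sum[OF v]) (simp add: v_def power2_eq_square)
  have "\<bar>\<Sum>i<r. x i * ?Av i\<bar> \<le> sqrt (\<Sum>i<r. (x i)\<^sup>2) * sqrt (\<Sum>i<r. (?Av i)\<^sup>2)"
    by (rule real_le_rsqrt[THEN order_trans]) 
      (use Cauchy_Schwarz_ineq_sum[of x ?Av "{..<r}"] in \<open>auto simp: real_sqrt_mult\<close>)
  also have "\<dots> \<le> sqrt (\<Sum>i<r. (x i)\<^sup>2) * (spec_norm A * sqrt (\<Sum>j<q. (y j)\<^sup>2))"
    using spec_norm_mult_mat_vec[OF A v] unfolding sq sv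
    by (intro mult_left_mono) (auto intro: sum_nonneg)
  finally show ?thesis by (simp add: mult_ac)
qed

section \<open>Finite Markov chains\<close>

lemma stochastic_pow:
  assumes "stochastic_mat h P"
  shows "stochastic_mat h (P ^\<^sub>m k)"
proof (induction k)
  case 0
  then show ?case using assms by (auto simp: stochastic_mat_def)
next
  case (Suc k)
  have P: "P \<in> carrier_mat h h" "P ^\<^sub>m k \<in> carrier_mat h h"
    using assms Suc by (auto simp: stochastic_mat_def)
  have ix: "(P ^\<^sub>m Suc k) $$ (u, v) = (\<Sum>w<h. (P ^\<^sub>m k) $$ (u, w) * P $$ (w, v))" if "u < h" "v < h" for u v
    using index_mult_mat_sum[OF P(2) P(1) that] by simp
  have "(\<Sum>v<h. \<Sum>w<h. (P ^\<^sub>m k) $$ (u, w) * P $$ (w, v)) = 1" if "u < h" for u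
  proof -
    have "(\<Sum>v<h. \<Sum>w<h. (P ^\<^sub>m k) $$ (u, w) * P $$ (w, v))
        = (\<Sum>w<h. (P ^\<^sub>m k) $$ (u, w) * (\<Sum>v<h. P $$ (w, v)))"
      by (subst sum.swap) (simp add: sum_distrib_left)
    also have "\<dots> = 1" using assms Suc that by (simp add: stochastic_mat_def)
    finally show ?thesis .
  qed
  then show ?case
    using assms Suc P unfolding stochastic_mat_def
    by (auto simp: ix simp del: pow_mat.simps intro!: sum_nonneg mult_nonneg_nonneg)
qed

lemma harmonic_pow:
  assumes st: "stochastic_mat h P" and harm: "\<And>u. u < h \<Longrightarrow> (\<Sum>v<h. P $$ (u, v) * f v) = f u"
    and u: "u < h"
  shows "(\<Sum>v<h. (P ^\<^sub>m k) $$ (u, v) * f v) = f u"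
proof (induction k)
  case 0
  have "P \<in> carrier_mat h h" using st by (simp add: stochastic_mat_def)
  then have "(\<Sum>v<h. (P ^\<^sub>m 0) $$ (u, v) * f v) = (\<Sum>v<h. if u = v then f v else 0)"
    using u by (intro sum.cong) auto
  then show ?case using u by simp
next
  case (Suc k)
  have P: "P \<in> carrier_mat h h" "P ^\<^sub>m k \<in> carrier_mat h h"
    using st stochastic_pow[OF st] by (auto simp: stochastic_mat_def)
  have "(\<Sum>v<h. (P ^\<^sub>m Suc k) $$ (u, v) * f v)
      = (\<Sum>v<h. \<Sum>w<h. (P ^\<^sub>m k) $$ (u, w) * P $$ (w, v) * f v)"
    using index_mult_mat_sum[OF P(2) P(1) u] by (simp add: sum_distrib_right)
  also have "\<dots> = (\<Sum>w<h. (P ^\<^sub>m k) $$ (u, w) * (\<Sum>v<h. P $$ (w, v) * f v))"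
    by (subst sum.swap) (simp add: sum_distrib_left mult.assoc)
  also have "\<dots> = f u" using Suc harm by simp
  finally show ?case .
qed

text \<open>Maximum principle: at a maximiser \<open>w\<close> the \<open>P^k\<close>-average of the
  nonnegative differences \<open>f w - f v\<close> vanishes, and irreducibility supplies for each
  state a \<open>k\<close> that gives it positive weight.\<close>

lemma harmonic_const:
  assumes st: "stochastic_mat h P" and irr: "irreducible_mat h P"
    and harm: "\<And>u. u < h \<Longrightarrow> (\<Sum>v<h. P $$ (u, v) * f v) = (f u :: real)"
    and "u < h" "v < h"
  shows "f u = f v"
proof -
  have fin: "finite (f ` {..<h})" and ne: "f ` {..<h} \<noteq> {}" using \<open>u < h\<close> by auto
  obtain w where w: "w < h" "f w = Max (f ` {..<h})" using Max_in[OF fin ne] by fastforce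
  have le: "f x \<le> f w" if "x < h" for x using w fin that by simp
  have "f x = f w" if x: "x < h" for x
  proof -
    obtain k where k: "(P ^\<^sub>m k) $$ (w, x) > 0"
      using irr w x unfolding irreducible_mat_def by blast
    note stk = stochastic_pow[OF st, of k]
    have "(\<Sum>v<h. (P ^\<^sub>m k) $$ (w, v) * (f w - f v))
       = (\<Sum>v<h. (P ^\<^sub>m k) $$ (w, v)) * f w - (\<Sum>v<h. (P ^\<^sub>m k) $$ (w, v) * f v)"
      by (simp add: algebra_simps sum_subtractf sum_distrib_left)
    also have "\<dots> = 0" using harmonic_pow[OF st harm w(1), of k] stk w by (simp add: stochastic_mat_def)
    finally have "\<forall>v\<in>{..<h}. (P ^\<^sub>m k) $$ (w, v) * (f w - f v) = 0"
      using stk w le by (subst (asm) sum_nonneg_eq_0_iff) (auto simp: stochastic_mat_def)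
    then have "(P ^\<^sub>m k) $$ (w, x) * (f w - f x) = 0" using x by blast
    then show ?thesis using k by simp
  qed
  then show ?thesis using assms(4,5) by metis
qed

text \<open>Some state carries mass, and by invariance under \<open>P^k\<close> part of this mass
  reaches \<open>v\<close> for a suitable \<open>k\<close>.\<close>

lemma stationary_pos:
  assumes st: "stochastic_mat h P" and irr: "irreducible_mat h P" and pi: "stationary_dist h P \<pi>"
    and v: "v < h"
  shows "\<pi> v > 0"
proof -
  have inv: "(\<Sum>u<h. \<pi> u * (P ^\<^sub>m k) $$ (u, v)) = \<pi> v" if "v < h" for k v
    using that
  proof (induction k arbitrary: v)
    case 0
    have "P \<in> carrier_mat h h" using st by (simp add: stochastic_mat_def)
    then have "(\<Sum>u<h. \<pi> u * (P ^\<^sub>m 0) $$ (u, v)) = (\<Sum>u<h. if u = v then \<pi> u else 0)"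
      using 0 by (intro sum.cong) auto
    then show ?case using 0 by simp
  next
    case (Suc k)
    have P: "P \<in> carrier_mat h h" "P ^\<^sub>m k \<in> carrier_mat h h"
      using st stochastic_pow[OF st] by (auto simp: stochastic_mat_def)
    have "(\<Sum>u<h. \<pi> u * (P ^\<^sub>m Suc k) $$ (u, v))
      = (\<Sum>u<h. \<Sum>w<h. \<pi> u * (P ^\<^sub>m k) $$ (u, w) * P $$ (w, v))"
      using index_mult_mat_sum[OF P(2) P(1) _ Suc.prems] by (simp add: sum_distrib_left mult.assoc)
    also have "\<dots> = (\<Sum>w<h. (\<Sum>u<h. \<pi> u * (P ^\<^sub>m k) $$ (u, w)) * P $$ (w, v))"
      by (subst sum.swap) (simp add: sum_distrib_right)
    also have "\<dots> = \<pi> v" using Suc pi by (simp add: stationary_dist_def)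
    finally show ?case .
  qed
  have "\<exists>u<h. \<pi> u > 0"
  proof (rule ccontr)
    assume "\<not> ?thesis"
    then have "(\<Sum>u<h. \<pi> u) \<le> 0" by (intro sum_nonpos) (metis lessThan_iff not_less)
    then show False using pi by (simp add: stationary_dist_def)
  qed
  then obtain u where u: "u < h" "\<pi> u > 0" by blast
  obtain k where k: "(P ^\<^sub>m k) $$ (u, v) > 0"
    using irr u v unfolding irreducible_mat_def by blast
  have "0 < \<pi> u * (P ^\<^sub>m k) $$ (u, v)" using u k by simp
  also have "\<dots> \<le> (\<Sum>u<h. \<pi> u * (P ^\<^sub>m k) $$ (u, v))"
    using u v pi stochastic_pow[OF st, of k]
    by (intro member_le_sum) (auto simp: stationary_dist_def stochastic_mat_def)
  also have "\<dots> = \<pi> v" by (rule inv[OF v])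
  finally show ?thesis .
qed

text \<open>\<open>I - P\<close> annihilates the constants, so the system is solved for
  \<open>I - P\<close> plus the matrix all of whose rows are \<pi>. Applying \<pi> to a kernel
  vector shows that it is harmonic, hence constant, hence zero. Applying \<pi> to the solved system
  shows that the added part contributes nothing.\<close>

lemma poisson_equation:
  fixes g :: "nat \<Rightarrow> real"
  assumes st: "stochastic_mat h P" and irr: "irreducible_mat h P" and pi: "stationary_dist h P \<pi>"
  shows "\<exists>G. \<forall>u<h. g u - (\<Sum>v<h. \<pi> v * g v) = G u - (\<Sum>v<h. P $$ (u, v) * G v)"
proof -
  have P: "P \<in> carrier_mat h h" using st by (simp add: stochastic_mat_def)
  define A where "A = mat h h (\<lambda>(u, v). (if u = v then 1 else 0) - P $$ (u, v) + \<pi> v)"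
  have A: "A \<in> carrier_mat h h" by (simp add: A_def)
  have Av: "vec_index (A *\<^sub>v w) u = vec_index w u - (\<Sum>v<h. P $$ (u, v) * vec_index w v) + (\<Sum>v<h. \<pi> v * vec_index w v)"
    if w: "w \<in> carrier_vec h" and u: "u < h" for w u
  proof -
    have "vec_index (A *\<^sub>v w) u = (\<Sum>v<h. (if u = v then vec_index w v else 0) - P $$ (u, v) * vec_index w v + \<pi> v * vec_index w v)"
      unfolding index_mult_mat_vec_sum[OF A w u] using u
      by (auto simp: A_def algebra_simps intro!: sum.cong)
    then show ?thesis using u by (simp add: sum.distrib sum_subtractf)
  qed
  have piA: "(\<Sum>u<h. \<pi> u * (w u - (\<Sum>v<h. P $$ (u, v) * w v))) = 0" for w :: "nat \<Rightarrow> real"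
  proof -
    have "(\<Sum>u<h. \<pi> u * (\<Sum>v<h. P $$ (u, v) * w v)) = (\<Sum>v<h. (\<Sum>u<h. \<pi> u * P $$ (u, v)) * w v)"
      by (simp add: sum_distrib_left sum_distrib_right mult.assoc) (rule sum.swap)
    also have "\<dots> = (\<Sum>v<h. \<pi> v * w v)" using pi by (simp add: stationary_dist_def)
    finally show ?thesis by (simp add: algebra_simps sum_subtractf)
  qed
  have sumpi: "(\<Sum>u<h. \<pi> u) = 1" using pi by (simp add: stationary_dist_def)
  have "det A \<noteq> 0"
  proof
    assume "det A = 0"
    then obtain w where w: "w \<in> carrier_vec h" "w \<noteq> 0\<^sub>v h" "A *\<^sub>v w = 0\<^sub>v h"
      using det_0_iff_vec_prod_zero_field[OF A] by blast
    define c where "c = (\<Sum>v<h. \<pi> v * vec_index w v)"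
    have eq: "vec_index w u - (\<Sum>v<h. P $$ (u, v) * vec_index w v) = - c" if "u < h" for u
      using Av[OF w(1) that] w(3) that by (simp add: c_def)
    have "c = 0" using piA[of "vec_index w"] eq sumpi by (simp add: sum_distrib_right[symmetric] sum_negf)
    with eq have harm: "\<And>u. u < h \<Longrightarrow> (\<Sum>v<h. P $$ (u, v) * vec_index w v) = vec_index w u" by fastforce
    have const: "vec_index w u = vec_index w v" if "u < h" "v < h" for u v
      by (rule harmonic_const[OF st irr _ that]) (rule harm)
    have "vec_index w u = 0" if u: "u < h" for u
    proof -
      have "c = (\<Sum>v<h. \<pi> v * vec_index w u)" unfolding c_def by (intro sum.cong refl) (metis const lessThan_iff u)
      then show ?thesis using \<open>c = 0\<close> sumpi by (simp add: sum_distrib_right[symmetric])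
    qed
    then have "w = 0\<^sub>v h" using w(1) by auto
    then show False using w by simp
  qed
  then obtain B where B: "B \<in> carrier_mat h h" "A * B = 1\<^sub>m h"
    using det_non_zero_imp_unit[OF A, of "()"] by (auto simp: Units_def ring_mat_def)
  define r where "r = vec h (\<lambda>u. g u - (\<Sum>v<h. \<pi> v * g v))"
  define w where "w = B *\<^sub>v r"
  have r: "r \<in> carrier_vec h" by (simp add: r_def)
  have w: "w \<in> carrier_vec h" using B(1) r by (simp add: w_def)
  have "A *\<^sub>v w = r"
    unfolding w_def using assoc_mult_mat_vec[OF A B(1) r] B(2) r by simp
  then have eq: "g u - (\<Sum>v<h. \<pi> v * g v) = vec_index w u - (\<Sum>v<h. P $$ (u, v) * vec_index w v) + (\<Sum>v<h. \<pi> v * vec_index w v)"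
    if "u < h" for u
    using Av[OF w that] that by (simp add: r_def)
  have "(\<Sum>u<h. \<pi> u * (g u - (\<Sum>v<h. \<pi> v * g v))) = (\<Sum>v<h. \<pi> v * vec_index w v)"
  proof -
    have "(\<Sum>u<h. \<pi> u * (g u - (\<Sum>v<h. \<pi> v * g v)))
      = (\<Sum>u<h. \<pi> u * (vec_index w u - (\<Sum>v<h. P $$ (u, v) * vec_index w v)) + \<pi> u * (\<Sum>v<h. \<pi> v * vec_index w v))"
      by (intro sum.cong) (auto simp: eq distrib_left)
    then show ?thesis using piA[of "vec_index w"] sumpi by (simp add: sum.distrib sum_distrib_right[symmetric])
  qed
  moreover have "(\<Sum>u<h. \<pi> u * (g u - (\<Sum>v<h. \<pi> v * g v))) = 0"
    using sumpi by (simp add: right_diff_distrib sum_subtractf sum_distrib_right[symmetric])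
  ultimately show ?thesis using eq by (intro exI[of _ "vec_index w"]) auto
qed

section \<open>Second eigenvalue of a Laplacian\<close>

text \<open>The quadratic form attains its minimum on the unit sphere orthogonal to the constants by
  compactness, and homogeneity extends the bound to all vectors of sum zero.\<close>

lemma rayleigh_minimiser:
  fixes L :: "real mat"
  assumes N: "N \<ge> 2"
  defines "q \<equiv> \<lambda>v. \<Sum>i<N. v i * (\<Sum>j<N. L $$ (i, j) * v j)"
  shows "\<exists>w. (\<Sum>i<N. w i) = 0 \<and> (\<Sum>i<N. (w i)\<^sup>2) = 1 \<and>
    (\<forall>v. (\<Sum>i<N. v i) = 0 \<longrightarrow> q w * (\<Sum>i<N. (v i)\<^sup>2) \<le> q v)"
proof -
  \<comment> \<open>Vectors are total functions on the naturals. Fixing all coordinates from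
    \<open>N\<close> on to 0 makes this box compact by Tychonoff's theorem.\<close>
  define B where "B = (\<Pi>\<^sub>E i\<in>UNIV. if i < N then {-1..1::real} else {0})"
  define S where "S = B \<inter> {v. (\<Sum>i<N. v i) = 0} \<inter> {v. (\<Sum>i<N. (v i)\<^sup>2) = 1}"
  have cont: "continuous_on UNIV (\<lambda>v::nat \<Rightarrow> real. v i)" for i
    by (rule continuous_on_product_coordinates)
  have "compactin (product_topology (\<lambda>i. euclidean) UNIV) B"
    unfolding B_def by (subst compactin_PiE) auto
  then have "compact B"
    by (simp add: euclidean_product_topology)
  moreover have "closed {v :: nat \<Rightarrow> real. (\<Sum>i<N. v i) = 0}"
    by (intro closed_Collect_eq continuous_intros cont)
  moreover have "closed {v :: nat \<Rightarrow> real. (\<Sum>i<N. (v i)\<^sup>2) = 1}"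
    by (intro closed_Collect_eq continuous_intros cont)
  ultimately have compS: "compact S" unfolding S_def by (intro compact_Int_closed)
  have scale: "\<exists>w\<in>S. \<exists>c>0. (\<forall>i<N. v i = c * w i) \<and> c\<^sup>2 = (\<Sum>i<N. (v i)\<^sup>2)"
    if v: "(\<Sum>i<N. v i) = 0" and nz: "(\<Sum>i<N. (v i)\<^sup>2) \<noteq> 0" for v :: "nat \<Rightarrow> real"
  proof -
    define c where "c = sqrt (\<Sum>i<N. (v i)\<^sup>2)"
    have pos: "(\<Sum>i<N. (v i)\<^sup>2) > 0" using nz sum_nonneg[of "{..<N}" "\<lambda>i. (v i)\<^sup>2"] by fastforce
    then have c: "c > 0" "c\<^sup>2 = (\<Sum>i<N. (v i)\<^sup>2)" by (auto simp: c_def)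
    define w where "w = (\<lambda>i. if i < N then v i / c else 0)"
    have w1: "(\<Sum>i<N. w i) = 0" using v by (simp add: w_def sum_divide_distrib[symmetric])
    have w2: "(\<Sum>i<N. (w i)\<^sup>2) = 1"
      using c pos by (simp add: w_def power_divide sum_divide_distrib[symmetric])
    have "\<bar>w i\<bar> \<le> 1" if "i < N" for i
    proof -
      have "(w i)\<^sup>2 \<le> (\<Sum>i<N. (w i)\<^sup>2)" using that by (intro member_le_sum) auto
      then show ?thesis using w2 by (simp add: abs_square_le_1)
    qed
    then have "w i \<in> (if i < N then {-1..1} else {0})" for i
      by (cases "i < N") (auto simp: abs_le_iff w_def simp del: abs_divide)
    then have "w \<in> B" by (simp add: B_def PiE_def)
    then have "w \<in> S" using w1 w2 by (simp add: S_def)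
    moreover have "\<forall>i<N. v i = c * w i" using c by (simp add: w_def)
    ultimately show ?thesis using c by blast
  qed
  \<comment> \<open>The sphere is nonempty because there are two coordinates on which to place 1 and
    -1.\<close>
  define v0 where "v0 = (\<lambda>i::nat. if i = 0 then 1 else if i = 1 then -1 else 0 :: real)"
  have sub: "{..<N} = {0, 1} \<union> {2..<N}" using N by auto
  have "(\<Sum>i<N. v0 i) = 0" "(\<Sum>i<N. (v0 i)\<^sup>2) \<noteq> 0"
    unfolding sub by (subst sum.union_disjoint; simp add: v0_def)+
  then have "S \<noteq> {}" using scale by blast
  moreover have "continuous_on S q" unfolding q_def
    by (rule continuous_on_subset[OF _ subset_UNIV]) (intro continuous_intros cont)
  ultimately obtain w where w: "w \<in> S" "\<And>v. v \<in> S \<Longrightarrow> q w \<le> q v"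
    using continuous_attains_inf[OF compS] by blast
  have "q w * (\<Sum>i<N. (v i)\<^sup>2) \<le> q v" if v: "(\<Sum>i<N. v i) = 0" for v
  proof (cases "(\<Sum>i<N. (v i)\<^sup>2) = 0")
    case True
    then have "v i = 0" if "i < N" for i using that by (simp add: sum_nonneg_eq_0_iff)
    then have "q v = 0" by (simp add: q_def)
    then show ?thesis using True by simp
  next
    case False
    from scale[OF v this] obtain x c where x: "x \<in> S" "c > 0" "\<forall>i<N. v i = c * x i" "c\<^sup>2 = (\<Sum>i<N. (v i)\<^sup>2)"
      by blast
    have "q v = c\<^sup>2 * q x"
      unfolding q_def using x(3) by (simp add: sum_distrib_left power2_eq_square mult_ac)
    then show ?thesis using w(2)[OF x(1)] x(4) by (metis mult.commute mult_left_mono zero_le_power2)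
  qed
  then show ?thesis using w(1) by (intro exI[of _ w]) (auto simp: S_def)
qed

text \<open>The residual \<open>r = L w - \<mu> w\<close> is itself orthogonal to the constants, by
  symmetry and zero row sums, so it is an allowed direction of variation. The first variation of the
  quotient at \<open>w\<close> in this direction is twice the squared norm of \<open>r\<close>,
  which must therefore vanish.\<close>

lemma rayleigh_minimum_eigenvalue:
  fixes L :: "real mat"
  assumes N: "N \<ge> 2" and L: "L \<in> carrier_mat N N"
    and sym: "\<And>i j. i < N \<Longrightarrow> j < N \<Longrightarrow> L $$ (i, j) = L $$ (j, i)"
    and rows: "\<And>i. i < N \<Longrightarrow> (\<Sum>j<N. L $$ (i, j)) = 0"
  defines "q \<equiv> \<lambda>v. \<Sum>i<N. v i * (\<Sum>j<N. L $$ (i, j) * v j)"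
  shows "\<exists>w. (\<Sum>i<N. w i) = 0 \<and> (\<Sum>i<N. (w i)\<^sup>2) = 1 \<and> eigenvalue L (q w) \<and>
    (\<forall>v. (\<Sum>i<N. v i) = 0 \<longrightarrow> q w * (\<Sum>i<N. (v i)\<^sup>2) \<le> q v)"
proof -
  obtain w where w: "(\<Sum>i<N. w i) = 0" "(\<Sum>i<N. (w i)\<^sup>2) = 1"
    and min: "\<And>v. (\<Sum>i<N. v i) = 0 \<Longrightarrow> q w * (\<Sum>i<N. (v i)\<^sup>2) \<le> q v"
    using rayleigh_minimiser[OF N, of L] unfolding q_def by blast
  define \<mu> where "\<mu> = q w"
  define r where "r = (\<lambda>i. (\<Sum>j<N. L $$ (i, j) * w j) - \<mu> * w i)"
  have swap: "(\<Sum>i<N. v i * (\<Sum>j<N. L $$ (i, j) * v' j)) = (\<Sum>i<N. v' i * (\<Sum>j<N. L $$ (i, j) * v j))" for v v'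
  proof -
    have "(\<Sum>i<N. v i * (\<Sum>j<N. L $$ (i, j) * v' j)) = (\<Sum>i<N. \<Sum>j<N. v i * (L $$ (i, j) * v' j))"
      by (simp add: sum_distrib_left)
    also have "\<dots> = (\<Sum>j<N. \<Sum>i<N. v i * (L $$ (i, j) * v' j))" by (rule sum.swap)
    also have "\<dots> = (\<Sum>j<N. v' j * (\<Sum>i<N. L $$ (j, i) * v i))"
      unfolding sum_distrib_left using sym by (intro sum.cong refl) (simp add: mult_ac)
    finally show ?thesis .
  qed
  have sumr: "(\<Sum>i<N. r i) = 0"
    using swap[of "\<lambda>_. 1" w] rows w(1) by (simp add: r_def sum_subtractf sum_distrib_left[symmetric])
  define R where "R = (\<Sum>i<N. (r i)\<^sup>2)"
  have R: "R = (\<Sum>i<N. r i * (\<Sum>j<N. L $$ (i, j) * w j)) - \<mu> * (\<Sum>i<N. r i * w i)"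
    by (simp add: R_def r_def power2_eq_square algebra_simps sum_subtractf sum_distrib_left sum.distrib)
  have ineq: "0 \<le> 2 * s * R + s\<^sup>2 * (q r - \<mu> * R)" for s
  proof -
    have "(\<Sum>i<N. w i + s * r i) = 0" using w sumr by (simp add: sum.distrib sum_distrib_left[symmetric])
    from min[OF this] have "\<mu> * (\<Sum>i<N. (w i + s * r i)\<^sup>2) \<le> q (\<lambda>i. w i + s * r i)" by (simp add: \<mu>_def)
    moreover have "(\<Sum>i<N. (w i + s * r i)\<^sup>2) = 1 + 2 * s * (\<Sum>i<N. r i * w i) + s\<^sup>2 * R"
      using w(2) by (simp add: R_def power2_sum sum.distrib sum_distrib_left power_mult_distrib algebra_simps)
    moreover have "q (\<lambda>i. w i + s * r i) = \<mu> + s * (\<Sum>i<N. w i * (\<Sum>j<N. L $$ (i, j) * r j))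
        + s * (\<Sum>i<N. r i * (\<Sum>j<N. L $$ (i, j) * w j)) + s\<^sup>2 * q r"
      unfolding q_def \<mu>_def
      by (simp add: distrib_left distrib_right sum.distrib sum_distrib_left power2_eq_square mult_ac)
    ultimately have "\<mu> * (1 + 2 * s * (\<Sum>i<N. r i * w i) + s\<^sup>2 * R)
       \<le> \<mu> + 2 * s * (\<Sum>i<N. r i * (\<Sum>j<N. L $$ (i, j) * w j)) + s\<^sup>2 * q r"
      using swap[of w r] by simp
    then show ?thesis unfolding R by (simp add: algebra_simps)
  qed
  have "R = 0"
  proof (rule ccontr)
    assume "R \<noteq> 0"
    then have Rpos: "R > 0" by (simp add: R_def less_le sum_nonneg)
    \<comment> \<open>\<open>k\<close> dominates the second-order coefficient, so the step
      \<open>s = - R / k\<close> makes the linear term win and the expression negative.\<close>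
    define k where "k = \<bar>q r - \<mu> * R\<bar> + 1"
    have k: "k > 0" "q r - \<mu> * R \<le> k" by (auto simp: k_def)
    have "0 \<le> 2 * (- R / k) * R + (- R / k)\<^sup>2 * (q r - \<mu> * R)" by (rule ineq)
    also have "\<dots> \<le> 2 * (- R / k) * R + (- R / k)\<^sup>2 * k" using k by (intro add_left_mono mult_left_mono) auto
    also have "\<dots> = - R\<^sup>2 / k" using k by (simp add: power2_eq_square field_simps)
    also have "\<dots> < 0" using k Rpos by simp
    finally show False by simp
  qed
  then have r0: "r i = 0" if "i < N" for i using that by (simp add: R_def sum_nonneg_eq_0_iff)
  define wv where "wv = vec N w"
  have wv: "wv \<in> carrier_vec N" by (simp add: wv_def)
  have "wv \<noteq> 0\<^sub>v N"
  proof
    assume "wv = 0\<^sub>v N"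
    then have "w i = 0" if "i < N" for i using that by (metis index_vec index_zero_vec(1) wv_def)
    then show False using w(2) by simp
  qed
  moreover have "L *\<^sub>v wv = \<mu> \<cdot>\<^sub>v wv"
  proof (rule eq_vecI)
    fix i assume "i < dim_vec (\<mu> \<cdot>\<^sub>v wv)"
    then have i: "i < N" by (simp add: wv_def)
    show "vec_index (L *\<^sub>v wv) i = vec_index (\<mu> \<cdot>\<^sub>v wv) i"
      using r0[OF i] i unfolding index_mult_mat_vec_sum[OF L wv i] by (simp add: r_def wv_def)
  qed (use L in \<open>simp add: wv_def\<close>)
  ultimately have "eigenvalue L \<mu>" unfolding eigenvalue_def eigenvector_def using wv L by auto
  then show ?thesis using w min unfolding \<mu>_def by blast
qed

text \<open>Replacing the first basis vector by the all-ones vector (the matrix \<open>S\<close>,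
  with inverse \<open>T\<close>) makes the first column zero, so \<open>X\<close> splits off and the
  block \<open>A3\<close> remains. A kernel vector of \<open>A3\<close>, padded by a leading 0, is
  only known to be mapped by \<open>L\<close> to a constant vector; this is why \<open>ker\<close>
  speaks of constant images and not just of the kernel.\<close>

lemma order_zero_char_poly_simple:
  fixes L :: "real mat"
  assumes L: "L \<in> carrier_mat (Suc k) (Suc k)"
    and rows: "\<And>i. i < Suc k \<Longrightarrow> (\<Sum>j<Suc k. L $$ (i, j)) = 0"
    and ker: "\<And>v c. (\<And>i. i < Suc k \<Longrightarrow> (\<Sum>j<Suc k. L $$ (i, j) * v j) = c) \<Longrightarrow> \<forall>i<Suc k. v i = v 0"
  shows "order 0 (char_poly L) = 1"
proof -
  let ?n = "Suc k"
  define S where "S = mat ?n ?n (\<lambda>(i, j). if i = j \<or> j = 0 then 1 else 0 :: real)"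
  define T where "T = mat ?n ?n (\<lambda>(i, j). if i = j then 1 else if j = 0 then - 1 else 0 :: real)"
  define A2 where "A2 = mat 1 k (\<lambda>(i, j). L $$ (0, Suc j))"
  define A3 where "A3 = mat k k (\<lambda>(i, j). L $$ (Suc i, Suc j) - L $$ (0, Suc j))"
  define B where "B = four_block_mat (0\<^sub>m 1 1) A2 (0\<^sub>m k 1) A3"
  have cS: "S \<in> carrier_mat ?n ?n" "T \<in> carrier_mat ?n ?n" by (auto simp: S_def T_def)
  have cA: "A2 \<in> carrier_mat 1 k" "A3 \<in> carrier_mat k k" by (auto simp: A2_def A3_def)
  have cB: "B \<in> carrier_mat ?n ?n" using cA by (auto simp: B_def)
  have Sx: "(\<Sum>l<?n. S $$ (i, l) * f l) = (if i = 0 then f 0 else f 0 + f i)" if i: "i < ?n" for i f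
  proof -
    have "(\<Sum>l<?n. S $$ (i, l) * f l) = (\<Sum>l<?n. (if l = 0 then f l else 0) + (if l = i \<and> i \<noteq> 0 then f l else 0))"
      using i by (intro sum.cong) (auto simp: S_def)
    also have "\<dots> = (if i = 0 then f 0 else f 0 + f i)"
      using i by (cases "i = 0") (simp_all add: sum.distrib del: sum.lessThan_Suc)
    finally show ?thesis .
  qed
  have Tx: "(\<Sum>l<?n. T $$ (i, l) * f l) = (if i = 0 then f 0 else f i - f 0)" if i: "i < ?n" for i f
  proof -
    have "(\<Sum>l<?n. T $$ (i, l) * f l) = (\<Sum>l<?n. (if l = i then f l else 0) - (if l = 0 then (if i \<noteq> 0 then f l else 0) else 0))"
      using i by (intro sum.cong) (auto simp: T_def)
    also have "\<dots> = (if i = 0 then f 0 else f i - f 0)"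
      using i by (cases "i = 0") (simp_all add: sum_subtractf del: sum.lessThan_Suc)
    finally show ?thesis .
  qed
  have ST: "S * T = 1\<^sub>m ?n"
    by (rule eq_matI) (auto simp: index_mult_mat_sum[OF cS] Sx simp del: index_mult_mat(1) sum.lessThan_Suc, auto simp: T_def cS S_def)
  have TS: "T * S = 1\<^sub>m ?n"
    by (rule eq_matI) (auto simp: index_mult_mat_sum[OF cS(2,1)] Tx simp del: index_mult_mat(1) sum.lessThan_Suc, auto simp: T_def cS S_def)
  have "L * S = S * B"
  proof (rule eq_matI)
    fix i j assume "i < dim_row (S * B)" "j < dim_col (S * B)"
    then have i: "i < ?n" and j: "j < ?n" using cS cB by auto
    have Bj0: "B $$ (l, 0) = 0" if "l < ?n" for l using that cA by (cases l) (auto simp: B_def)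
    have Bj: "B $$ (0, Suc j') = L $$ (0, Suc j')" if "Suc j' < ?n" for j' using that cA by (auto simp: B_def A2_def)
    have Bij: "B $$ (Suc i', Suc j') = L $$ (Suc i', Suc j') - L $$ (0, Suc j')" if "Suc j' < ?n" "Suc i' < ?n" for i' j'
      using that cA by (auto simp: B_def A3_def)
    have "(L * S) $$ (i, j) = (if j = 0 then 0 else L $$ (i, j))"
    proof -
      have "(L * S) $$ (i, j) = (\<Sum>l<?n. L $$ (i, l) * S $$ (l, j))" by (rule index_mult_mat_sum[OF L cS(1) i j])
      also have "\<dots> = (if j = 0 then 0 else L $$ (i, j))"
      proof (cases "j = 0")
        case True
        then have "(\<Sum>l<?n. L $$ (i, l) * S $$ (l, j)) = (\<Sum>l<?n. L $$ (i, l))"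
          by (intro sum.cong) (auto simp: S_def)
        then show ?thesis using True rows[OF i] by (simp del: sum.lessThan_Suc)
      next
        case False
        then have "(\<Sum>l<?n. L $$ (i, l) * S $$ (l, j)) = (\<Sum>l<?n. if l = j then L $$ (i, l) else 0)"
          using j by (intro sum.cong) (auto simp: S_def)
        then show ?thesis using False j by (simp del: sum.lessThan_Suc)
      qed
      finally show ?thesis .
    qed
    moreover have "(S * B) $$ (i, j) = (if j = 0 then 0 else L $$ (i, j))"
      unfolding index_mult_mat_sum[OF cS(1) cB i j] Sx[OF i]
      using i j by (cases i; cases j) (auto simp: Bj0 Bj Bij)
    ultimately show "(L * S) $$ (i, j) = (S * B) $$ (i, j)" by simp
  qed (use cS cB L in auto)
  then have "L = S * B * T"
    using ST cS cB L by (metis assoc_mult_mat right_mult_one_mat)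
  then have "similar_mat L B"
    unfolding similar_mat_def using similar_mat_witI[OF ST TS _ L cB cS] by blast
  then have "char_poly L = char_poly B" by (rule char_poly_similar)
  also have "\<dots> = char_poly (0\<^sub>m 1 1) * char_poly A3"
    unfolding B_def using cA by (intro char_poly_four_block_zeros_col) auto
  also have "char_poly (0\<^sub>m 1 1 :: real mat) = [:0, 1:]"
    by (simp add: char_poly_def char_poly_matrix_def det_single)
  finally have cp: "char_poly L = [:0, 1:] * char_poly A3" .
  have "poly (char_poly A3) 0 \<noteq> 0"
  proof
    assume "poly (char_poly A3) 0 = 0"
    then have "eigenvalue A3 0" using eigenvalue_root_char_poly[OF cA(2)] by simp
    then obtain w where w: "w \<in> carrier_vec k" "w \<noteq> 0\<^sub>v k" "A3 *\<^sub>v w = 0 \<cdot>\<^sub>v w"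
      using cA unfolding eigenvalue_def eigenvector_def by auto
    define v where "v = (\<lambda>i. if i = 0 then 0 else vec_index w (i - 1))"
    have Lv: "(\<Sum>j<?n. L $$ (i, j) * v j) = (\<Sum>j<k. L $$ (i, Suc j) * vec_index w j)" for i
      by (simp add: sum.lessThan_Suc_shift v_def del: sum.lessThan_Suc)
    have "(\<Sum>j<?n. L $$ (i, j) * v j) = (\<Sum>j<k. L $$ (0, Suc j) * vec_index w j)" if i: "i < ?n" for i
    proof (cases i)
      case 0
      then show ?thesis by (simp add: Lv del: sum.lessThan_Suc)
    next
      case (Suc i')
      then have i': "i' < k" using i by simp
      have "(\<Sum>j<k. A3 $$ (i', j) * vec_index w j) = 0"
        using w i' cA(2) index_mult_mat_vec_sum[OF cA(2) w(1) i'] by simp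
      then show ?thesis using i' Suc unfolding Lv
        by (simp add: A3_def left_diff_distrib sum_subtractf)
    qed
    from ker[OF this] have "v (Suc i) = v 0" if "i < k" for i using that by blast
    then have "vec_index w i = 0" if "i < k" for i using that by (simp add: v_def)
    then have "w = 0\<^sub>v k" using w(1) by auto
    then show False using w by simp
  qed
  then have "order 0 (char_poly A3) = 0" by (simp add: order_0I)
  moreover have "order 0 [:0, 1 :: real:] = 1"
    using order_power_n_n[of "0::real" 1] by simp
  moreover have "char_poly A3 \<noteq> 0" using degree_monic_char_poly[OF cA(2)] by auto
  ultimately show ?thesis unfolding cp by (subst order_mult) auto
qed

text \<open>The minimum of the Rayleigh quotient on the orthogonal complement of the constants is an
  eigenvalue and \<open>0\<close> is a simple root of the characteristic polynomial, so the second smallest root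
  is positive and at most that minimum; the spectral theorem is not needed.\<close>

lemma second_eigenvalue:
  fixes L :: "real mat"
  assumes N: "N \<ge> 2" and L: "L \<in> carrier_mat N N"
    and sym: "\<And>i j. i < N \<Longrightarrow> j < N \<Longrightarrow> L $$ (i, j) = L $$ (j, i)"
    and rows: "\<And>i. i < N \<Longrightarrow> (\<Sum>j<N. L $$ (i, j)) = 0"
    and psd: "\<And>v. 0 \<le> (\<Sum>i<N. v i * (\<Sum>j<N. L $$ (i, j) * v j))"
    and null: "\<And>v. (\<Sum>i<N. v i * (\<Sum>j<N. L $$ (i, j) * v j)) = 0 \<Longrightarrow> \<forall>i<N. v i = v 0"
  shows "eig_sorted L ! 1 > 0"
    and "(\<Sum>i<N. v i) = 0 \<Longrightarrow>
      eig_sorted L ! 1 * (\<Sum>i<N. (v i)\<^sup>2) \<le> (\<Sum>i<N. v i * (\<Sum>j<N. L $$ (i, j) * v j))"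
proof -
  obtain w where w: "(\<Sum>i<N. w i) = 0" "(\<Sum>i<N. (w i)\<^sup>2) = 1"
    and ev: "eigenvalue L (\<Sum>i<N. w i * (\<Sum>j<N. L $$ (i, j) * w j))"
    and min: "\<And>v. (\<Sum>i<N. v i) = 0 \<Longrightarrow> (\<Sum>i<N. w i * (\<Sum>j<N. L $$ (i, j) * w j)) * (\<Sum>i<N. (v i)\<^sup>2)
       \<le> (\<Sum>i<N. v i * (\<Sum>j<N. L $$ (i, j) * v j))"
    using rayleigh_minimum_eigenvalue[OF N L sym rows] by blast
  define \<mu> where "\<mu> = (\<Sum>i<N. w i * (\<Sum>j<N. L $$ (i, j) * w j))"
  have "\<mu> \<noteq> 0"
  proof
    assume "\<mu> = 0"
    then have const: "w i = w 0" if "i < N" for i using null[of w] that unfolding \<mu>_def by blast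
    then have "(\<Sum>i<N. w i) = (\<Sum>i<N. w 0)" by (intro sum.cong) blast+
    then have "w 0 = 0" using w N by simp
    then have "w i = 0" if "i < N" for i using const[OF that] by simp
    then have "(\<Sum>i<N. (w i)\<^sup>2) = 0" by simp
    then show False using w by simp
  qed
  then have \<mu>: "\<mu> > 0" using psd[of w] by (simp add: \<mu>_def)
  let ?p = "char_poly L"
  have p0: "?p \<noteq> 0" using degree_monic_char_poly[OF L] N by auto
  have fin: "finite {x. poly ?p x = 0}" using p0 by (rule poly_roots_finite)
  have cnt: "count (eig_mset L) x = (if poly ?p x = 0 then order x ?p else 0)" for x
    unfolding eig_mset_def count_sum using fin by (simp add: if_distrib sum.delta cong: if_cong)
  have mem: "x \<in># eig_mset L \<longleftrightarrow> poly ?p x = 0" for x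
    using p0 by (auto simp: count_greater_zero_iff[symmetric] cnt order_root simp del: count_greater_zero_iff)
  have symx: "(\<Sum>i<N. \<Sum>j<N. L $$ (i, j) * v j) = 0" for v
  proof -
    have "(\<Sum>i<N. \<Sum>j<N. L $$ (i, j) * v j) = (\<Sum>j<N. (\<Sum>i<N. L $$ (j, i)) * v j)"
      unfolding sum_distrib_right by (subst sum.swap) (intro sum.cong refl, simp add: sym)
    then show ?thesis using rows by simp
  qed
  \<comment> \<open>Column sums vanish too, so summing the constant image over all rows forces the
    constant to be 0.\<close>
  have ker: "\<forall>i<N. v i = v 0" if Lv: "\<And>i. i < N \<Longrightarrow> (\<Sum>j<N. L $$ (i, j) * v j) = c" for v c
  proof -
    have "real N * c = 0" using symx[of v] Lv by simp
    then have "c = 0" using N by simp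
    then have "(\<Sum>i<N. v i * (\<Sum>j<N. L $$ (i, j) * v j)) = 0" using Lv by simp
    then show ?thesis by (rule null)
  qed
  obtain k where k: "N = Suc k" using N by (cases N) auto
  have ord: "order 0 ?p = 1"
    using order_zero_char_poly_simple[of L k] L rows ker unfolding k by blast
  then have root0: "poly ?p 0 = 0" using p0 by (simp add: order_root)
  have nonneg: "x \<ge> 0" if "poly ?p x = 0" for x
  proof -
    have "eigenvalue L x" using that eigenvalue_root_char_poly[OF L] by simp
    then obtain e where e: "e \<in> carrier_vec N" "e \<noteq> 0\<^sub>v N" "L *\<^sub>v e = x \<cdot>\<^sub>v e"
      using L unfolding eigenvalue_def eigenvector_def by auto
    have "(\<Sum>j<N. L $$ (i, j) * vec_index e j) = x * vec_index e i" if "i < N" for i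
      using e that index_mult_mat_vec_sum[OF L e(1) that] by simp
    then have "0 \<le> (\<Sum>i<N. vec_index e i * (x * vec_index e i))" using psd[of "vec_index e"] by simp
    also have "\<dots> = x * (\<Sum>i<N. (vec_index e i)\<^sup>2)" by (simp add: sum_distrib_left power2_eq_square mult_ac)
    finally have *: "0 \<le> x * (\<Sum>i<N. (vec_index e i)\<^sup>2)" .
    have "(\<Sum>i<N. (vec_index e i)\<^sup>2) \<noteq> 0"
    proof
      assume "(\<Sum>i<N. (vec_index e i)\<^sup>2) = 0"
      then have "\<forall>i<N. vec_index e i = 0" by (simp add: sum_nonneg_eq_0_iff)
      then have "e = 0\<^sub>v N" using e(1) by auto
      then show False using e by simp
    qed
    then have "(\<Sum>i<N. (vec_index e i)\<^sup>2) > 0" by (simp add: less_le sum_nonneg)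
    then show ?thesis using * by (simp add: zero_le_mult_iff)
  qed
  define l where "l = eig_sorted L"
  have l: "sorted l" "mset l = eig_mset L"
    by (auto simp: l_def eig_sorted_def)
  have setl: "x \<in> set l \<longleftrightarrow> poly ?p x = 0" for x using l(2) mem by (metis set_mset_mset)
  have "0 \<in> set l" "\<mu> \<in> set l"
    using root0 ev eigenvalue_root_char_poly[OF L] by (auto simp: setl \<mu>_def)
  then obtain i0 im where i0: "i0 < length l" "l ! i0 = 0" and im: "im < length l" "l ! im = \<mu>"
    by (metis in_set_conv_nth)
  have "i0 \<noteq> im" using i0 im \<mu> by auto
  then have len: "length l \<ge> 2" using i0 im by linarith
  \<comment> \<open>\<open>0\<close> and \<mu> occupy different positions of the sorted list.
    Whichever of the two positions is at least 1 bounds the entry at position 1.\<close>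
  have "l ! 1 \<le> \<mu>"
  proof (cases "im \<ge> 1")
    case True
    then show ?thesis using l(1) im sorted_nth_mono by metis
  next
    case False
    then have "i0 \<ge> 1" using \<open>i0 \<noteq> im\<close> by simp
    then have "l ! 1 \<le> 0" using l(1) i0 sorted_nth_mono by metis
    then show ?thesis using \<mu> by simp
  qed
  \<comment> \<open>Otherwise the first two entries would both be 0, against the simplicity of the
    root 0.\<close>
  have "l ! 1 \<noteq> 0"
  proof
    assume l1: "l ! 1 = 0"
    obtain a b r where abr: "l = a # b # r" using len by (cases l; cases "tl l") auto
    have "a \<ge> 0" using setl[of a] nonneg[of a] abr by simp
    moreover have "a \<le> b" "b = 0" using l(1) l1 abr by auto
    ultimately have "a = 0" "b = 0" by auto
    then have "count (mset l) 0 \<ge> 2" using abr by simp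
    then show False using l(2) cnt ord root0 by simp
  qed
  moreover have "l ! 1 \<ge> 0" using setl nonneg len by (metis nth_mem order_less_le_trans one_less_numeral_iff semiring_norm(76))
  ultimately show "eig_sorted L ! 1 > 0" by (simp add: l_def)
  show "eig_sorted L ! 1 * (\<Sum>i<N. (v i)\<^sup>2) \<le> (\<Sum>i<N. v i * (\<Sum>j<N. L $$ (i, j) * v j))"
    if "(\<Sum>i<N. v i) = 0"
    using min[OF that] \<open>l ! 1 \<le> \<mu>\<close> unfolding l_def \<mu>_def
    by (meson mult_right_mono order_trans sum_nonneg zero_le_power2)
qed

section \<open>Graph constants\<close>

lemma valid_graphs_edge:
  assumes "valid_graphs N h E" "u < h" "{i, j} \<in> E u"
  shows "i < N" "j < N" "i \<noteq> j"
proof -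
  obtain k l where "{i, j} = {k, l}" "k \<noteq> l" "k < N" "l < N"
    using assms unfolding valid_graphs_def by blast
  then show "i < N" "j < N" "i \<noteq> j" by (auto simp: doubleton_eq_iff)
qed

lemma nbr_subset:
  assumes "valid_graphs N h E" "u < h"
  shows "nbr E u i \<subseteq> {..<N}" "finite (nbr E u i)"
proof -
  show "nbr E u i \<subseteq> {..<N}" using valid_graphs_edge[OF assms] by (auto simp: nbr_def)
  then show "finite (nbr E u i)" using finite_subset by blast
qed

lemma nbrU_subset:
  assumes "valid_graphs N h E"
  shows "nbrU h E i \<subseteq> {..<N}" "finite (nbrU h E i)"
proof -
  show "nbrU h E i \<subseteq> {..<N}" using valid_graphs_edge[OF assms] by (auto simp: nbrU_def)
  then show "finite (nbrU h E i)" using finite_subset by blast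
qed

lemma nbr_subset_nbrU: "u < h \<Longrightarrow> nbr E u i \<subseteq> nbrU h E i"
  by (auto simp: nbr_def nbrU_def)

lemma nbr_sym: "j \<in> nbr E u i \<longleftrightarrow> i \<in> nbr E u j"
  by (simp add: nbr_def insert_commute)

lemma sum_nbr_conv:
  assumes "valid_graphs N h E" "u < h"
  shows "(\<Sum>j\<in>nbr E u i. f j) = (\<Sum>j<N. if j \<in> nbr E u i then f j else (0::real))"
  using nbr_subset[OF assms, of i]
  by (simp add: sum.inter_restrict[symmetric] Int_absorb1)

lemma sum_nbr_nbrU:
  assumes "valid_graphs N h E" "u < h"
  shows "(\<Sum>j\<in>nbr E u i. f j) = (\<Sum>j\<in>nbrU h E i. if j \<in> nbr E u i then f j else (0::real))"
  using nbr_subset_nbrU[OF assms(2), of E i] nbrU_subset[OF assms(1), of i]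
  by (simp add: sum.inter_restrict[symmetric] Int_absorb1)

text \<open>Removes the enumeration of the ordered pairs, so that the matrix constants can be used
  with double sums over agents and neighbours.\<close>

lemma sum_pair_list:
  fixes f :: "nat \<Rightarrow> nat \<Rightarrow> real"
  assumes "valid_graphs N h E"
  shows "(\<Sum>p<length (pair_list N h E). f (fst (pair_list N h E ! p)) (snd (pair_list N h E ! p)))
    = (\<Sum>i<N. \<Sum>j\<in>nbrU h E i. f i j)"
proof -
  let ?g = "\<lambda>p. f (fst p) (snd p)"
  have cc: "sum_list (concat xss) = (\<Sum>xs\<leftarrow>xss. sum_list xs)" for xss :: "real list list"
    by (induction xss) auto
  have "(\<Sum>p<length (pair_list N h E). ?g (pair_list N h E ! p)) = sum_list (map ?g (pair_list N h E))"
    by (simp add: sum_list_sum_nth atLeast0LessThan)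
  also have "\<dots> = sum_list (map (\<lambda>i. \<Sum>j\<in>nbrU h E i. f i j) [0..<N])"
    using nbrU_subset[OF assms]
    by (simp add: pair_list_def map_concat cc o_def sum_list_distinct_conv_sum_set)
  also have "\<dots> = (\<Sum>i<N. \<Sum>j\<in>nbrU h E i. f i j)"
    by (simp add: interv_sum_list_conv_sum_set_nat atLeast0LessThan)
  finally show ?thesis .
qed

lemma Wmat_sum:
  fixes f :: "nat \<Rightarrow> nat \<Rightarrow> real"
  assumes "valid_graphs N h E" "u < h" "k < N"
  defines "ps \<equiv> pair_list N h E"
  shows "(\<Sum>p<length ps. Wmat N h E u $$ (k, p) * f (fst (ps ! p)) (snd (ps ! p)))
    = (\<Sum>j\<in>nbr E u k. f k j)"
proof -
  have "(\<Sum>p<length ps. Wmat N h E u $$ (k, p) * f (fst (ps ! p)) (snd (ps ! p)))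
    = (\<Sum>p<length ps. (\<lambda>i j. if i = k then if j \<in> nbr E u k then f i j else 0 else 0) (fst (ps ! p)) (snd (ps ! p)))"
    using assms by (intro sum.cong) (auto simp: Wmat_def Let_def nbr_def)
  also have "\<dots> = (\<Sum>i<N. \<Sum>j\<in>nbrU h E i. if i = k then if j \<in> nbr E u k then f i j else 0 else 0)"
    unfolding ps_def by (rule sum_pair_list[OF assms(1)])
  also have "\<dots> = (\<Sum>i<N. if i = k then (\<Sum>j\<in>nbrU h E k. if j \<in> nbr E u k then f k j else 0) else 0)"
    by (intro sum.cong) auto
  also have "\<dots> = (\<Sum>j\<in>nbr E u k. f k j)"
    using \<open>k < N\<close> by (simp add: sum_nbr_nbrU[OF assms(1,2)])
  finally show ?thesis .
qed

lemma laplacian_sum: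
  assumes "valid_graphs N h E" "u < h" "i < N"
  shows "(\<Sum>j<N. laplacian N E u $$ (i, j) * y j) = (\<Sum>j\<in>nbr E u i. y i - y j)"
proof -
  have ni: "i \<notin> nbr E u i" using valid_graphs_edge(3)[OF assms(1,2), of i i] by (auto simp: nbr_def)
  have "(\<Sum>j<N. laplacian N E u $$ (i, j) * y j)
     = (\<Sum>j<N. (if j = i then real (card (nbr E u i)) * y j else 0) - (if j \<in> nbr E u i then y j else 0))"
    using assms ni by (intro sum.cong) (auto simp: laplacian_def nbr_def)
  also have "\<dots> = real (card (nbr E u i)) * y i - (\<Sum>j\<in>nbr E u i. y j)"
    using assms by (simp add: sum_subtractf sum_nbr_conv[OF assms(1,2)])
  finally show ?thesis by (simp add: sum_subtractf)
qed

text \<open>Every edge is counted in both orientations, and the two contributions add up to a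
  square. The form thus depends on differences only, which later allows replacing \<open>y\<close>
  by its deviation from the average.\<close>

lemma laplacian_quadratic:
  fixes v :: "nat \<Rightarrow> real"
  assumes "valid_graphs N h E" "u < h"
  shows "2 * (\<Sum>i<N. v i * (\<Sum>j\<in>nbr E u i. v i - v j)) = (\<Sum>i<N. \<Sum>j\<in>nbr E u i. (v i - v j)\<^sup>2)"
proof -
  let ?a = "\<lambda>i j. if j \<in> nbr E u i then 1 else 0 :: real"
  have "(\<Sum>i<N. v i * (\<Sum>j\<in>nbr E u i. v i - v j)) = (\<Sum>i<N. \<Sum>j<N. ?a i j * (v i * (v i - v j)))"
    unfolding sum_nbr_conv[OF assms] sum_distrib_left by (intro sum.cong) auto
  moreover have "\<dots> = (\<Sum>i<N. \<Sum>j<N. ?a i j * (v j * (v j - v i)))"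
    by (subst sum.swap) (intro sum.cong refl, simp add: nbr_sym)
  moreover have "(\<Sum>i<N. \<Sum>j<N. ?a i j * (v i * (v i - v j))) + (\<Sum>i<N. \<Sum>j<N. ?a i j * (v j * (v j - v i)))
     = (\<Sum>i<N. \<Sum>j\<in>nbr E u i. (v i - v j)\<^sup>2)"
    unfolding sum_nbr_conv[OF assms] sum.distrib[symmetric]
    by (intro sum.cong) (auto simp: power2_eq_square algebra_simps)
  ultimately show ?thesis by simp
qed

section \<open>The spectral constants as bounds on bilinear forms\<close>

lemma carrier_mats:
  "Wmat N h E u \<in> carrier_mat N (length (pair_list N h E))"
  "Qmat N h E \<in> carrier_mat (length (pair_list N h E)) N"
  "Jmat N \<in> carrier_mat N N" "laplacian N E u \<in> carrier_mat N N"
  by (auto simp: Wmat_def Qmat_def Jmat_def laplacian_def Let_def)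

lemma Qmat_mult_index:
  assumes v: "valid_graphs N h E" and A: "A \<in> carrier_mat N q"
    and p: "p < length (pair_list N h E)" and j: "j < q"
  shows "(Qmat N h E * A) $$ (p, j) = A $$ (snd (pair_list N h E ! p), j)"
proof -
  let ?ps = "pair_list N h E"
  have "?ps ! p \<in> set ?ps" using p by simp
  then have s: "snd (?ps ! p) < N"
    using nbrU_subset[OF v] by (fastforce simp: pair_list_def)
  have "(Qmat N h E * A) $$ (p, j) = (\<Sum>k<N. if k = snd (?ps ! p) then A $$ (k, j) else 0)"
    unfolding index_mult_mat_sum[OF carrier_mats(2) A p j]
    using p by (intro sum.cong) (auto simp: Qmat_def Let_def)
  then show ?thesis using s by simp
qed

lemma Max_square_sqrt:
  fixes u h :: nat
  assumes "u < h"
  shows "spec_norm (A u) \<le> sqrt (Max ((\<lambda>u. (spec_norm (A u))\<^sup>2) ` {..<h}))"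
proof -
  have "(spec_norm (A u))\<^sup>2 \<le> Max ((\<lambda>u. (spec_norm (A u))\<^sup>2) ` {..<h})"
    using assms by (intro Max_ge finite_imageI) auto
  then show ?thesis by (rule real_le_rsqrt)
qed

lemma spec_norm_Max_bilinear:
  fixes u h :: nat
  assumes "A u \<in> carrier_mat r q" "u < h"
  shows "\<bar>\<Sum>i<r. x i * (\<Sum>j<q. A u $$ (i, j) * y j)\<bar>
    \<le> sqrt (Max ((\<lambda>u. (spec_norm (A u))\<^sup>2) ` {..<h})) * sqrt (\<Sum>i<r. (x i)\<^sup>2) * sqrt (\<Sum>j<q. (y j)\<^sup>2)"
  by (rule order_trans[OF spec_norm_bilinear[OF assms(1)]])
    (intro mult_right_mono Max_square_sqrt[OF assms(2)], auto simp: sum_nonneg)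

text \<open>A vector \<delta> of sum zero is fixed by the symmetric projection \<open>J\<close>, so
  \<open>W\<close> may be replaced by \<open>J * W\<close> in the form.\<close>

lemma lambdaG_bound:
  fixes \<delta> :: "nat \<Rightarrow> real" and e :: "nat \<Rightarrow> nat \<Rightarrow> real"
  assumes v: "valid_graphs N h E" and u: "u < h" and \<delta>: "(\<Sum>i<N. \<delta> i) = 0"
  shows "\<bar>\<Sum>i<N. \<delta> i * (\<Sum>j\<in>nbr E u i. e i j)\<bar>
    \<le> sqrt (lambdaG N h E) * sqrt (\<Sum>i<N. (\<delta> i)\<^sup>2) * sqrt (\<Sum>i<N. \<Sum>j\<in>nbrU h E i. (e i j)\<^sup>2)"
proof -
  let ?ps = "pair_list N h E"
  let ?e = "\<lambda>p. e (fst (?ps ! p)) (snd (?ps ! p))"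
  let ?W = "Wmat N h E u"
  have JW: "(Jmat N * ?W) $$ (i, p) = ?W $$ (i, p) - (1 / real N) * (\<Sum>k<N. ?W $$ (k, p))"
    if "i < N" "p < length ?ps" for i p
  proof -
    have "(Jmat N * ?W) $$ (i, p) = (\<Sum>k<N. (if k = i then ?W $$ (k, p) else 0) - (1 / real N) * ?W $$ (k, p))"
      unfolding index_mult_mat_sum[OF carrier_mats(3) carrier_mats(1) that]
      using that by (intro sum.cong) (auto simp: Jmat_def algebra_simps)
    then show ?thesis using that by (simp add: sum_subtractf sum_distrib_left)
  qed
  have "(\<Sum>i<N. \<delta> i * (\<Sum>p<length ?ps. (Jmat N * ?W) $$ (i, p) * ?e p))
     = (\<Sum>i<N. \<delta> i * ((\<Sum>p<length ?ps. ?W $$ (i, p) * ?e p) - (\<Sum>p<length ?ps. (1 / real N) * (\<Sum>k<N. ?W $$ (k, p)) * ?e p)))"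
    by (intro sum.cong refl) (simp add: JW left_diff_distrib sum_subtractf)
  also have "\<dots> = (\<Sum>i<N. \<delta> i * (\<Sum>p<length ?ps. ?W $$ (i, p) * ?e p))"
    using \<delta> by (simp add: right_diff_distrib sum_subtractf sum_distrib_right[symmetric])
  also have "\<dots> = (\<Sum>i<N. \<delta> i * (\<Sum>j\<in>nbr E u i. e i j))"
    by (intro sum.cong refl) (simp add: Wmat_sum[OF v u])
  finally show ?thesis
    using spec_norm_Max_bilinear[where A="\<lambda>u. Jmat N * Wmat N h E u" and x=\<delta> and y="?e", OF mult_carrier_mat[OF carrier_mats(3,1)] u]
    unfolding sum_pair_list[OF v, of "\<lambda>i j. (e i j)\<^sup>2"] lambdaG_def by simp
qed

text \<open>Row \<open>(i, j)\<close> of \<open>Q * W\<close> is row \<open>j\<close> of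
  \<open>W\<close>, which is why the inner sum runs over the neighbours of the second
  component.\<close>

lemma lambdaQW_bound:
  fixes e :: "nat \<Rightarrow> nat \<Rightarrow> real"
  assumes v: "valid_graphs N h E" and u: "u < h"
  shows "\<bar>\<Sum>i<N. \<Sum>j\<in>nbrU h E i. e i j * (\<Sum>l\<in>nbr E u j. e j l)\<bar>
    \<le> sqrt (lambdaQW N h E) * (\<Sum>i<N. \<Sum>j\<in>nbrU h E i. (e i j)\<^sup>2)"
proof -
  let ?ps = "pair_list N h E"
  let ?e = "\<lambda>p. e (fst (?ps ! p)) (snd (?ps ! p))"
  have s: "snd (?ps ! p) < N" if "p < length ?ps" for p
    using nbrU_subset[OF v] nth_mem[OF that] by (fastforce simp: pair_list_def)
  have "(\<Sum>p<length ?ps. ?e p * (\<Sum>q<length ?ps. (Qmat N h E * Wmat N h E u) $$ (p, q) * ?e q))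
     = (\<Sum>p<length ?ps. ?e p * (\<Sum>l\<in>nbr E u (snd (?ps ! p)). e (snd (?ps ! p)) l))"
    by (intro sum.cong refl) (simp add: Qmat_mult_index[OF v carrier_mats(1)] Wmat_sum[OF v u s])
  also have "\<dots> = (\<Sum>i<N. \<Sum>j\<in>nbrU h E i. e i j * (\<Sum>l\<in>nbr E u j. e j l))"
    by (rule sum_pair_list[OF v, of "\<lambda>i j. e i j * (\<Sum>l\<in>nbr E u j. e j l)"])
  finally show ?thesis
    using spec_norm_Max_bilinear[where A="\<lambda>u. Qmat N h E * Wmat N h E u" and x="?e" and y="?e", OF mult_carrier_mat[OF carrier_mats(2,1)] u]
    unfolding sum_pair_list[OF v, of "\<lambda>i j. (e i j)\<^sup>2"] lambdaQW_def by (simp add: mult.assoc sum_nonneg)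
qed

lemma lambdaQL_bound:
  fixes e :: "nat \<Rightarrow> nat \<Rightarrow> real" and y :: "nat \<Rightarrow> real"
  assumes v: "valid_graphs N h E" and u: "u < h"
  shows "\<bar>\<Sum>i<N. \<Sum>j\<in>nbrU h E i. e i j * (\<Sum>l\<in>nbr E u j. y j - y l)\<bar>
    \<le> sqrt (lambdaQL N h E) * sqrt (\<Sum>i<N. \<Sum>j\<in>nbrU h E i. (e i j)\<^sup>2) * sqrt (\<Sum>i<N. (y i)\<^sup>2)"
proof -
  let ?ps = "pair_list N h E"
  let ?e = "\<lambda>p. e (fst (?ps ! p)) (snd (?ps ! p))"
  have s: "snd (?ps ! p) < N" if "p < length ?ps" for p
    using nbrU_subset[OF v] nth_mem[OF that] by (fastforce simp: pair_list_def)
  have "(\<Sum>p<length ?ps. ?e p * (\<Sum>q<N. (Qmat N h E * laplacian N E u) $$ (p, q) * y q))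
     = (\<Sum>p<length ?ps. ?e p * (\<Sum>l\<in>nbr E u (snd (?ps ! p)). y (snd (?ps ! p)) - y l))"
    by (intro sum.cong refl) (simp add: Qmat_mult_index[OF v carrier_mats(4)] laplacian_sum[OF v u s])
  also have "\<dots> = (\<Sum>i<N. \<Sum>j\<in>nbrU h E i. e i j * (\<Sum>l\<in>nbr E u j. y j - y l))"
    by (rule sum_pair_list[OF v, of "\<lambda>i j. e i j * (\<Sum>l\<in>nbr E u j. y j - y l)"])
  finally show ?thesis
    using spec_norm_Max_bilinear[where A="\<lambda>u. Qmat N h E * laplacian N E u" and x="?e" and y=y, OF mult_carrier_mat[OF carrier_mats(2,4)] u]
    unfolding sum_pair_list[OF v, of "\<lambda>i j. (e i j)\<^sup>2"] lambdaQL_def by simp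
qed

text \<open>Agent 0 has to reach agent 1, so some edge leaves it. This gives
  \<open>lambdaG > 0\<close> and a nonempty set of pairs for the minimum defining
  \<open>fM_const\<close>.\<close>

lemma union_connected_edge:
  assumes "N \<ge> 2" "union_connected N h E"
  obtains u i where "u < h" "{0, i} \<in> E u"
proof -
  have "(0, 1) \<in> {(k, l). \<exists>u<h. {k, l} \<in> E u}\<^sup>*"
    using assms unfolding union_connected_def by auto
  then show ?thesis
    by (cases rule: converse_rtranclE) (use that in auto)
qed

lemma Max_square_nonneg:
  assumes "(0::nat) < h"
  shows "0 \<le> Max ((\<lambda>u. (g u :: real)\<^sup>2) ` {..<h})"
proof -
  have "(g 0)\<^sup>2 \<le> Max ((\<lambda>u. (g u)\<^sup>2) ` {..<h})" using assms by (intro Max_ge finite_imageI) auto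
  then show ?thesis by (rule order_trans[OF zero_le_power2])
qed

lemma lambdaG_pos:
  assumes N: "N \<ge> 2" and v: "valid_graphs N h E" and c: "union_connected N h E"
  shows "lambdaG N h E > 0"
proof -
  obtain u k where u: "u < h" "{0, k} \<in> E u" using union_connected_edge[OF N c] .
  have k: "k < N" "0 \<noteq> k" "0 < N" using valid_graphs_edge[OF v u] by auto
  \<comment> \<open>Test vectors attached to a single edge \<open>{0, k}\<close>: the bilinear form
    takes the value 1 on them, so its bound cannot be 0.\<close>
  define \<delta> where "\<delta> = (\<lambda>i. (if i = 0 then 1 else 0) - (if i = k then 1 else 0 :: real))"
  define e where "e = (\<lambda>(i::nat) j. if i = 0 then if j = k then 1 else 0 else 0 :: real)"
  have \<delta>: "(\<Sum>i<N. \<delta> i) = 0" using k by (simp add: \<delta>_def sum_subtractf)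
  have k0: "k \<in> nbr E u 0" using u by (simp add: nbr_def)
  have "(\<Sum>i<N. \<delta> i * (\<Sum>j\<in>nbr E u i. e i j)) = (\<Sum>i<N. if i = 0 then (\<Sum>j\<in>nbr E u 0. if j = k then 1 else 0) else 0)"
    using k by (intro sum.cong) (auto simp: \<delta>_def e_def)
  also have "\<dots> = 1" using k k0 nbr_subset[OF v u(1), of 0] by simp
  finally have eq: "(\<Sum>i<N. \<delta> i * (\<Sum>j\<in>nbr E u i. e i j)) = 1" .
  have "lambdaG N h E \<noteq> 0"
    using lambdaG_bound[OF v u(1) \<delta>, of e] unfolding eq by auto
  moreover have "lambdaG N h E \<ge> 0" unfolding lambdaG_def using u by (intro Max_square_nonneg) simp
  ultimately show ?thesis by simp
qed

section \<open>The spectral gap of the stationary average of the Laplacians\<close>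

lemma Lcheck_sum:
  assumes v: "valid_graphs N h E" and i: "i < N"
  shows "(\<Sum>j<N. Lcheck N h E \<pi> $$ (i, j) * y j) = (\<Sum>u<h. \<pi> u * (\<Sum>j\<in>nbr E u i. y i - y j))"
proof -
  have "(\<Sum>j<N. Lcheck N h E \<pi> $$ (i, j) * y j) = (\<Sum>j<N. \<Sum>u<h. \<pi> u * (laplacian N E u $$ (i, j) * y j))"
    using i by (intro sum.cong) (auto simp: Lcheck_def sum_distrib_right mult.assoc)
  also have "\<dots> = (\<Sum>u<h. \<pi> u * (\<Sum>j<N. laplacian N E u $$ (i, j) * y j))"
    by (subst sum.swap) (simp add: sum_distrib_left)
  also have "\<dots> = (\<Sum>u<h. \<pi> u * (\<Sum>j\<in>nbr E u i. y i - y j))"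
    by (intro sum.cong) (auto simp: laplacian_sum[OF v _ i])
  finally show ?thesis .
qed

lemma Lcheck_quadratic:
  assumes v: "valid_graphs N h E"
  shows "(\<Sum>i<N. y i * (\<Sum>j<N. Lcheck N h E \<pi> $$ (i, j) * y j))
    = (\<Sum>u<h. \<pi> u * (\<Sum>i<N. y i * (\<Sum>j\<in>nbr E u i. y i - y j)))"
proof -
  have "(\<Sum>i<N. y i * (\<Sum>j<N. Lcheck N h E \<pi> $$ (i, j) * y j))
     = (\<Sum>i<N. \<Sum>u<h. \<pi> u * (y i * (\<Sum>j\<in>nbr E u i. y i - y j)))"
    by (intro sum.cong refl, subst Lcheck_sum[OF v]) (auto simp: sum_distrib_left intro!: sum.cong)
  then show ?thesis by (subst (asm) sum.swap) (simp add: sum_distrib_left)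
qed

text \<open>All stationary weights are positive, so a zero of the averaged form is a zero of the
  form of every graph. Such a vector is constant along every edge of the union graph, which is
  connected.\<close>

lemma lambda2_properties:
  assumes N: "N \<ge> 2" and v: "valid_graphs N h E" and c: "union_connected N h E"
    and pos: "\<And>u. u < h \<Longrightarrow> \<pi> u > 0"
  shows "lambda2 N h E \<pi> > 0"
    and "(\<Sum>i<N. y i) = 0 \<Longrightarrow> lambda2 N h E \<pi> * (\<Sum>i<N. (y i)\<^sup>2)
      \<le> (\<Sum>u<h. \<pi> u * (\<Sum>i<N. y i * (\<Sum>j\<in>nbr E u i. y i - y j)))"
proof -
  let ?L = "Lcheck N h E \<pi>"
  let ?D = "\<lambda>u y. \<Sum>i<N. \<Sum>j\<in>nbr E u i. (y i - y j :: real)\<^sup>2"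
  have L: "?L \<in> carrier_mat N N" by (simp add: Lcheck_def)
  have quad: "(\<Sum>i<N. y i * (\<Sum>j<N. ?L $$ (i, j) * y j)) = (\<Sum>u<h. \<pi> u * (?D u y / 2))" for y
    unfolding Lcheck_quadratic[OF v] using laplacian_quadratic[OF v, of _ y]
    by (intro sum.cong refl) (simp add: field_simps)
  have sym: "?L $$ (i, j) = ?L $$ (j, i)" if "i < N" "j < N" for i j
    using that by (auto simp: Lcheck_def laplacian_def insert_commute intro!: sum.cong)
  have rows: "(\<Sum>j<N. ?L $$ (i, j)) = 0" if "i < N" for i
    using Lcheck_sum[OF v that, of \<pi> "\<lambda>_. 1"] by simp
  have nn: "\<pi> u * (?D u y / 2) \<ge> 0" if "u < h" for u y
    using pos[OF that] by (intro mult_nonneg_nonneg divide_nonneg_nonneg sum_nonneg) auto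
  have psd: "0 \<le> (\<Sum>i<N. y i * (\<Sum>j<N. ?L $$ (i, j) * y j))" for y
    unfolding quad using nn by (intro sum_nonneg) auto
  have null: "\<forall>i<N. y i = y 0" if "(\<Sum>i<N. y i * (\<Sum>j<N. ?L $$ (i, j) * y j)) = 0" for y
  proof -
    have D0: "?D u y = 0" if "u < h" for u
    proof -
      have "\<forall>u\<in>{..<h}. \<pi> u * (?D u y / 2) = 0"
        using \<open>(\<Sum>i<N. y i * _ i) = 0\<close> unfolding quad
        by (subst (asm) sum_nonneg_eq_0_iff) (use nn in auto)
      then have "\<pi> u * (?D u y / 2) = 0" using that by blast
      then show ?thesis using pos[OF that] by simp
    qed
    have edge: "y i = y j" if "u < h" "{i, j} \<in> E u" for u i j
    proof -
      have i: "i < N" using valid_graphs_edge[OF v that] by simp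
      have j: "j \<in> nbr E u i" using that by (simp add: nbr_def)
      have fin: "finite (nbr E u i)" by (rule nbr_subset[OF v that(1)])
      have "(\<Sum>j\<in>nbr E u i. (y i - y j)\<^sup>2) = 0"
        using D0[OF that(1)] i by (subst (asm) sum_nonneg_eq_0_iff) (auto intro: sum_nonneg)
      then have "(y i - y j)\<^sup>2 = 0"
        using j fin by (subst (asm) sum_nonneg_eq_0_iff) auto
      then show ?thesis by simp
    qed
    have "y i = y 0" if "i < N" for i
    proof -
      have "(0, i) \<in> {(k, l). \<exists>u<h. {k, l} \<in> E u}\<^sup>*"
        using c N that unfolding union_connected_def by auto
      then show ?thesis by (induction rule: rtrancl_induct) (use edge in force)+
    qed
    then show ?thesis by blast
  qed
  note se = second_eigenvalue[OF N L sym rows psd null]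
  show "lambda2 N h E \<pi> > 0" unfolding lambda2_def by (rule se(1))
  show "lambda2 N h E \<pi> * (\<Sum>i<N. (y i)\<^sup>2)
      \<le> (\<Sum>u<h. \<pi> u * (\<Sum>i<N. y i * (\<Sum>j\<in>nbr E u i. y i - y j)))" if "(\<Sum>i<N. y i) = 0"
    using se(2)[OF _ _ _ _ that] unfolding lambda2_def Lcheck_quadratic[OF v] by blast
qed

section \<open>Scalar estimates\<close>

text \<open>\<open>D * \<tau> powr (- q)\<close> is a supersolution: the surplus
  \<open>(\<kappa> - q) * D / \<tau>\<close> in the contraction absorbs the forcing, which is of no
  larger order because \<open>q \<le> 1\<close>, and the remaining factor \<open>1 - q/t\<close> is
  at most \<open>(1 + 1/t) powr (- q)\<close>.\<close>

lemma perturbed_recursion_rate: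
  fixes T :: "nat \<Rightarrow> real" and t0 :: nat
  defines "\<tau> \<equiv> \<lambda>k. real (t0 + 1 + k)"
  assumes q: "0 < q" "q \<le> 1" "q < \<kappa>" and C: "C \<ge> 0"
    and rec: "\<And>k. T (Suc k) \<le> (1 - \<kappa> / \<tau> k) * T k + C / (\<tau> k)\<^sup>2"
    and bdd: "\<And>k. T k \<le> B"
  shows "\<exists>D\<ge>0. \<forall>k. T k \<le> D * \<tau> k powr (- q)"
proof -
  \<comment> \<open>Before \<open>k0\<close> the factor \<open>1 - \<kappa> / \<tau>\<close> can be
    negative and the induction hypothesis could not be multiplied by it; there the uniform bound
    \<open>B\<close> is used.\<close>
  obtain k0 :: nat where "real k0 \<ge> \<kappa>" using real_arch_simple by blast
  then have k0: "\<tau> k0 \<ge> \<kappa>" by (simp add: \<tau>_def)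
  have \<tau>1: "\<tau> k \<ge> 1" for k by (simp add: \<tau>_def)
  have \<tau>0: "\<tau> k > 0" for k by (simp add: \<tau>_def)
  \<comment> \<open>The first entry absorbs the forcing, the second covers the initial stretch up to
    \<open>k0\<close>.\<close>
  define D where "D = max (C / (\<kappa> - q)) (max B 0 * \<tau> k0 powr q)"
  have D0: "D \<ge> 0" by (simp add: D_def max.coboundedI2)
  have DC: "C \<le> (\<kappa> - q) * D"
  proof -
    have "C / (\<kappa> - q) \<le> D" by (simp add: D_def)
    then show ?thesis using q by (simp add: field_simps)
  qed
  have small: "T k \<le> D * \<tau> k powr (- q)" if "k \<le> k0" for k
  proof -
    have "\<tau> k powr q \<le> \<tau> k0 powr q" using that q \<tau>0[of k] by (intro powr_mono2) (auto simp: \<tau>_def)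
    then have "max B 0 * \<tau> k powr q \<le> D"
      unfolding D_def by (intro max.coboundedI2 mult_left_mono) auto
    then have "max B 0 * \<tau> k powr q * \<tau> k powr (- q) \<le> D * \<tau> k powr (- q)"
      by (rule mult_right_mono) simp
    then have "max B 0 \<le> D * \<tau> k powr (- q)"
      using \<tau>0[of k] by (simp add: mult.assoc powr_add[symmetric])
    then show ?thesis using bdd[of k] by linarith
  qed
  have "T k \<le> D * \<tau> k powr (- q)" if "k \<ge> k0" for k
    using that
  proof (induction k rule: dec_induct)
    case base
    then show ?case by (rule small) simp
  next
    case (step k)
    define t where "t = \<tau> k"
    have t: "t \<ge> 1" "t > 0" "t \<ge> \<kappa>" using \<tau>1[of k] k0 step.hyps by (auto simp: t_def \<tau>_def)
    have "1 - \<kappa> / t \<ge> 0" using t by (simp add: field_simps)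
    then have "(1 - \<kappa> / t) * T k \<le> (1 - \<kappa> / t) * (D * t powr (- q))"
      using step.IH by (intro mult_left_mono) (auto simp: t_def)
    then have "T (Suc k) \<le> (1 - \<kappa> / t) * (D * t powr (- q)) + C / t\<^sup>2"
      using rec[of k] by (simp add: t_def)
    also have "C / t\<^sup>2 \<le> (\<kappa> - q) * D * (t powr (- q) / t)"
    proof -
      have "1 / t\<^sup>2 = t powr (-1) / t" using t by (simp add: powr_minus power2_eq_square field_simps)
      also have "\<dots> \<le> t powr (- q) / t" using t q by (intro divide_right_mono powr_mono) auto
      finally have "C * (1 / t\<^sup>2) \<le> (\<kappa> - q) * D * (t powr (- q) / t)"
        using DC C t by (intro mult_mono) auto
      then show ?thesis by simp
    qed
    also have "(1 - \<kappa> / t) * (D * t powr (- q)) + (\<kappa> - q) * D * (t powr (- q) / t)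
       = D * (t powr (- q) * (1 - q / t))" using t by (simp add: field_simps)
    also have "\<dots> \<le> D * (t + 1) powr (- q)"
    proof (rule mult_left_mono[OF _ D0])
      have "1 - q / t \<le> exp (- q / t)" using exp_ge_add_one_self[of "- q / t"] by simp
      also have "\<dots> \<le> exp (- q * ln (1 + 1 / t))"
        using ln_add_one_self_le_self[of "1 / t"] t q by (simp add: divide_inverse)
      also have "\<dots> = (1 + 1 / t) powr (- q)"
        using t add_pos_pos[of 1 "1 / t"] by (auto simp: powr_def)
      finally have "t powr (- q) * (1 - q / t) \<le> t powr (- q) * (1 + 1 / t) powr (- q)"
        by (intro mult_left_mono) auto
      also have "\<dots> = (t * (1 + 1 / t)) powr (- q)" using t by (simp add: powr_mult)
      also have "t * (1 + 1 / t) = t + 1" using t by (simp add: distrib_left)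
      finally show "t powr (- q) * (1 - q / t) \<le> (t + 1) powr (- q)" .
    qed
    also have "t + 1 = \<tau> (Suc k)" by (simp add: t_def \<tau>_def)
    finally show ?case by simp
  qed
  then show ?thesis using small D0 by (metis nat_le_linear)
qed

text \<open>The two inequalities with strict rate \<kappa>0 say
  \<open>b / (d - \<kappa>0) < w < (a - \<kappa>0) / b\<close>. This interval is nonempty exactly
  under \<open>det\<close>, that is, when the matrix with diagonal \<open>a - \<kappa>0\<close>,
  \<open>d - \<kappa>0\<close> and off-diagonal \<open>- b\<close> is positive definite.\<close>

lemma lyapunov_weight:
  fixes a b d \<kappa>0 :: real
  assumes b: "b > 0" and a: "a > \<kappa>0" and det: "b\<^sup>2 < (a - \<kappa>0) * (d - \<kappa>0)"
  shows "\<exists>w>0. \<exists>\<kappa>>\<kappa>0. \<kappa> \<le> a - w * b \<and> \<kappa> * w \<le> w * d - b"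
proof -
  have "(a - \<kappa>0) * (d - \<kappa>0) > 0" using det by (rule le_less_trans[OF zero_le_power2])
  then have d: "d - \<kappa>0 > 0" using a by (simp add: zero_less_mult_iff)
  have "b / (d - \<kappa>0) < (a - \<kappa>0) / b" using det b d by (simp add: field_simps power2_eq_square)
  then obtain w where w: "b / (d - \<kappa>0) < w" "w < (a - \<kappa>0) / b" using dense by blast
  have w0: "w > 0" using w(1) b d by (meson divide_pos_pos less_trans)
  have 1: "\<kappa>0 < a - w * b" using w(2) b by (simp add: field_simps)
  have 2: "\<kappa>0 < d - b / w" using w(1) d w0 by (simp add: field_simps)
  show ?thesis
  proof (intro exI conjI)
    show "min (a - w * b) (d - b / w) * w \<le> w * d - b"
    proof -
      have "min (a - w * b) (d - b / w) * w \<le> (d - b / w) * w" using w0 by (intro mult_right_mono) auto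
      also have "(d - b / w) * w = w * d - b" using w0 by (simp add: field_simps)
      finally show ?thesis .
    qed
  qed (use w0 1 2 in auto)
qed

lemma sqrt_young:
  fixes G V R p :: real
  assumes "G \<ge> 0" "V \<ge> 0" "R \<ge> 0" "p > 0"
  shows "2 * (sqrt G * sqrt V * sqrt R) \<le> p * V + G / p * R"
proof -
  have "0 \<le> (sqrt p * sqrt V - sqrt G / sqrt p * sqrt R)\<^sup>2" by simp
  also have "\<dots> = p * V + G / p * R - 2 * (sqrt G * sqrt V * sqrt R)"
    using assms by (simp add: power2_diff power_mult_distrib power_divide)
  finally show ?thesis by simp
qed

section \<open>Gaussian distribution function\<close>

lemma real_distribution_normal:
  "\<sigma> > 0 \<Longrightarrow> real_distribution (density lborel (\<lambda>y. ennreal (normal_density 0 \<sigma> y)))"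
  by (simp add: real_distribution_def real_distribution_axioms_def prob_space_normal_density)

lemma Fcdf_range: "\<sigma> > 0 \<Longrightarrow> 0 \<le> Fcdf \<sigma> x \<and> Fcdf \<sigma> x \<le> 1"
  unfolding Fcdf_def cdf_def
  using prob_space.prob_le_1[OF prob_space_normal_density] by (simp add: measure_nonneg)

lemma normal_density_antimono:
  assumes "\<sigma> > 0" "\<bar>x\<bar> \<le> R"
  shows "normal_density 0 \<sigma> R \<le> normal_density 0 \<sigma> x"
proof -
  have "x\<^sup>2 \<le> R\<^sup>2" using assms by (simp add: abs_le_square_iff[symmetric])
  then show ?thesis using assms by (simp add: normal_density_def divide_right_mono)
qed

text \<open>On \<open>[-R, R]\<close> the density is smallest at the endpoints, so it can be bounded
  below by its value at \<open>R\<close> under the integral.\<close>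

lemma Fcdf_diff_ge:
  assumes \<sigma>: "\<sigma> > 0" and "x \<le> y" "\<bar>x\<bar> \<le> R" "\<bar>y\<bar> \<le> R"
  shows "normal_density 0 \<sigma> R * (y - x) \<le> Fcdf \<sigma> y - Fcdf \<sigma> x"
proof (cases "x = y")
  case False
  then have xy: "x < y" using assms by simp
  let ?D = "density lborel (\<lambda>y. ennreal (normal_density 0 \<sigma> y))"
  interpret D: real_distribution ?D by (rule real_distribution_normal[OF \<sigma>])
  have "ennreal (normal_density 0 \<sigma> R * (y - x)) = (\<integral>\<^sup>+ s. ennreal (normal_density 0 \<sigma> R) * indicator {x<..y} s \<partial>lborel)"
    using xy by (simp add: nn_integral_cmult_indicator ennreal_mult)
  also have "\<dots> \<le> (\<integral>\<^sup>+ s. ennreal (normal_density 0 \<sigma> s) * indicator {x<..y} s \<partial>lborel)"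
    using assms by (intro nn_integral_mono) (auto simp: indicator_def intro!: ennreal_leI normal_density_antimono)
  also have "\<dots> = emeasure ?D {x<..y}" by (simp add: emeasure_density)
  also have "\<dots> = ennreal (measure ?D {x<..y})" by (simp add: D.emeasure_eq_measure)
  finally have "normal_density 0 \<sigma> R * (y - x) \<le> measure ?D {x<..y}"
    by (simp add: ennreal_le_iff)
  then show ?thesis unfolding Fcdf_def using D.cdf_diff_eq[OF xy] by simp
qed simp

text \<open>Strong monotonicity of the quantised observation. Both arguments stay within
  \<open>\<bar>c\<bar> + B\<close>, where the density is at least \<open>f\<close>; this is where
  the constant \<open>fM\<close> comes from, and why the states must be kept bounded.\<close>

lemma Fcdf_monotonicity:
  assumes \<sigma>: "\<sigma> > 0" and f: "f \<le> normal_density 0 \<sigma> (\<bar>c\<bar> + B)" and z: "\<bar>z\<bar> \<le> B" and y: "\<bar>y\<bar> \<le> B"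
  shows "(z - y) * (Fcdf \<sigma> (c - z) - Fcdf \<sigma> (c - y)) \<le> - f * (z - y)\<^sup>2"
proof -
  let ?n = "normal_density 0 \<sigma> (\<bar>c\<bar> + B)"
  have ab: "\<bar>c - z\<bar> \<le> \<bar>c\<bar> + B" "\<bar>c - y\<bar> \<le> \<bar>c\<bar> + B" using z y by auto
  have "(z - y) * (Fcdf \<sigma> (c - z) - Fcdf \<sigma> (c - y)) \<le> - ?n * (z - y)\<^sup>2"
  proof (cases "z \<le> y")
    case True
    then have "?n * (y - z) \<le> Fcdf \<sigma> (c - z) - Fcdf \<sigma> (c - y)"
      using Fcdf_diff_ge[OF \<sigma> _ ab(2,1)] by simp
    then have "(y - z) * (?n * (y - z)) \<le> (y - z) * (Fcdf \<sigma> (c - z) - Fcdf \<sigma> (c - y))"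
      using True by (intro mult_left_mono) auto
    then show ?thesis by (simp add: algebra_simps power2_eq_square)
  next
    case False
    then have "?n * (z - y) \<le> Fcdf \<sigma> (c - y) - Fcdf \<sigma> (c - z)"
      using Fcdf_diff_ge[OF \<sigma> _ ab] by simp
    then have "(z - y) * (?n * (z - y)) \<le> (z - y) * (Fcdf \<sigma> (c - y) - Fcdf \<sigma> (c - z))"
      using False by (intro mult_left_mono) auto
    then show ?thesis by (simp add: algebra_simps power2_eq_square)
  qed
  also have "\<dots> \<le> - f * (z - y)\<^sup>2" using f by (simp add: mult_right_mono)
  finally show ?thesis .
qed

lemma Fcdf_measurable [measurable]: "\<sigma> > 0 \<Longrightarrow> Fcdf \<sigma> \<in> borel_measurable borel"
proof -
  assume \<sigma>: "\<sigma> > 0"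
  interpret D: real_distribution "density lborel (\<lambda>y. ennreal (normal_density 0 \<sigma> y))"
    by (rule real_distribution_normal[OF \<sigma>])
  show ?thesis unfolding Fcdf_def by (intro borel_measurable_mono monoI D.cdf_nondecreasing)
qed

section \<open>One step of the algorithm\<close>

definition avg :: "nat \<Rightarrow> (nat \<Rightarrow> real) \<Rightarrow> real" where
  "avg N y = (\<Sum>i<N. y i) / real N"

definition disagreement :: "nat \<Rightarrow> (nat \<Rightarrow> real) \<Rightarrow> real" where
  "disagreement N y = (\<Sum>i<N. (y i - avg N y)\<^sup>2)"

definition est_error :: "nat \<Rightarrow> nat \<Rightarrow> (nat \<Rightarrow> nat set set) \<Rightarrow> (nat \<Rightarrow> real) \<Rightarrow> (nat \<Rightarrow> nat \<Rightarrow> real) \<Rightarrow> real" where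
  "est_error N h E y z = (\<Sum>i<N. \<Sum>j\<in>nbrU h E i. (z i j - y j)\<^sup>2)"

lemma sum_avg_diff: "0 < N \<Longrightarrow> (\<Sum>i<N. y i - avg N y) = 0"
  by (simp add: avg_def sum_subtractf)

text \<open>The exact expansion contains in addition \<open>- real N * (avg N e)\<^sup>2\<close>,
  which has a favourable sign and is dropped.\<close>

lemma disagreement_add:
  assumes "0 < N"
  shows "disagreement N (\<lambda>i. y i + e i) \<le> disagreement N y + 2 * (\<Sum>i<N. (y i - avg N y) * e i) + (\<Sum>i<N. (e i)\<^sup>2)"
proof -
  have av: "avg N (\<lambda>i. y i + e i) = avg N y + avg N e"
    by (simp add: avg_def sum.distrib add_divide_distrib)
  have "disagreement N (\<lambda>i. y i + e i)
     = (\<Sum>i<N. (y i - avg N y)\<^sup>2 + 2 * ((y i - avg N y) * e i) - (2 * avg N e) * (y i - avg N y) + (e i)\<^sup>2 - 2 * avg N e * e i + (avg N e)\<^sup>2)"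
    unfolding disagreement_def av by (intro sum.cong) (auto simp: power2_eq_square algebra_simps)
  also have "\<dots> = disagreement N y + 2 * (\<Sum>i<N. (y i - avg N y) * e i) + (\<Sum>i<N. (e i)\<^sup>2)
      - (2 * avg N e) * (\<Sum>i<N. y i - avg N y) - 2 * avg N e * (\<Sum>i<N. e i) + real N * (avg N e)\<^sup>2"
    by (simp add: sum.distrib sum_subtractf sum_distrib_left[symmetric] disagreement_def)
  also have "\<dots> = disagreement N y + 2 * (\<Sum>i<N. (y i - avg N y) * e i) + (\<Sum>i<N. (e i)\<^sup>2) - real N * (avg N e)\<^sup>2"
  proof -
    have "(\<Sum>i<N. e i) = real N * avg N e" using assms by (simp add: avg_def)
    then show ?thesis unfolding sum_avg_diff[OF assms] by (simp add: power2_eq_square)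
  qed
  also have "\<dots> \<le> disagreement N y + 2 * (\<Sum>i<N. (y i - avg N y) * e i) + (\<Sum>i<N. (e i)\<^sup>2)"
    by (simp only: diff_le_eq le_add_same_cancel1) simp
  finally show ?thesis .
qed

lemma avg_bound:
  assumes "0 < N" "\<And>i. i < N \<Longrightarrow> \<bar>y i\<bar> \<le> B"
  shows "\<bar>avg N y\<bar> \<le> B"
proof -
  have "\<bar>\<Sum>i<N. y i\<bar> \<le> (\<Sum>i<N. B)" by (rule order_trans[OF sum_abs sum_mono]) (use assms in auto)
  then show ?thesis using assms by (simp add: avg_def field_simps)
qed

lemma projM_bound: "0 < B \<Longrightarrow> \<bar>projM B x\<bar> \<le> B"
  by (auto simp: projM_def)

text \<open>Projection onto an interval does not increase the distance to any of its points. With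
  \<open>y\<close> the previous estimate this bounds one update; with \<open>y\<close> the true
  output it removes the projection from the error.\<close>

lemma projM_contract: "\<bar>y\<bar> \<le> B \<Longrightarrow> \<bar>projM B x - y\<bar> \<le> \<bar>x - y\<bar>"
  by (auto simp: projM_def max_def min_def)

lemma sum_nbr_abs_le:
  assumes "valid_graphs N h E" "u < h" "\<And>j. j \<in> nbr E u i \<Longrightarrow> \<bar>g j\<bar> \<le> (B::real)" "B \<ge> 0"
  shows "\<bar>\<Sum>j\<in>nbr E u i. g j\<bar> \<le> real N * B"
proof -
  have "card (nbr E u i) \<le> card {..<N}" using nbr_subset[OF assms(1,2)] by (intro card_mono) auto
  moreover have "\<bar>\<Sum>j\<in>nbr E u i. g j\<bar> \<le> (\<Sum>j\<in>nbr E u i. B)"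
    by (rule order_trans[OF sum_abs sum_mono]) (use assms in auto)
  ultimately show ?thesis using mult_right_mono[OF _ assms(4), of "real (card (nbr E u i))" "real N"] by simp
qed

lemma sum_nbrU_abs_le:
  assumes "valid_graphs N h E" "\<And>j. j \<in> nbrU h E i \<Longrightarrow> \<bar>g j\<bar> \<le> (B::real)" "B \<ge> 0"
  shows "\<bar>\<Sum>j\<in>nbrU h E i. g j\<bar> \<le> real N * B"
proof -
  have "card (nbrU h E i) \<le> card {..<N}" using nbrU_subset[OF assms(1)] by (intro card_mono) auto
  moreover have "\<bar>\<Sum>j\<in>nbrU h E i. g j\<bar> \<le> (\<Sum>j\<in>nbrU h E i. B)"
    by (rule order_trans[OF sum_abs sum_mono]) (use assms in auto)
  ultimately show ?thesis using mult_right_mono[OF _ assms(3), of "real (card (nbrU h E i))" "real N"] by simp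
qed

lemma sum_agents_abs_le:
  assumes "\<And>i. i < N \<Longrightarrow> \<bar>g i\<bar> \<le> (B::real)"
  shows "\<bar>\<Sum>i<N. g i\<bar> \<le> real N * B"
  using order_trans[OF sum_abs sum_mono, of "{..<N}" g "\<lambda>_. B"] assms by simp

text \<open>The pathwise part of the analysis, free of probability. At time \<tau> the estimates
  pass from \<open>z\<close> (time \<tau> - 1) to \<open>z'\<close> (time \<tau>) and the outputs
  from \<open>y\<close> (time \<tau>) to \<open>y'\<close> (time \<tau> + 1). The innovation
  \<theta> stands for \<open>Fcdf\<close> minus the received bit, and only its bound by 1 is
  assumed.\<close>

locale consensus_step =
  fixes N h :: nat and E :: "nat \<Rightarrow> nat set set" and \<beta> \<gamma> Mb \<tau> :: real and u :: nat
    and y y' :: "nat \<Rightarrow> real" and z z' :: "nat \<Rightarrow> nat \<Rightarrow> real" and \<theta> :: "nat \<Rightarrow> nat \<Rightarrow> real"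
  assumes N: "N \<ge> 2" and valid: "valid_graphs N h E" and u: "u < h"
    and params: "\<beta> > 0" "\<gamma> > 0" "Mb > 0" "\<tau> \<ge> 1"
    and degree: "\<And>i. \<gamma> * real (card (nbr E u i)) \<le> \<tau> + 1"
    and yb: "\<And>i. i < N \<Longrightarrow> \<bar>y i\<bar> \<le> Mb"
    and zb: "\<And>i j. i < N \<Longrightarrow> j \<in> nbrU h E i \<Longrightarrow> \<bar>z i j\<bar> \<le> Mb"
    and \<theta>: "\<And>i j. \<bar>\<theta> i j\<bar> \<le> 1"
    and z': "\<And>i j. i < N \<Longrightarrow> j \<in> nbrU h E i \<Longrightarrow>
      z' i j = projM Mb (z i j + \<beta> / \<tau> * (if j \<in> nbr E u i then 1 else 0) * \<theta> i j)"
    and y': "\<And>i. i < N \<Longrightarrow> y' i = y i + \<gamma> / (\<tau> + 1) * (\<Sum>j\<in>nbr E u i. z' i j - y i)"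
begin

lemma N0: "0 < N" using N by simp

lemma nbrU_N: "j \<in> nbrU h E i \<Longrightarrow> j < N"
  using nbrU_subset[OF valid] by blast

lemma nbr_nbrU: "j \<in> nbr E u i \<Longrightarrow> j \<in> nbrU h E i"
  using nbr_subset_nbrU[OF u] by blast

lemma z'_bound: "i < N \<Longrightarrow> j \<in> nbrU h E i \<Longrightarrow> \<bar>z' i j\<bar> \<le> Mb"
  using projM_bound params z' by simp

lemma z'_diff: assumes "i < N" "j \<in> nbrU h E i" shows "\<bar>z' i j - z i j\<bar> \<le> \<beta> / \<tau>"
proof -
  have "\<bar>z' i j - z i j\<bar> \<le> \<bar>\<beta> / \<tau> * (if j \<in> nbr E u i then 1 else 0) * \<theta> i j\<bar>"
    using projM_contract[OF zb[OF assms], of "z i j + \<beta> / \<tau> * (if j \<in> nbr E u i then 1 else 0) * \<theta> i j"] z'[OF assms] by simp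
  also have "\<dots> \<le> \<beta> / \<tau> * 1"
    using params \<theta>[of i j] by (auto simp: abs_mult intro!: divide_right_mono mult_left_le)
  finally show ?thesis by simp
qed

text \<open>\<open>A / \<tau>\<close> bounds the move of an output: step size at most
  \<open>\<gamma> / \<tau>\<close>, at most \<open>N\<close> neighbours, differences at most
  \<open>2 * Mb\<close>.\<close>

definition "A = 2 * \<gamma> * real N * Mb"

text \<open>\<open>B / \<tau>\<^sup>2\<close> is the second-order error of \<open>y'\<close>: the
  first summand pays for using the old estimates instead of the new ones, the second for
  \<open>\<gamma> / \<tau>\<close> instead of \<open>\<gamma> / (\<tau> + 1)\<close>.\<close>

definition "B = \<gamma> * real N * \<beta> + 2 * \<gamma> * real N * Mb"

lemma AB: "A \<ge> 0" "B \<ge> 0" using params by (auto simp: A_def B_def)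

lemma y'_diff: assumes i: "i < N" shows "\<bar>y' i - y i\<bar> \<le> A / \<tau>"
proof -
  have "\<bar>\<Sum>j\<in>nbr E u i. z' i j - y i\<bar> \<le> real N * (2 * Mb)"
  proof (rule sum_nbr_abs_le[OF valid u])
    fix j assume "j \<in> nbr E u i"
    then show "\<bar>z' i j - y i\<bar> \<le> 2 * Mb" using z'_bound[OF i nbr_nbrU, of j] yb[OF i] by linarith
  qed (use params in simp)
  then have "\<gamma> / (\<tau> + 1) * \<bar>\<Sum>j\<in>nbr E u i. z' i j - y i\<bar> \<le> \<gamma> / \<tau> * (real N * (2 * Mb))"
    using params by (intro mult_mono divide_left_mono) auto
  then show ?thesis using params unfolding y'[OF i] by (simp add: abs_mult A_def mult_ac)
qed

text \<open>The degree condition makes the update of an agent a convex combination of points of the interval.\<close>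

lemma y'_bound: assumes i: "i < N" shows "\<bar>y' i\<bar> \<le> Mb"
proof -
  define r where "r = \<gamma> / (\<tau> + 1)"
  define n where "n = real (card (nbr E u i))"
  have r: "r \<ge> 0" "r * n \<le> 1" using params degree[of i] by (auto simp: r_def n_def field_simps)
  have "\<bar>\<Sum>j\<in>nbr E u i. z' i j\<bar> \<le> (\<Sum>j\<in>nbr E u i. Mb)"
    by (rule order_trans[OF sum_abs sum_mono]) (use z'_bound[OF i nbr_nbrU] in auto)
  then have s: "\<bar>\<Sum>j\<in>nbr E u i. z' i j\<bar> \<le> n * Mb" by (simp add: n_def)
  have "y' i = (1 - r * n) * y i + r * (\<Sum>j\<in>nbr E u i. z' i j)"
    unfolding y'[OF i] r_def[symmetric] sum_subtractf by (simp add: n_def algebra_simps)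
  then have "\<bar>y' i\<bar> \<le> \<bar>(1 - r * n) * y i\<bar> + \<bar>r * (\<Sum>j\<in>nbr E u i. z' i j)\<bar>" by (simp only: abs_triangle_ineq)
  also have "\<dots> \<le> (1 - r * n) * Mb + r * (n * Mb)"
    unfolding abs_mult using r s yb[OF i] by (intro add_mono mult_mono) auto
  also have "\<dots> = Mb" by (simp add: algebra_simps)
  finally show ?thesis .
qed

text \<open>Formed with the old estimates \<open>z\<close> instead of \<open>z'\<close>, so that the
  first-order drift is a function of the state before the step and the current graph.\<close>

definition "g i = (\<Sum>j\<in>nbr E u i. z i j - y i)"

lemma y'_expansion: assumes i: "i < N" shows "\<bar>y' i - y i - \<gamma> / \<tau> * g i\<bar> \<le> B / \<tau>\<^sup>2"
proof -
  have gb: "\<bar>g i\<bar> \<le> real N * (2 * Mb)" unfolding g_def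
  proof (rule sum_nbr_abs_le[OF valid u])
    fix j assume "j \<in> nbr E u i"
    then show "\<bar>z i j - y i\<bar> \<le> 2 * Mb" using zb[OF i nbr_nbrU, of j] yb[OF i] by linarith
  qed (use params in simp)
  have db: "\<bar>\<Sum>j\<in>nbr E u i. z' i j - z i j\<bar> \<le> real N * (\<beta> / \<tau>)"
    by (rule sum_nbr_abs_le[OF valid u]) (use z'_diff[OF i nbr_nbrU] params in auto)
  have "y' i - y i - \<gamma> / \<tau> * g i
      = \<gamma> / (\<tau> + 1) * (\<Sum>j\<in>nbr E u i. z' i j - z i j) - (\<gamma> / (\<tau> * (\<tau> + 1))) * g i"
  proof -
    have "(\<Sum>j\<in>nbr E u i. z' i j - y i) = (\<Sum>j\<in>nbr E u i. z' i j - z i j) + g i"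
      by (simp add: g_def sum.distrib[symmetric])
    then have "y' i - y i - \<gamma> / \<tau> * g i
      = \<gamma> / (\<tau> + 1) * (\<Sum>j\<in>nbr E u i. z' i j - z i j) + (\<gamma> / (\<tau> + 1) - \<gamma> / \<tau>) * g i"
      unfolding y'[OF i] by (simp add: algebra_simps)
    moreover have "\<gamma> / (\<tau> + 1) - \<gamma> / \<tau> = - (\<gamma> / (\<tau> * (\<tau> + 1)))" using params by (simp add: field_simps)
    ultimately show ?thesis by simp
  qed
  then have "\<bar>y' i - y i - \<gamma> / \<tau> * g i\<bar>
     \<le> \<bar>\<gamma> / (\<tau> + 1) * (\<Sum>j\<in>nbr E u i. z' i j - z i j)\<bar> + \<bar>(\<gamma> / (\<tau> * (\<tau> + 1))) * g i\<bar>"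
    by (simp only: abs_triangle_ineq4)
  also have "\<dots> \<le> \<gamma> / \<tau> * (real N * (\<beta> / \<tau>)) + \<gamma> / (\<tau> * \<tau>) * (real N * (2 * Mb))"
    unfolding abs_mult using params gb db by (intro add_mono mult_mono) (auto simp: frac_le)
  also have "\<dots> = B / \<tau>\<^sup>2" using params by (simp add: B_def power2_eq_square field_simps)
  finally show ?thesis .
qed

lemma y'_sq: assumes "i < N" shows "(y' i - y i)\<^sup>2 \<le> A\<^sup>2 / \<tau>\<^sup>2"
proof -
  have "\<bar>y' i - y i\<bar>\<^sup>2 \<le> (A / \<tau>)\<^sup>2" using y'_diff[OF assms] by (intro power_mono) auto
  then show ?thesis by (simp add: power_divide)
qed

lemma disagreement_step:
  "disagreement N y' \<le> disagreement N y + 2 * \<gamma> / \<tau> * (\<Sum>i<N. (y i - avg N y) * g i)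
     + (4 * real N * Mb * B + real N * A\<^sup>2) / \<tau>\<^sup>2"
proof -
  define e where "e = (\<lambda>i. y' i - y i)"
  have 1: "disagreement N y' \<le> disagreement N y + 2 * (\<Sum>i<N. (y i - avg N y) * e i) + (\<Sum>i<N. (e i)\<^sup>2)"
    using disagreement_add[OF N0, of y e] by (simp add: e_def)
  have 2: "(\<Sum>i<N. (e i)\<^sup>2) \<le> real N * (A\<^sup>2 / \<tau>\<^sup>2)"
    using sum_mono[of "{..<N}" "\<lambda>i. (e i)\<^sup>2" "\<lambda>_. A\<^sup>2 / \<tau>\<^sup>2"] y'_sq by (simp add: e_def)
  have "\<bar>\<Sum>i<N. (y i - avg N y) * (e i - \<gamma> / \<tau> * g i)\<bar> \<le> real N * (2 * Mb * (B / \<tau>\<^sup>2))"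
  proof (rule sum_agents_abs_le)
    fix i assume i: "i < N"
    have "\<bar>y i - avg N y\<bar> \<le> 2 * Mb" using yb[OF i] avg_bound[OF N0 yb] by fastforce
    then show "\<bar>(y i - avg N y) * (e i - \<gamma> / \<tau> * g i)\<bar> \<le> 2 * Mb * (B / \<tau>\<^sup>2)"
      unfolding abs_mult e_def using y'_expansion[OF i] params by (intro mult_mono) auto
  qed
  moreover have "(\<Sum>i<N. (y i - avg N y) * (e i - \<gamma> / \<tau> * g i))
     = (\<Sum>i<N. (y i - avg N y) * e i) - \<gamma> / \<tau> * (\<Sum>i<N. (y i - avg N y) * g i)"
    unfolding sum_distrib_left sum_subtractf[symmetric] by (intro sum.cong refl) (simp add: algebra_simps diff_divide_distrib)
  ultimately have 3: "(\<Sum>i<N. (y i - avg N y) * e i)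
     \<le> \<gamma> / \<tau> * (\<Sum>i<N. (y i - avg N y) * g i) + real N * (2 * Mb * (B / \<tau>\<^sup>2))" by linarith
  have "disagreement N y' \<le> disagreement N y
      + 2 * (\<gamma> / \<tau> * (\<Sum>i<N. (y i - avg N y) * g i) + real N * (2 * Mb * (B / \<tau>\<^sup>2))) + real N * (A\<^sup>2 / \<tau>\<^sup>2)"
    by (rule order_trans[OF 1 add_mono[OF add_mono[OF order_refl mult_left_mono[OF 3]] 2]]) simp
  then show ?thesis by (simp add: algebra_simps add_divide_distrib)
qed

lemma est_error_step:
  "est_error N h E y' z' \<le> est_error N h E y z
     - 2 * \<gamma> / \<tau> * (\<Sum>i<N. \<Sum>j\<in>nbrU h E i. (z i j - y j) * g j)
     + 2 * \<beta> / \<tau> * (\<Sum>i<N. \<Sum>j\<in>nbr E u i. (z i j - y j) * \<theta> i j)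
     + real N * (real N * (4 * Mb * B + 2 * \<beta> * A + A\<^sup>2 + \<beta>\<^sup>2)) / \<tau>\<^sup>2"
proof -
  define C where "C = 4 * Mb * B + 2 * \<beta> * A + A\<^sup>2 + \<beta>\<^sup>2"
  have C: "C \<ge> 0" using AB params by (simp add: C_def)
  have pt: "(z' i j - y' j)\<^sup>2 \<le> (z i j - y j)\<^sup>2 - 2 * \<gamma> / \<tau> * ((z i j - y j) * g j)
      + 2 * \<beta> / \<tau> * (if j \<in> nbr E u i then (z i j - y j) * \<theta> i j else 0) + C / \<tau>\<^sup>2"
    if i: "i < N" and j: "j \<in> nbrU h E i" for i j
  proof -
    have jN: "j < N" by (rule nbrU_N[OF j])
    define \<eta> e r where "\<eta> = z i j - y j" and "e = y' j - y j" and "r = y' j - y j - \<gamma> / \<tau> * g j"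
    define ind where "ind = (if j \<in> nbr E u i then 1 else 0 :: real)"
    have eb: "\<bar>\<eta>\<bar> \<le> 2 * Mb" using zb[OF i j] yb[OF jN] by (simp add: \<eta>_def)
    \<comment> \<open>The true output lies in the interval, so projecting can only bring the
      estimate closer to it.\<close>
    have "\<bar>z' i j - y j\<bar> \<le> \<bar>z i j + \<beta> / \<tau> * ind * \<theta> i j - y j\<bar>"
      unfolding z'[OF i j] ind_def by (rule projM_contract[OF yb[OF jN]])
    then have "(z' i j - y j)\<^sup>2 \<le> (\<eta> + \<beta> / \<tau> * ind * \<theta> i j)\<^sup>2"
      unfolding abs_le_square_iff by (simp add: \<eta>_def algebra_simps)
    also have "\<dots> = \<eta>\<^sup>2 + 2 * \<beta> / \<tau> * (ind * (\<eta> * \<theta> i j)) + (\<beta> / \<tau>)\<^sup>2 * (ind * \<theta> i j)\<^sup>2"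
      by (simp add: power2_eq_square algebra_simps)
    also have "(\<beta> / \<tau>)\<^sup>2 * (ind * \<theta> i j)\<^sup>2 \<le> (\<beta> / \<tau>)\<^sup>2 * 1"
    proof (rule mult_left_mono)
      show "(ind * \<theta> i j)\<^sup>2 \<le> 1" using \<theta>[of i j] by (simp add: ind_def abs_square_le_1)
    qed simp
    finally have 1: "(z' i j - y j)\<^sup>2 \<le> \<eta>\<^sup>2 + 2 * \<beta> / \<tau> * (ind * (\<eta> * \<theta> i j)) + \<beta>\<^sup>2 / \<tau>\<^sup>2"
      by (simp add: power_divide)
    \<comment> \<open>The cross term \<open>-2 * (z' - y) * e\<close> is split by
      \<open>z' - y = \<eta> + (z' - z)\<close> and \<open>e = \<gamma> / \<tau> * g + r\<close>;
      only the product of \<eta> with the first-order move survives, the other products are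
      \<open>O(1/\<tau>^2)\<close>.\<close>
    have "(z' i j - y' j)\<^sup>2 = (z' i j - y j)\<^sup>2 - 2 * (\<eta> * (\<gamma> / \<tau> * g j)) - 2 * (\<eta> * r) - 2 * ((z' i j - z i j) * e) + e\<^sup>2"
      by (simp add: \<eta>_def e_def r_def power2_eq_square algebra_simps)
    moreover have "\<bar>\<eta> * r\<bar> \<le> 2 * Mb * (B / \<tau>\<^sup>2)"
      unfolding abs_mult using eb y'_expansion[OF jN] params by (intro mult_mono) (auto simp: r_def)
    moreover have "\<bar>(z' i j - z i j) * e\<bar> \<le> \<beta> / \<tau> * (A / \<tau>)"
      unfolding abs_mult using z'_diff[OF i j] y'_diff[OF jN] params by (intro mult_mono) (auto simp: e_def)
    moreover have "e\<^sup>2 \<le> A\<^sup>2 / \<tau>\<^sup>2" using y'_sq[OF jN] by (simp add: e_def)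
    ultimately have "(z' i j - y' j)\<^sup>2 \<le> \<eta>\<^sup>2 + 2 * \<beta> / \<tau> * (ind * (\<eta> * \<theta> i j)) + \<beta>\<^sup>2 / \<tau>\<^sup>2
        - 2 * (\<eta> * (\<gamma> / \<tau> * g j)) + 2 * (2 * Mb * (B / \<tau>\<^sup>2)) + 2 * (\<beta> / \<tau> * (A / \<tau>)) + A\<^sup>2 / \<tau>\<^sup>2"
      using 1 by linarith
    also have "\<dots> = \<eta>\<^sup>2 - 2 * \<gamma> / \<tau> * (\<eta> * g j) + 2 * \<beta> / \<tau> * (ind * (\<eta> * \<theta> i j)) + C / \<tau>\<^sup>2"
      by (simp add: C_def power2_eq_square add_divide_distrib algebra_simps)
    finally show ?thesis by (simp add: \<eta>_def ind_def split: if_splits)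
  qed
  have "est_error N h E y' z' \<le> (\<Sum>i<N. \<Sum>j\<in>nbrU h E i. (z i j - y j)\<^sup>2 - 2 * \<gamma> / \<tau> * ((z i j - y j) * g j)
      + 2 * \<beta> / \<tau> * (if j \<in> nbr E u i then (z i j - y j) * \<theta> i j else 0) + C / \<tau>\<^sup>2)"
    unfolding est_error_def by (intro sum_mono pt) auto
  also have "\<dots> = est_error N h E y z
     - 2 * \<gamma> / \<tau> * (\<Sum>i<N. \<Sum>j\<in>nbrU h E i. (z i j - y j) * g j)
     + 2 * \<beta> / \<tau> * (\<Sum>i<N. \<Sum>j\<in>nbr E u i. (z i j - y j) * \<theta> i j) + (\<Sum>i<N. \<Sum>j\<in>nbrU h E i. C / \<tau>\<^sup>2)"
    unfolding est_error_def sum_nbr_nbrU[OF valid u]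
    by (simp only: sum.distrib sum_subtractf sum_distrib_left)
  also have "(\<Sum>i<N. \<Sum>j\<in>nbrU h E i. C / \<tau>\<^sup>2) \<le> real N * (real N * (C / \<tau>\<^sup>2))"
  proof (rule order_trans[OF abs_ge_self])
    show "\<bar>\<Sum>i<N. \<Sum>j\<in>nbrU h E i. C / \<tau>\<^sup>2\<bar> \<le> real N * (real N * (C / \<tau>\<^sup>2))"
      using C by (intro sum_agents_abs_le sum_nbrU_abs_le[OF valid]) auto
  qed
  finally show ?thesis by (simp add: C_def)
qed

lemma drift_disagreement:
  assumes pos: "\<mu> > 0"
  shows "2 * (\<Sum>i<N. (y i - avg N y) * g i)
    \<le> \<mu> * disagreement N y + lambdaG N h E / \<mu> * est_error N h E y z
      - 2 * (\<Sum>i<N. y i * (\<Sum>j\<in>nbr E u i. y i - y j))"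
proof -
  define \<delta> where "\<delta> = (\<lambda>i. y i - avg N y)"
  have \<delta>0: "(\<Sum>i<N. \<delta> i) = 0" using sum_avg_diff[OF N0] by (simp add: \<delta>_def)
  have h0: "0 < h" using u by simp
  have gsplit: "g i = (\<Sum>j\<in>nbr E u i. z i j - y j) - (\<Sum>j\<in>nbr E u i. y i - y j)" for i
    by (simp add: g_def sum_subtractf)
  have "2 * (\<Sum>i<N. \<delta> i * (\<Sum>j\<in>nbr E u i. \<delta> i - \<delta> j)) = 2 * (\<Sum>i<N. y i * (\<Sum>j\<in>nbr E u i. y i - y j))"
    unfolding laplacian_quadratic[OF valid u] by (simp add: \<delta>_def)
  then have q: "2 * (\<Sum>i<N. \<delta> i * g i) = 2 * (\<Sum>i<N. \<delta> i * (\<Sum>j\<in>nbr E u i. z i j - y j))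
      - 2 * (\<Sum>i<N. y i * (\<Sum>j\<in>nbr E u i. y i - y j))"
    by (simp add: gsplit right_diff_distrib sum_subtractf \<delta>_def)
  have "2 * (\<Sum>i<N. \<delta> i * (\<Sum>j\<in>nbr E u i. z i j - y j))
     \<le> 2 * (sqrt (lambdaG N h E) * sqrt (disagreement N y) * sqrt (est_error N h E y z))"
    using lambdaG_bound[OF valid u \<delta>0, of "\<lambda>i j. z i j - y j"]
    unfolding disagreement_def est_error_def \<delta>_def by linarith
  also have "\<dots> \<le> \<mu> * disagreement N y + lambdaG N h E / \<mu> * est_error N h E y z"
    using pos unfolding lambdaG_def disagreement_def est_error_def
    by (intro sqrt_young Max_square_nonneg[OF h0] sum_nonneg) auto
  finally show ?thesis using q unfolding \<delta>_def by linarith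
qed

text \<open>Neither part of this coupling has a definite sign, so both are bounded in absolute
  value. The Laplacian sees only deviations from the average, which is why
  \<open>disagreement\<close> and not the size of \<open>y\<close> appears.\<close>

lemma drift_est_error:
  assumes p: "p > 0"
  shows "- 2 * (\<Sum>i<N. \<Sum>j\<in>nbrU h E i. (z i j - y j) * g j)
    \<le> p * disagreement N y + (2 * sqrt (lambdaQW N h E) + lambdaQL N h E / p) * est_error N h E y z"
proof -
  define \<delta> where "\<delta> = (\<lambda>i. y i - avg N y)"
  define \<eta> where "\<eta> = (\<lambda>i j. z i j - y j)"
  have h0: "0 < h" using u by simp
  have gsplit: "g i = (\<Sum>j\<in>nbr E u i. \<eta> i j) - (\<Sum>j\<in>nbr E u i. \<delta> i - \<delta> j)" for i
    by (simp add: g_def sum_subtractf \<eta>_def \<delta>_def)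
  have split: "(\<Sum>i<N. \<Sum>j\<in>nbrU h E i. \<eta> i j * g j)
    = (\<Sum>i<N. \<Sum>j\<in>nbrU h E i. \<eta> i j * (\<Sum>l\<in>nbr E u j. \<eta> j l))
     - (\<Sum>i<N. \<Sum>j\<in>nbrU h E i. \<eta> i j * (\<Sum>l\<in>nbr E u j. \<delta> j - \<delta> l))"
    unfolding gsplit right_diff_distrib sum_subtractf ..
  have R: "est_error N h E y z = (\<Sum>i<N. \<Sum>j\<in>nbrU h E i. (\<eta> i j)\<^sup>2)" by (simp add: est_error_def \<eta>_def)
  have V: "disagreement N y = (\<Sum>i<N. (\<delta> i)\<^sup>2)" by (simp add: disagreement_def \<delta>_def)
  have 1: "\<bar>\<Sum>i<N. \<Sum>j\<in>nbrU h E i. \<eta> i j * (\<Sum>l\<in>nbr E u j. \<eta> j l)\<bar> \<le> sqrt (lambdaQW N h E) * est_error N h E y z"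
    unfolding R by (rule lambdaQW_bound[OF valid u])
  have 2: "\<bar>\<Sum>i<N. \<Sum>j\<in>nbrU h E i. \<eta> i j * (\<Sum>l\<in>nbr E u j. \<delta> j - \<delta> l)\<bar>
     \<le> sqrt (lambdaQL N h E) * sqrt (est_error N h E y z) * sqrt (disagreement N y)"
    unfolding R V by (rule lambdaQL_bound[OF valid u])
  have "2 * (sqrt (lambdaQL N h E) * sqrt (disagreement N y) * sqrt (est_error N h E y z))
     \<le> p * disagreement N y + lambdaQL N h E / p * est_error N h E y z"
    using p unfolding lambdaQL_def disagreement_def est_error_def
    by (intro sqrt_young Max_square_nonneg[OF h0] sum_nonneg) auto
  then have "2 * (sqrt (lambdaQL N h E) * sqrt (est_error N h E y z) * sqrt (disagreement N y))
     \<le> p * disagreement N y + lambdaQL N h E / p * est_error N h E y z" by (simp add: mult_ac)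
  with 1 2 have "- 2 * (\<Sum>i<N. \<Sum>j\<in>nbrU h E i. \<eta> i j * g j)
    \<le> p * disagreement N y + lambdaQL N h E / p * est_error N h E y z + 2 * (sqrt (lambdaQW N h E) * est_error N h E y z)"
    unfolding split by (simp add: abs_le_iff)
  then show ?thesis by (simp add: \<eta>_def algebra_simps)
qed

end

text \<open>The two dissipative terms that depend on the current graph: the Laplacian form and the
  error on the active pairs. For one graph each can vanish on a state far from consensus, so a lower
  bound is sought only after averaging over the stationary law.\<close>

definition sw_drift :: "nat \<Rightarrow> (nat \<Rightarrow> nat set set) \<Rightarrow> real \<Rightarrow> real \<Rightarrow> nat \<Rightarrow> (nat \<Rightarrow> real) \<Rightarrow> (nat \<Rightarrow> nat \<Rightarrow> real) \<Rightarrow> real" where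
  "sw_drift N E \<gamma> \<rho> u y z = 2 * \<gamma> * (\<Sum>i<N. y i * (\<Sum>j\<in>nbr E u i. y i - y j))
     + 2 * \<rho> * (\<Sum>i<N. \<Sum>j\<in>nbr E u i. (z i j - y j)\<^sup>2)"

definition lyap :: "nat \<Rightarrow> nat \<Rightarrow> (nat \<Rightarrow> nat set set) \<Rightarrow> real \<Rightarrow> (nat \<Rightarrow> real) \<Rightarrow> (nat \<Rightarrow> nat \<Rightarrow> real) \<Rightarrow> real" where
  "lyap N h E w y z = disagreement N y + w * est_error N h E y z"

lemma abs_conic_le:
  fixes p q :: real
  assumes "p \<ge> 0" "q \<ge> 0" "\<bar>x\<bar> \<le> a" "\<bar>y\<bar> \<le> b"
  shows "\<bar>p * x + q * y\<bar> \<le> p * a + q * b"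
proof -
  have "\<bar>p * x + q * y\<bar> \<le> p * \<bar>x\<bar> + q * \<bar>y\<bar>"
    using abs_triangle_ineq[of "p * x" "q * y"] assms by (simp add: abs_mult)
  also have "\<dots> \<le> p * a + q * b" using assms by (intro add_mono mult_left_mono)
  finally show ?thesis .
qed

lemma sw_drift_pairs:
  "sw_drift N E \<gamma> \<rho> u y z
    = (\<Sum>i<N. \<Sum>j\<in>nbr E u i. 2 * \<gamma> * (y i * (y i - y j)) + 2 * \<rho> * (z i j - y j)\<^sup>2)"
  unfolding sw_drift_def sum_distrib_left sum.distrib[symmetric] ..

text \<open>\<zeta> collects the noise left over once the innovation has been compared with its
  strongly monotone part. Taking \<open>p = lambdaG / \<mu>\<close> in the second Young inequality
  gives both off-diagonal coefficients the same value; for \<mu> = \<open>lambda2\<close> the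
  bracket multiplying \<open>est_error\<close> becomes \<open>alpha_const\<close>.\<close>

lemma (in consensus_step) lyapunov_step:
  assumes \<mu>: "\<mu> > 0" and G: "lambdaG N h E > 0" and w: "w \<ge> 0"
    and \<zeta>: "\<And>i j. i < N \<Longrightarrow> j \<in> nbr E u i \<Longrightarrow> (z i j - y j) * \<theta> i j \<le> - f * (z i j - y j)\<^sup>2 + \<zeta> i j"
  defines "p \<equiv> lambdaG N h E / \<mu>"
  shows "lyap N h E w y' z' \<le> lyap N h E w y z
    + (- sw_drift N E \<gamma> (w * \<beta> * f) u y z + (\<gamma> * \<mu> + w * (\<gamma> * p)) * disagreement N y
       + (\<gamma> * p + w * (\<gamma> * (2 * sqrt (lambdaQW N h E) + lambdaQL N h E / p))) * est_error N h E y z) / \<tau>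
    + 2 * w * \<beta> * (\<Sum>i<N. \<Sum>j\<in>nbr E u i. \<zeta> i j) / \<tau>
    + (4 * real N * Mb * B + real N * A\<^sup>2 + w * (real N * (real N * (4 * Mb * B + 2 * \<beta> * A + A\<^sup>2 + \<beta>\<^sup>2)))) / \<tau>\<^sup>2"
proof -
  define V R where "V = disagreement N y" and "R = est_error N h E y z"
  define X where "X = (\<Sum>i<N. (y i - avg N y) * g i)"
  define Y where "Y = (\<Sum>i<N. \<Sum>j\<in>nbrU h E i. (z i j - y j) * g j)"
  define Q where "Q = (\<Sum>i<N. y i * (\<Sum>j\<in>nbr E u i. y i - y j))"
  define H where "H = (\<Sum>i<N. \<Sum>j\<in>nbr E u i. (z i j - y j)\<^sup>2)"
  define Th where "Th = (\<Sum>i<N. \<Sum>j\<in>nbr E u i. (z i j - y j) * \<theta> i j)"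
  define Ze where "Ze = (\<Sum>i<N. \<Sum>j\<in>nbr E u i. \<zeta> i j)"
  define l where "l = 2 * sqrt (lambdaQW N h E) + lambdaQL N h E / p"
  define C1 C2 where "C1 = 4 * real N * Mb * B + real N * A\<^sup>2"
    and "C2 = real N * (real N * (4 * Mb * B + 2 * \<beta> * A + A\<^sup>2 + \<beta>\<^sup>2))"
  have p: "p > 0" using \<mu> G by (simp add: p_def)
  have \<tau>: "\<tau> > 0" using params by simp
  have "Th \<le> (\<Sum>i<N. \<Sum>j\<in>nbr E u i. - f * (z i j - y j)\<^sup>2 + \<zeta> i j)"
    unfolding Th_def by (intro sum_mono \<zeta>) auto
  then have Th: "Th \<le> - f * H + Ze" by (simp add: H_def Ze_def sum.distrib sum_subtractf sum_distrib_left sum_negf)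
  have 1: "2 * X \<le> \<mu> * V + p * R - 2 * Q"
    using drift_disagreement[OF \<mu>] by (simp add: X_def V_def R_def Q_def p_def)
  have 2: "- 2 * Y \<le> p * V + l * R"
    using drift_est_error[OF p] by (simp add: Y_def V_def R_def l_def)
  have 3: "disagreement N y' \<le> V + 2 * \<gamma> / \<tau> * X + C1 / \<tau>\<^sup>2"
    using disagreement_step by (simp add: V_def X_def C1_def)
  have 4: "est_error N h E y' z' \<le> R - 2 * \<gamma> / \<tau> * Y + 2 * \<beta> / \<tau> * Th + C2 / \<tau>\<^sup>2"
    using est_error_step by (simp add: R_def Y_def Th_def C2_def)
  have "2 * \<gamma> / \<tau> * X \<le> \<gamma> / \<tau> * (\<mu> * V + p * R - 2 * Q)"
    using mult_left_mono[OF 1, of "\<gamma> / \<tau>"] params \<tau> by (simp add: mult_ac)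
  with 3 have 5: "disagreement N y' \<le> V + \<gamma> / \<tau> * (\<mu> * V + p * R - 2 * Q) + C1 / \<tau>\<^sup>2" by linarith
  have "- (2 * \<gamma> / \<tau> * Y) \<le> \<gamma> / \<tau> * (p * V + l * R)"
    using mult_left_mono[OF 2, of "\<gamma> / \<tau>"] params \<tau> by (simp add: mult_ac)
  moreover have "2 * \<beta> / \<tau> * Th \<le> 2 * \<beta> / \<tau> * (- f * H + Ze)"
    using Th params \<tau> by (intro mult_left_mono) auto
  ultimately have 6: "est_error N h E y' z' \<le> R + \<gamma> / \<tau> * (p * V + l * R) + 2 * \<beta> / \<tau> * (- f * H + Ze) + C2 / \<tau>\<^sup>2"
    using 4 by linarith
  have "lyap N h E w y' z' \<le> V + \<gamma> / \<tau> * (\<mu> * V + p * R - 2 * Q) + C1 / \<tau>\<^sup>2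
      + w * (R + \<gamma> / \<tau> * (p * V + l * R) + 2 * \<beta> / \<tau> * (- f * H + Ze) + C2 / \<tau>\<^sup>2)"
    unfolding lyap_def by (intro add_mono[OF 5 mult_left_mono[OF 6 w]])
  also have "\<dots> = V + w * R + (- (2 * \<gamma> * Q + 2 * (w * \<beta> * f) * H) + (\<gamma> * \<mu> + w * (\<gamma> * p)) * V
       + (\<gamma> * p + w * (\<gamma> * l)) * R) / \<tau> + 2 * w * \<beta> * Ze / \<tau> + (C1 + w * C2) / \<tau>\<^sup>2"
    using \<tau> by (simp add: field_simps power2_eq_square)
  finally show ?thesis
    by (simp add: lyap_def sw_drift_def V_def R_def Q_def H_def Ze_def l_def C1_def C2_def)
qed

lemma sw_drift_abs_le:
  assumes v: "valid_graphs N h E" and u: "u < h" and pos: "\<gamma> \<ge> 0" "\<rho> \<ge> 0" "Mb \<ge> 0"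
    and yb: "\<And>i. i < N \<Longrightarrow> \<bar>y i\<bar> \<le> Mb"
    and zb: "\<And>i j. i < N \<Longrightarrow> j \<in> nbrU h E i \<Longrightarrow> \<bar>z i j\<bar> \<le> Mb"
  shows "\<bar>sw_drift N E \<gamma> \<rho> u y z\<bar> \<le> real N * (real N * (4 * \<gamma> * Mb\<^sup>2 + 8 * \<rho> * Mb\<^sup>2))"
  unfolding sw_drift_pairs
proof (intro sum_agents_abs_le sum_nbr_abs_le[OF v u])
  fix i j assume i: "i < N" and j: "j \<in> nbr E u i"
  have jU: "j \<in> nbrU h E i" using j nbr_subset_nbrU[OF u] by blast
  have jN: "j < N" using j nbr_subset[OF v u] by blast
  have "\<bar>y i * (y i - y j)\<bar> \<le> Mb * (2 * Mb)"
    unfolding abs_mult using yb[OF i] yb[OF jN] pos by (intro mult_mono) auto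
  moreover have "\<bar>z i j - y j\<bar>\<^sup>2 \<le> (2 * Mb)\<^sup>2"
    using zb[OF i jU] yb[OF jN] by (intro power_mono) auto
  ultimately have "\<bar>2 * \<gamma> * (y i * (y i - y j)) + 2 * \<rho> * (z i j - y j)\<^sup>2\<bar> \<le> 2 * \<gamma> * (Mb * (2 * Mb)) + 2 * \<rho> * (2 * Mb)\<^sup>2"
    using pos by (intro abs_conic_le) auto
  then show "\<bar>2 * \<gamma> * (y i * (y i - y j)) + 2 * \<rho> * (z i j - y j)\<^sup>2\<bar> \<le> 4 * \<gamma> * Mb\<^sup>2 + 8 * \<rho> * Mb\<^sup>2"
    by (simp add: power2_eq_square algebra_simps)
qed (use pos in auto)

text \<open>Used with \<open>r\<close> of order \<open>1/\<tau>\<close>: it is the price of moving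
  the state one step ahead in the Poisson correction.\<close>

lemma sw_drift_lipschitz:
  assumes v: "valid_graphs N h E" and u: "u < h" and pos: "\<gamma> \<ge> 0" "\<rho> \<ge> 0" "Mb \<ge> 0" "r \<ge> 0"
    and yb: "\<And>i. i < N \<Longrightarrow> \<bar>y i\<bar> \<le> Mb" "\<And>i. i < N \<Longrightarrow> \<bar>y' i\<bar> \<le> Mb"
    and zb: "\<And>i j. i < N \<Longrightarrow> j \<in> nbrU h E i \<Longrightarrow> \<bar>z i j\<bar> \<le> Mb"
      "\<And>i j. i < N \<Longrightarrow> j \<in> nbrU h E i \<Longrightarrow> \<bar>z' i j\<bar> \<le> Mb"
    and yd: "\<And>i. i < N \<Longrightarrow> \<bar>y' i - y i\<bar> \<le> r"
    and zd: "\<And>i j. i < N \<Longrightarrow> j \<in> nbrU h E i \<Longrightarrow> \<bar>z' i j - z i j\<bar> \<le> r"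
  shows "\<bar>sw_drift N E \<gamma> \<rho> u y' z' - sw_drift N E \<gamma> \<rho> u y z\<bar>
    \<le> real N * (real N * ((8 * \<gamma> * Mb + 16 * \<rho> * Mb) * r))"
  unfolding sw_drift_pairs sum_subtractf[symmetric]
proof (intro sum_agents_abs_le sum_nbr_abs_le[OF v u])
  fix i j assume i: "i < N" and j: "j \<in> nbr E u i"
  have jU: "j \<in> nbrU h E i" using j nbr_subset_nbrU[OF u] by blast
  have jN: "j < N" using j nbr_subset[OF v u] by blast
  have "\<bar>y' i * (y' i - y' j) - y i * (y i - y j)\<bar>
      = \<bar>(y' i - y i) * (y' i - y' j) + y i * ((y' i - y i) - (y' j - y j))\<bar>"
    by (simp add: algebra_simps)
  also have "\<dots> \<le> r * (2 * Mb) + Mb * (2 * r)"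
    by (rule order_trans[OF abs_triangle_ineq], unfold abs_mult)
      (use yb[OF i] yb[OF jN] yd[OF i] yd[OF jN] pos in \<open>intro add_mono mult_mono; auto\<close>)
  finally have 1: "\<bar>y' i * (y' i - y' j) - y i * (y i - y j)\<bar> \<le> 4 * Mb * r" by (simp add: mult_ac)
  have "\<bar>(z' i j - y' j)\<^sup>2 - (z i j - y j)\<^sup>2\<bar>
      = \<bar>(z' i j - z i j) - (y' j - y j)\<bar> * \<bar>(z' i j - y' j) + (z i j - y j)\<bar>"
    unfolding abs_mult[symmetric] by (simp add: power2_eq_square algebra_simps)
  also have "\<dots> \<le> (2 * r) * (4 * Mb)"
    using zb(1)[OF i jU] zb(2)[OF i jU] yb[OF jN] yd[OF jN] zd[OF i jU] pos by (intro mult_mono) auto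
  finally have 2: "\<bar>(z' i j - y' j)\<^sup>2 - (z i j - y j)\<^sup>2\<bar> \<le> 8 * Mb * r" by (simp add: mult_ac)
  have "\<bar>2 * \<gamma> * (y' i * (y' i - y' j)) + 2 * \<rho> * (z' i j - y' j)\<^sup>2
     - (2 * \<gamma> * (y i * (y i - y j)) + 2 * \<rho> * (z i j - y j)\<^sup>2)\<bar>
     = \<bar>2 * \<gamma> * (y' i * (y' i - y' j) - y i * (y i - y j)) + 2 * \<rho> * ((z' i j - y' j)\<^sup>2 - (z i j - y j)\<^sup>2)\<bar>"
    by (simp add: algebra_simps)
  also have "\<dots> \<le> 2 * \<gamma> * (4 * Mb * r) + 2 * \<rho> * (8 * Mb * r)"
    using 1 2 pos by (intro abs_conic_le) auto
  finally show "\<bar>2 * \<gamma> * (y' i * (y' i - y' j)) + 2 * \<rho> * (z' i j - y' j)\<^sup>2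
     - (2 * \<gamma> * (y i * (y i - y j)) + 2 * \<rho> * (z i j - y j)\<^sup>2)\<bar> \<le> (8 * \<gamma> * Mb + 16 * \<rho> * Mb) * r"
    by (simp add: algebra_simps)
qed (use pos in auto)

lemma lyap_abs_le:
  assumes N: "0 < N" and v: "valid_graphs N h E" and pos: "w \<ge> 0" "Mb \<ge> 0"
    and yb: "\<And>i. i < N \<Longrightarrow> \<bar>y i\<bar> \<le> Mb"
    and zb: "\<And>i j. i < N \<Longrightarrow> j \<in> nbrU h E i \<Longrightarrow> \<bar>z i j\<bar> \<le> Mb"
  shows "\<bar>lyap N h E w y z\<bar> \<le> real N * (2 * Mb)\<^sup>2 + w * (real N * (real N * (2 * Mb)\<^sup>2))"
proof -
  have "\<bar>disagreement N y\<bar> \<le> real N * (2 * Mb)\<^sup>2"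
    unfolding disagreement_def
  proof (rule sum_agents_abs_le)
    fix i assume i: "i < N"
    have "\<bar>y i - avg N y\<bar>\<^sup>2 \<le> (2 * Mb)\<^sup>2"
      using yb[OF i] avg_bound[OF N yb] by (intro power_mono) fastforce+
    then show "\<bar>(y i - avg N y)\<^sup>2\<bar> \<le> (2 * Mb)\<^sup>2" by simp
  qed
  moreover have "\<bar>est_error N h E y z\<bar> \<le> real N * (real N * (2 * Mb)\<^sup>2)"
    unfolding est_error_def
  proof (intro sum_agents_abs_le sum_nbrU_abs_le[OF v])
    fix i j assume i: "i < N" and j: "j \<in> nbrU h E i"
    have "j < N" using j nbrU_subset[OF v] by blast
    then have "\<bar>z i j - y j\<bar>\<^sup>2 \<le> (2 * Mb)\<^sup>2"
      using yb[of j] zb[OF i j] by (intro power_mono) auto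
    then show "\<bar>(z i j - y j)\<^sup>2\<bar> \<le> (2 * Mb)\<^sup>2" by simp
  qed simp
  ultimately show ?thesis unfolding lyap_def using pos
    by (intro order_trans[OF abs_triangle_ineq] add_mono) (auto simp: abs_mult intro!: mult_left_mono)
qed

text \<open>The averaged Laplacian has the gap \<open>lambda2\<close> on deviations from the
  average. Every pair of the union graph is active in at least one graph, whose stationary weight is
  at least the minimum.\<close>

lemma stationary_drift_ge:
  assumes N: "N \<ge> 2" and v: "valid_graphs N h E" and c: "union_connected N h E"
    and pos: "\<And>u. u < h \<Longrightarrow> \<pi> u > 0" and par: "\<gamma> \<ge> 0" "\<rho> \<ge> 0"
  shows "2 * \<gamma> * lambda2 N h E \<pi> * disagreement N y + 2 * \<rho> * Min (\<pi> ` {..<h}) * est_error N h E y z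
    \<le> (\<Sum>u<h. \<pi> u * sw_drift N E \<gamma> \<rho> u y z)"
proof -
  have N0: "0 < N" using N by simp
  define \<delta> where "\<delta> = (\<lambda>i. y i - avg N y)"
  have 1: "lambda2 N h E \<pi> * disagreement N y
     \<le> (\<Sum>u<h. \<pi> u * (\<Sum>i<N. y i * (\<Sum>j\<in>nbr E u i. y i - y j)))"
  proof -
    have "(\<Sum>i<N. \<delta> i) = 0" using sum_avg_diff[OF N0] by (simp add: \<delta>_def)
    then have "lambda2 N h E \<pi> * (\<Sum>i<N. (\<delta> i)\<^sup>2)
      \<le> (\<Sum>u<h. \<pi> u * (\<Sum>i<N. \<delta> i * (\<Sum>j\<in>nbr E u i. \<delta> i - \<delta> j)))"
      using lambda2_properties(2)[OF N v c, of \<pi> \<delta>] pos by blast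
    moreover have "(\<Sum>i<N. \<delta> i * (\<Sum>j\<in>nbr E u i. \<delta> i - \<delta> j)) = (\<Sum>i<N. y i * (\<Sum>j\<in>nbr E u i. y i - y j))"
      if "u < h" for u
      using laplacian_quadratic[OF v that, of \<delta>] laplacian_quadratic[OF v that, of y] by (simp add: \<delta>_def)
    ultimately show ?thesis by (simp add: disagreement_def \<delta>_def)
  qed
  have 2: "Min (\<pi> ` {..<h}) * est_error N h E y z \<le> (\<Sum>u<h. \<pi> u * (\<Sum>i<N. \<Sum>j\<in>nbr E u i. (z i j - y j)\<^sup>2))"
  proof -
    have "(\<Sum>u<h. \<pi> u * (\<Sum>i<N. \<Sum>j\<in>nbr E u i. (z i j - y j)\<^sup>2))
       = (\<Sum>u<h. \<Sum>i<N. \<Sum>j\<in>nbrU h E i. (if j \<in> nbr E u i then \<pi> u else 0) * (z i j - y j)\<^sup>2)"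
      unfolding sum_distrib_left
      by (rule sum.cong[OF refl], rule sum.cong[OF refl], subst sum_nbr_nbrU[OF v]) (auto intro!: sum.cong)
    also have "\<dots> = (\<Sum>i<N. \<Sum>u<h. \<Sum>j\<in>nbrU h E i. (if j \<in> nbr E u i then \<pi> u else 0) * (z i j - y j)\<^sup>2)"
      by (rule sum.swap)
    also have "\<dots> = (\<Sum>i<N. \<Sum>j\<in>nbrU h E i. \<Sum>u<h. (if j \<in> nbr E u i then \<pi> u else 0) * (z i j - y j)\<^sup>2)"
      by (intro sum.cong refl sum.swap)
    also have "\<dots> \<ge> (\<Sum>i<N. \<Sum>j\<in>nbrU h E i. Min (\<pi> ` {..<h}) * (z i j - y j)\<^sup>2)"
    proof (intro sum_mono)
      fix i j assume "j \<in> nbrU h E i"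
      then obtain u where u: "u < h" "j \<in> nbr E u i" by (auto simp: nbrU_def nbr_def)
      have "Min (\<pi> ` {..<h}) \<le> (if j \<in> nbr E u i then \<pi> u else 0)" using u by simp
      also have "\<dots> \<le> (\<Sum>u<h. if j \<in> nbr E u i then \<pi> u else 0)"
        using u(1) pos by (intro member_le_sum) (auto intro: less_imp_le)
      finally show "Min (\<pi> ` {..<h}) * (z i j - y j)\<^sup>2 \<le> (\<Sum>u<h. (if j \<in> nbr E u i then \<pi> u else 0) * (z i j - y j)\<^sup>2)"
        unfolding sum_distrib_right[symmetric] by (intro mult_right_mono) auto
    qed
    finally show ?thesis unfolding est_error_def sum_distrib_left .
  qed
  have "(\<Sum>u<h. \<pi> u * sw_drift N E \<gamma> \<rho> u y z)
     = 2 * \<gamma> * (\<Sum>u<h. \<pi> u * (\<Sum>i<N. y i * (\<Sum>j\<in>nbr E u i. y i - y j)))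
      + 2 * \<rho> * (\<Sum>u<h. \<pi> u * (\<Sum>i<N. \<Sum>j\<in>nbr E u i. (z i j - y j)\<^sup>2))"
    unfolding sw_drift_def distrib_left sum.distrib
    by (intro arg_cong2[where f="(+)"]; subst sum_distrib_left; intro sum.cong refl; simp only: mult_ac)
  moreover have "2 * \<gamma> * (lambda2 N h E \<pi> * disagreement N y) \<le> 2 * \<gamma> * (\<Sum>u<h. \<pi> u * (\<Sum>i<N. y i * (\<Sum>j\<in>nbr E u i. y i - y j)))"
    using 1 par by (intro mult_left_mono) auto
  moreover have "2 * \<rho> * (Min (\<pi> ` {..<h}) * est_error N h E y z) \<le> 2 * \<rho> * (\<Sum>u<h. \<pi> u * (\<Sum>i<N. \<Sum>j\<in>nbr E u i. (z i j - y j)\<^sup>2))"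
    using 2 par by (intro mult_left_mono) auto
  ultimately show ?thesis by (simp only: mult.assoc)
qed

section \<open>Expectations along the chain and the noise\<close>

lemma projM_id: "\<bar>x\<bar> \<le> B \<Longrightarrow> projM B x = x"
  by (auto simp: projM_def)

text \<open>The constant second component of \<open>(D, 0)\<close> is there because \<open>indep_var\<close> requires both random
  variables to have values in the same type.\<close>

lemma (in prob_space) threshold_mean_zero:
  fixes X H D :: "'a \<Rightarrow> real"
  assumes \<sigma>: "\<sigma> > 0" and B: "B > 0"
    and ind: "indep_var (borel \<Otimes>\<^sub>M borel) (\<lambda>\<omega>. (X \<omega>, H \<omega>)) (borel \<Otimes>\<^sub>M borel) (\<lambda>\<omega>. (D \<omega>, 0))"
    and dist: "distributed M lborel D (\<lambda>y. ennreal (normal_density 0 \<sigma> y))"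
    and bd: "\<And>\<omega>. \<omega> \<in> space M \<Longrightarrow> \<bar>H \<omega>\<bar> \<le> B"
  shows "(\<integral>\<omega>. H \<omega> * (Fcdf \<sigma> (c - X \<omega>) - (if X \<omega> + D \<omega> \<le> c then 1 else 0)) \<partial>M) = 0"
proof -
  let ?b2 = "borel \<Otimes>\<^sub>M borel :: (real \<times> real) measure"
  let ?S = "distr M ?b2 (\<lambda>\<omega>. (X \<omega>, H \<omega>))"
  let ?T = "distr M ?b2 (\<lambda>\<omega>. (D \<omega>, 0 :: real))"
  let ?D = "density lborel (\<lambda>y. ennreal (normal_density 0 \<sigma> y))"
  have rv: "(\<lambda>\<omega>. (X \<omega>, H \<omega>)) \<in> measurable M ?b2" and rvT: "(\<lambda>\<omega>. (D \<omega>, 0)) \<in> measurable M ?b2"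
    and joint: "?S \<Otimes>\<^sub>M ?T = distr M (?b2 \<Otimes>\<^sub>M ?b2) (\<lambda>\<omega>. ((X \<omega>, H \<omega>), (D \<omega>, 0)))"
    using ind unfolding indep_var_distribution_eq by auto
  have rvD: "D \<in> borel_measurable M" using distributed_measurable[OF dist] by simp
  have T: "distr M borel D = ?D"
    using distributed_distr_eq_density[OF dist] by (simp cong: distr_cong)
  interpret S: prob_space ?S by (rule prob_space_distr[OF rv])
  interpret T: prob_space ?T by (rule prob_space_distr[OF rvT])
  interpret D: prob_space ?D by (rule prob_space_normal_density[OF \<sigma>])
  interpret ST: pair_prob_space ?S ?T ..
  \<comment> \<open>\<open>H\<close> is bounded only along the sample space. Truncating the second
    coordinate by \<open>projM B\<close> changes nothing there and makes the integrand bounded on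
    the whole product space.\<close>
  define \<psi> where "\<psi> = (\<lambda>(p :: real \<times> real) (d :: real). projM B (snd p) * (Fcdf \<sigma> (c - fst p) - (if fst p + d \<le> c then 1 else 0)))"
  have [measurable]: "Fcdf \<sigma> \<in> borel_measurable borel" by (rule Fcdf_measurable[OF \<sigma>])
  have meas: "(\<lambda>(p, d). \<psi> p (fst d)) \<in> borel_measurable (?b2 \<Otimes>\<^sub>M ?b2)"
    unfolding \<psi>_def projM_def by measurable
  have meas1: "\<psi> p \<in> borel_measurable borel" for p
    unfolding \<psi>_def projM_def by measurable
  have bound: "\<bar>\<psi> p d\<bar> \<le> B * 1" for p d
    unfolding \<psi>_def abs_mult using projM_bound[OF B, of "snd p"] Fcdf_range[OF \<sigma>, of "c - fst p"] B
    by (intro mult_mono) auto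
  have "(\<lambda>(p, d). \<psi> p (fst d)) \<in> borel_measurable (?S \<Otimes>\<^sub>M ?T)"
    using meas by (simp cong: measurable_cong_sets)
  then have int: "integrable (?S \<Otimes>\<^sub>M ?T) (\<lambda>(p, d). \<psi> p (fst d))"
    by (intro ST.P.integrable_const_bound[where B="B * 1"]) (use bound in auto)
  have "(\<integral>\<omega>. H \<omega> * (Fcdf \<sigma> (c - X \<omega>) - (if X \<omega> + D \<omega> \<le> c then 1 else 0)) \<partial>M)
      = (\<integral>\<omega>. (\<lambda>(p, d). \<psi> p (fst d)) ((X \<omega>, H \<omega>), (D \<omega>, 0 :: real)) \<partial>M)"
    by (intro Bochner_Integration.integral_cong refl) (simp add: \<psi>_def projM_id[OF bd])
  also have "\<dots> = (\<integral>q. (\<lambda>(p, d). \<psi> p (fst d)) q \<partial>(?S \<Otimes>\<^sub>M ?T))"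
    unfolding joint using measurable_Pair[OF rv rvT] meas by (rule integral_distr[symmetric])
  also have "\<dots> = (\<integral>p. (\<integral>d. \<psi> p (fst d) \<partial>?T) \<partial>?S)"
    by (rule ST.integral_fst[symmetric, OF int])
  \<comment> \<open>With \<open>X\<close> and \<open>H\<close> frozen, \<open>Fcdf\<close> is
    precisely the probability that the noise is at most \<open>c - X\<close>, so the inner integral
    vanishes.\<close>
  also have "\<dots> = (\<integral>p. 0 \<partial>?S)"
  proof (rule Bochner_Integration.integral_cong[OF refl])
    fix p :: "real \<times> real"
    have "(\<integral>d. \<psi> p (fst d) \<partial>?T) = (\<integral>\<omega>. \<psi> p (D \<omega>) \<partial>M)"
      by (subst integral_distr[OF rvT]) (auto intro!: measurable_compose[OF measurable_fst meas1])
    also have "\<dots> = (\<integral>d. \<psi> p d \<partial>?D)"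
      unfolding T[symmetric] by (rule integral_distr[OF rvD meas1, symmetric])
    also have "\<dots> = (\<integral>d. projM B (snd p) * (Fcdf \<sigma> (c - fst p) - indicator {..c - fst p} d) \<partial>?D)"
      by (intro Bochner_Integration.integral_cong refl) (auto simp: \<psi>_def indicator_def)
    also have "\<dots> = projM B (snd p) * (Fcdf \<sigma> (c - fst p) - measure ?D {..c - fst p})"
    proof -
      have "integrable ?D (indicator {..c - fst p} :: real \<Rightarrow> real)"
        by (rule integrable_real_indicator) (simp_all add: D.emeasure_eq_measure)
      moreover have "(\<integral>d. Fcdf \<sigma> (c - fst p) \<partial>?D) = Fcdf \<sigma> (c - fst p)"
        using D.prob_space by simp
      ultimately show ?thesis
        by (subst integral_mult_right_zero, subst Bochner_Integration.integral_diff) auto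
    qed
    also have "\<dots> = 0" by (simp add: Fcdf_def cdf_def)
    finally show "(\<integral>d. \<psi> p (fst d) \<partial>?T) = 0" .
  qed
  finally show ?thesis by simp
qed

lemma (in prob_space) indep_sigma_integral_mult:
  fixes f g :: "'a \<Rightarrow> real"
  assumes ind: "indep_set (sigma_sets (space M) Ga) (sigma_sets (space M) Gb)"
    and sub: "Ga \<subseteq> Pow (space M)" "Gb \<subseteq> Pow (space M)"
    and f: "f \<in> borel_measurable (sigma (space M) Ga)" and g: "g \<in> borel_measurable (sigma (space M) Gb)"
    and fb: "\<And>\<omega>. \<omega> \<in> space M \<Longrightarrow> \<bar>f \<omega>\<bar> \<le> Bf" and gb: "\<And>\<omega>. \<omega> \<in> space M \<Longrightarrow> \<bar>g \<omega>\<bar> \<le> Bg"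
  shows "(\<integral>\<omega>. f \<omega> * g \<omega> \<partial>M) = (\<integral>\<omega>. f \<omega> \<partial>M) * (\<integral>\<omega>. g \<omega> \<partial>M)"
proof -
  have pre: "{f -` A \<inter> space M | A. A \<in> sets borel} \<subseteq> sigma_sets (space M) G"
    if "G \<subseteq> Pow (space M)" "f \<in> borel_measurable (sigma (space M) G)" for f :: "'a \<Rightarrow> real" and G
    using measurable_sets[OF that(2)] that(1) by auto
  have ev: "sigma_sets (space M) Ga \<subseteq> events" "sigma_sets (space M) Gb \<subseteq> events"
    using ind unfolding indep_sets2_eq by auto
  have rv: "f \<in> borel_measurable M" if "G \<subseteq> Pow (space M)" "f \<in> borel_measurable (sigma (space M) G)"
      "sigma_sets (space M) G \<subseteq> events" for f :: "'a \<Rightarrow> real" and G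
    using that pre[OF that(1,2)] unfolding measurable_def by auto
  have fM: "f \<in> borel_measurable M" and gM: "g \<in> borel_measurable M"
    using rv[OF sub(1) f ev(1)] rv[OF sub(2) g ev(2)] by auto
  have "indep_set (sigma_sets (space M) {f -` A \<inter> space M | A. A \<in> sets borel})
      (sigma_sets (space M) {g -` A \<inter> space M | A. A \<in> sets borel})"
    using ind sigma_sets_mono[OF pre[OF sub(1) f]] sigma_sets_mono[OF pre[OF sub(2) g]]
    unfolding indep_sets2_eq by (meson subset_iff)
  then have "indep_var borel f borel g" unfolding indep_var_eq using fM gM by simp
  moreover have "integrable M f" using fb fM by (intro integrable_const_bound[of _ Bf]) auto
  moreover have "integrable M g" using gb gM by (intro integrable_const_bound[of _ Bg]) auto
  ultimately show ?thesis by (intro indep_var_lebesgue_integral)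
qed

text \<open>Paths are continued by \<open>0\<close> after time \<open>t\<close>, so that every history up to \<open>t\<close> has exactly one
  representative.\<close>

definition paths :: "nat \<Rightarrow> nat \<Rightarrow> (nat \<Rightarrow> nat) set" where
  "paths h t = {s. (\<forall>k\<le>t. s k < h) \<and> (\<forall>k>t. s k = 0)}"

lemma finite_paths: "finite (paths h t)"
proof -
  have "paths h t \<subseteq> (\<lambda>f k. if k \<le> t then f k else 0) ` (PiE {..t} (\<lambda>_. {..<h}))"
  proof
    fix s assume s: "s \<in> paths h t"
    then have "s = (\<lambda>k. if k \<le> t then restrict s {..t} k else 0)" by (auto simp: paths_def)
    moreover have "restrict s {..t} \<in> PiE {..t} (\<lambda>_. {..<h})" using s by (auto simp: paths_def)
    ultimately show "s \<in> (\<lambda>f k. if k \<le> t then f k else 0) ` (PiE {..t} (\<lambda>_. {..<h}))" by blast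
  qed
  then show ?thesis by (rule finite_subset) (auto intro!: finite_imageI finite_PiE)
qed

text \<open>The noise enters only through a generating family \<open>Gn\<close> of events that is
  independent of the chain.\<close>

locale markov_noise = prob_space M for M :: "'w measure" +
  fixes h :: nat and P :: "real mat" and m :: "nat \<Rightarrow> 'w \<Rightarrow> nat" and Gn :: "'w set set"
  assumes markov: "markov_chain M h P m"
    and noise: "Gn \<subseteq> Pow (space M)"
    and indep: "indep_set
           (sigma_sets (space M) (\<Union>t. {m t -` A \<inter> space M | A. A \<in> sets (count_space UNIV)}))
           (sigma_sets (space M) Gn)"
begin

definition "Gm = (\<Union>t. {m t -` A \<inter> space M | A. A \<in> sets (count_space UNIV)})"

abbreviation "chain_alg \<equiv> sigma (space M) Gm"

abbreviation "noise_alg \<equiv> sigma (space M) Gn"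

definition "cyl t s = {\<omega>\<in>space M. \<forall>k\<le>t. m k \<omega> = s k}"

lemma Gm_Pow: "Gm \<subseteq> Pow (space M)" by (auto simp: Gm_def)

lemma m_less: "\<omega> \<in> space M \<Longrightarrow> m t \<omega> < h"
  using markov by (simp add: markov_chain_def)

lemma h_pos: "0 < h"
  using m_less not_empty by fastforce

lemma m_chain_alg [measurable]: "m t \<in> measurable chain_alg (count_space UNIV)"
proof (rule measurableI)
  fix A assume "A \<in> sets (count_space (UNIV :: nat set))"
  then have "m t -` A \<inter> space M \<in> Gm" unfolding Gm_def by blast
  then show "m t -` A \<inter> space chain_alg \<in> sets chain_alg" using Gm_Pow by auto
qed simp

lemma sets_chain_alg: "sets chain_alg \<subseteq> events"
  using indep_setD_ev1[OF indep] unfolding Gm_def[symmetric] sets_measure_of[OF Gm_Pow] .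

lemma sets_noise_alg: "sets noise_alg \<subseteq> events"
  using indep_setD_ev2[OF indep] unfolding sets_measure_of[OF noise] .

lemma chain_alg_measurable: "f \<in> measurable chain_alg K \<Longrightarrow> f \<in> measurable M K"
  using sets_chain_alg Gm_Pow unfolding measurable_def by auto

lemma noise_alg_measurable: "f \<in> measurable noise_alg K \<Longrightarrow> f \<in> measurable M K"
  using sets_noise_alg noise unfolding measurable_def by auto

lemma cyl_chain_alg: "cyl t s \<in> sets chain_alg"
proof -
  have "cyl t s = {\<omega>\<in>space chain_alg. \<forall>k\<in>{..t}. m k \<omega> = s k}" using Gm_Pow by (auto simp: cyl_def)
  also have "\<dots> \<in> sets chain_alg" by measurable
  finally show ?thesis .
qed

text \<open>Exactly one history agrees with the sample point. The chain then appears only in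
  indicators while \<Psi> is evaluated at frozen histories; this takes the place of conditioning on
  the chain.\<close>

lemma path_split:
  assumes \<omega>: "\<omega> \<in> space M"
    and cong: "\<And>s. s \<in> paths h t \<Longrightarrow> \<omega> \<in> cyl t s \<Longrightarrow> \<Psi> (\<lambda>k. m k \<omega>) = (\<Psi> s :: real)"
  shows "\<Psi> (\<lambda>k. m k \<omega>) = (\<Sum>s\<in>paths h t. indicator (cyl t s) \<omega> * \<Psi> s)"
proof -
  define s0 where "s0 = (\<lambda>k. if k \<le> t then m k \<omega> else 0)"
  have s0: "s0 \<in> paths h t" using m_less[OF \<omega>] by (auto simp: paths_def s0_def)
  have in0: "\<omega> \<in> cyl t s0" using \<omega> by (auto simp: cyl_def s0_def)
  have uniq: "s = s0" if "s \<in> paths h t" "\<omega> \<in> cyl t s" for s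
    using that by (auto simp: paths_def cyl_def s0_def)
  have "(\<Sum>s\<in>paths h t. indicator (cyl t s) \<omega> * \<Psi> s) = (\<Sum>s\<in>paths h t. if s = s0 then \<Psi> s0 else 0)"
  proof (rule sum.cong[OF refl])
    fix s assume "s \<in> paths h t"
    then show "indicator (cyl t s) \<omega> * \<Psi> s = (if s = s0 then \<Psi> s0 else 0)"
      using in0 uniq[of s] by (cases "\<omega> \<in> cyl t s") (simp, metis indicator_simps(2) mult_zero_left)
  qed
  also have "\<dots> = \<Psi> (\<lambda>k. m k \<omega>)" using s0 cong[OF s0 in0] finite_paths by simp
  finally show ?thesis by simp
qed

context
  fixes \<Psi> :: "(nat \<Rightarrow> nat) \<Rightarrow> 'w \<Rightarrow> real" and t :: nat and B :: real
  assumes cong: "\<And>\<omega> s. \<omega> \<in> space M \<Longrightarrow> s \<in> paths h t \<Longrightarrow> \<omega> \<in> cyl t s \<Longrightarrow> \<Psi> (\<lambda>k. m k \<omega>) \<omega> = \<Psi> s \<omega>"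
    and meas: "\<And>s. s \<in> paths h t \<Longrightarrow> \<Psi> s \<in> borel_measurable noise_alg"
    and bound: "\<And>s \<omega>. s \<in> paths h t \<Longrightarrow> \<omega> \<in> space M \<Longrightarrow> \<bar>\<Psi> s \<omega>\<bar> \<le> B"
begin

lemma path_sum:
  "\<omega> \<in> space M \<Longrightarrow> \<Psi> (\<lambda>k. m k \<omega>) \<omega> = (\<Sum>s\<in>paths h t. indicator (cyl t s) \<omega> * \<Psi> s \<omega>)"
  by (rule path_split[where \<Psi>="\<lambda>s. \<Psi> s \<omega>"]) (auto intro: cong)

lemma path_measurable: "(\<lambda>\<omega>. \<Psi> (\<lambda>k. m k \<omega>) \<omega>) \<in> borel_measurable M"
proof -
  have "(\<lambda>\<omega>. \<Sum>s\<in>paths h t. indicator (cyl t s) \<omega> * \<Psi> s \<omega>) \<in> borel_measurable M"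
    using noise_alg_measurable[OF meas] cyl_chain_alg sets_chain_alg
    by (intro borel_measurable_sum borel_measurable_times borel_measurable_indicator) auto
  then show ?thesis
    by (rule measurable_cong[THEN iffD2, rotated]) (rule path_sum)
qed

lemma path_integral:
  assumes f: "f \<in> borel_measurable chain_alg" and fb: "\<And>\<omega>. \<omega> \<in> space M \<Longrightarrow> \<bar>f \<omega>\<bar> \<le> (Bf::real)"
  shows "(\<integral>\<omega>. f \<omega> * \<Psi> (\<lambda>k. m k \<omega>) \<omega> \<partial>M)
    = (\<Sum>s\<in>paths h t. (\<integral>\<omega>. f \<omega> * indicator (cyl t s) \<omega> \<partial>M) * (\<integral>\<omega>. \<Psi> s \<omega> \<partial>M))"
proof -
  have Bf: "0 \<le> Bf" using not_empty fb by fastforce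
  have "(\<integral>\<omega>. f \<omega> * \<Psi> (\<lambda>k. m k \<omega>) \<omega> \<partial>M)
     = (\<integral>\<omega>. (\<Sum>s\<in>paths h t. (f \<omega> * indicator (cyl t s) \<omega>) * \<Psi> s \<omega>) \<partial>M)"
    by (intro Bochner_Integration.integral_cong refl) (simp add: path_sum sum_distrib_left mult.assoc)
  also have "\<dots> = (\<Sum>s\<in>paths h t. \<integral>\<omega>. (f \<omega> * indicator (cyl t s) \<omega>) * \<Psi> s \<omega> \<partial>M)"
  proof (rule Bochner_Integration.integral_sum)
    fix s assume s: "s \<in> paths h t"
    have "\<bar>f \<omega> * indicator (cyl t s) \<omega> * \<Psi> s \<omega>\<bar> \<le> Bf * 1 * B" if "\<omega> \<in> space M" for \<omega>
      unfolding abs_mult using fb[OF that] bound[OF s that] Bf by (intro mult_mono) (auto simp: indicator_def)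
    then show "integrable M (\<lambda>\<omega>. f \<omega> * indicator (cyl t s) \<omega> * \<Psi> s \<omega>)"
      using chain_alg_measurable[OF f] noise_alg_measurable[OF meas[OF s]] subsetD[OF sets_chain_alg cyl_chain_alg]
      by (intro integrable_const_bound[where B="Bf * 1 * B"]) auto
  qed
  also have "\<dots> = (\<Sum>s\<in>paths h t. (\<integral>\<omega>. f \<omega> * indicator (cyl t s) \<omega> \<partial>M) * (\<integral>\<omega>. \<Psi> s \<omega> \<partial>M))"
  proof (rule sum.cong[OF refl])
    fix s assume s: "s \<in> paths h t"
    have "(\<lambda>\<omega>. f \<omega> * indicator (cyl t s) \<omega>) \<in> borel_measurable chain_alg"
      using f cyl_chain_alg by (intro borel_measurable_times borel_measurable_indicator) auto
    moreover have "\<bar>f \<omega> * indicator (cyl t s) \<omega>\<bar> \<le> Bf" if "\<omega> \<in> space M" for \<omega>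
      using fb[OF that] Bf by (auto simp: indicator_def)
    ultimately show "(\<integral>\<omega>. (f \<omega> * indicator (cyl t s) \<omega>) * \<Psi> s \<omega> \<partial>M)
        = (\<integral>\<omega>. f \<omega> * indicator (cyl t s) \<omega> \<partial>M) * (\<integral>\<omega>. \<Psi> s \<omega> \<partial>M)"
      by (intro indep_sigma_integral_mult[OF indep[folded Gm_def] Gm_Pow noise, where Bf=Bf and Bg=B] meas[OF s] bound[OF s])
  qed
  finally show ?thesis .
qed

lemma path_integral_zero:
  assumes "\<And>s. s \<in> paths h t \<Longrightarrow> (\<integral>\<omega>. \<Psi> s \<omega> \<partial>M) = 0"
  shows "(\<integral>\<omega>. \<Psi> (\<lambda>k. m k \<omega>) \<omega> \<partial>M) = 0"
  using path_integral[of "\<lambda>_. 1" 1] assms by simp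

end

lemma markov_transition:
  assumes s: "s \<in> paths h t"
  shows "(\<integral>\<omega>. G (m (Suc t) \<omega>) * indicator (cyl t s) \<omega> \<partial>M)
    = (\<integral>\<omega>. (\<Sum>v<h. P $$ (m t \<omega>, v) * G v) * indicator (cyl t s) \<omega> \<partial>M)"
proof -
  \<comment> \<open>\<open>markov_chain\<close> asks for values below \<open>h\<close> at all times,
    also after the horizon; the continuation by 0 qualifies because \<open>h\<close> is
    positive.\<close>
  have sv: "(s(Suc t := v)) k < h" if "v < h" for v k
    using s h_pos that by (cases "k \<le> t") (auto simp: paths_def)
  have cyl_ev: "cyl t s \<in> events" for t s using cyl_chain_alg sets_chain_alg by auto
  have "(\<integral>\<omega>. G (m (Suc t) \<omega>) * indicator (cyl t s) \<omega> \<partial>M)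
      = (\<integral>\<omega>. (\<Sum>v<h. G v * indicator (cyl (Suc t) (s(Suc t := v))) \<omega>) \<partial>M)"
  proof (intro Bochner_Integration.integral_cong refl)
    fix \<omega> assume \<omega>: "\<omega> \<in> space M"
    have "indicator (cyl (Suc t) (s(Suc t := v))) \<omega> = (if v = m (Suc t) \<omega> then indicator (cyl t s) \<omega> else 0 :: real)" for v
      by (auto simp: indicator_def cyl_def le_Suc_eq)
    then have "(\<Sum>v<h. G v * indicator (cyl (Suc t) (s(Suc t := v))) \<omega>)
      = (\<Sum>v<h. if v = m (Suc t) \<omega> then G v * indicator (cyl t s) \<omega> else 0)"
      by (intro sum.cong) auto
    then show "G (m (Suc t) \<omega>) * indicator (cyl t s) \<omega> = (\<Sum>v<h. G v * indicator (cyl (Suc t) (s(Suc t := v))) \<omega>)"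
      using m_less[OF \<omega>] by simp
  qed
  also have "\<dots> = (\<Sum>v<h. G v * measure M (cyl (Suc t) (s(Suc t := v))))"
    using cyl_ev by (subst Bochner_Integration.integral_sum) (auto intro!: integrable_mult_right integrable_real_indicator simp: emeasure_eq_measure)
  also have "\<dots> = (\<Sum>v<h. G v * (measure M (cyl t s) * P $$ (s t, v)))"
  proof (intro sum.cong refl)
    fix v assume v: "v \<in> {..<h}"
    have "measure M {\<omega>\<in>space M. \<forall>k\<le>Suc t. m k \<omega> = (s(Suc t := v)) k}
        = measure M {\<omega>\<in>space M. \<forall>k\<le>t. m k \<omega> = (s(Suc t := v)) k} * P $$ ((s(Suc t := v)) t, (s(Suc t := v)) (Suc t))"
      using markov sv v unfolding markov_chain_def by blast
    moreover have "{\<omega>\<in>space M. \<forall>k\<le>t. m k \<omega> = (s(Suc t := v)) k} = cyl t s" by (auto simp: cyl_def)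
    ultimately show "G v * measure M (cyl (Suc t) (s(Suc t := v))) = G v * (measure M (cyl t s) * P $$ (s t, v))"
      by (simp add: cyl_def)
  qed
  also have "\<dots> = (\<Sum>v<h. P $$ (s t, v) * G v) * measure M (cyl t s)"
    unfolding sum_distrib_right by (intro sum.cong refl) (simp add: mult_ac)
  also have "\<dots> = (\<integral>\<omega>. (\<Sum>v<h. P $$ (s t, v) * G v) * indicator (cyl t s) \<omega> \<partial>M)"
    using cyl_ev by simp
  also have "\<dots> = (\<integral>\<omega>. (\<Sum>v<h. P $$ (m t \<omega>, v) * G v) * indicator (cyl t s) \<omega> \<partial>M)"
    by (intro Bochner_Integration.integral_cong refl) (auto simp: indicator_def cyl_def)
  finally show ?thesis .
qed

lemma finite_values_bounded: "\<exists>B. \<forall>u<(h::nat). \<bar>G u :: real\<bar> \<le> B"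
  by (intro exI[of _ "\<Sum>u<h. \<bar>G u\<bar>"]) (auto intro!: member_le_sum)

text \<open>The Markov property with a passenger: \<Psi> may depend on the noise as well as on the
  chain up to \<open>t\<close>, and the next chain value is still averaged by \<open>P\<close>
  alone.\<close>

lemma markov_mean:
  assumes cong: "\<And>\<omega> s. \<omega> \<in> space M \<Longrightarrow> s \<in> paths h t \<Longrightarrow> \<omega> \<in> cyl t s \<Longrightarrow> \<Psi> (\<lambda>k. m k \<omega>) \<omega> = \<Psi> s \<omega>"
    and meas: "\<And>s. s \<in> paths h t \<Longrightarrow> \<Psi> s \<in> borel_measurable noise_alg"
    and bound: "\<And>s \<omega>. s \<in> paths h t \<Longrightarrow> \<omega> \<in> space M \<Longrightarrow> \<bar>\<Psi> s \<omega> :: real\<bar> \<le> B"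
  shows "(\<integral>\<omega>. G (m (Suc t) \<omega>) * \<Psi> (\<lambda>k. m k \<omega>) \<omega> \<partial>M)
    = (\<integral>\<omega>. (\<Sum>v<h. P $$ (m t \<omega>, v) * G v) * \<Psi> (\<lambda>k. m k \<omega>) \<omega> \<partial>M)"
proof -
  have mf: "(\<lambda>\<omega>. F (m k \<omega>)) \<in> borel_measurable chain_alg" for F :: "nat \<Rightarrow> real" and k by measurable
  obtain B1 where B1: "\<And>u. u < h \<Longrightarrow> \<bar>G u\<bar> \<le> B1" using finite_values_bounded by blast
  obtain B2 where B2: "\<And>u. u < h \<Longrightarrow> \<bar>\<Sum>v<h. P $$ (u, v) * G v\<bar> \<le> B2"
    using finite_values_bounded[of "\<lambda>u. \<Sum>v<h. P $$ (u, v) * G v"] by blast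
  have "(\<integral>\<omega>. G (m (Suc t) \<omega>) * \<Psi> (\<lambda>k. m k \<omega>) \<omega> \<partial>M)
    = (\<Sum>s\<in>paths h t. (\<integral>\<omega>. G (m (Suc t) \<omega>) * indicator (cyl t s) \<omega> \<partial>M) * (\<integral>\<omega>. \<Psi> s \<omega> \<partial>M))"
    by (rule path_integral[OF cong meas bound mf, where Bf=B1]) (use B1 m_less in auto)
  moreover have "(\<integral>\<omega>. (\<Sum>v<h. P $$ (m t \<omega>, v) * G v) * \<Psi> (\<lambda>k. m k \<omega>) \<omega> \<partial>M)
    = (\<Sum>s\<in>paths h t. (\<integral>\<omega>. (\<Sum>v<h. P $$ (m t \<omega>, v) * G v) * indicator (cyl t s) \<omega> \<partial>M) * (\<integral>\<omega>. \<Psi> s \<omega> \<partial>M))"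
    by (rule path_integral[OF cong meas bound mf, where Bf=B2]) (use B2 m_less in auto)
  ultimately show ?thesis by (simp add: markov_transition)
qed

end

section \<open>The closed-loop system\<close>

text \<open>Along the switching path \<open>ms\<close> and the noise realisation \<open>D\<close>, \<open>Y ms D k\<close> and \<open>Z ms D k\<close> are the
  outputs \<open>K\<^sub>2 x\<close> at time \<open>t0 + 1 + k\<close> and the estimates at time \<open>t0 + k\<close>. The estimation error
  used in the Lyapunov function therefore compares estimates at time \<open>t\<close> with outputs at time
  \<open>t + 1\<close>; both then depend on the chain up to time \<open>t\<close> only.\<close>

locale binary_consensus =
  markov_noise M h P m "\<Union>((i, j), t)\<in>pairs N h E \<times> UNIV. {d i j t -` A \<inter> space M | A. A \<in> sets borel}"
  for M :: "'w measure" and h :: nat and P :: "real mat" and m :: "nat \<Rightarrow> 'w \<Rightarrow> nat"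
    and N :: nat and E :: "nat \<Rightarrow> nat set set" and d :: "nat \<Rightarrow> nat \<Rightarrow> nat \<Rightarrow> 'w \<Rightarrow> real" +
  fixes \<pi> :: "nat \<Rightarrow> real" and c :: "nat \<Rightarrow> nat \<Rightarrow> real" and \<sigma> \<beta> \<gamma> Mb :: real and t0 :: nat
    and y0 :: "nat \<Rightarrow> real" and z0 :: "nat \<Rightarrow> nat \<Rightarrow> real"
    and Y :: "(nat \<Rightarrow> nat) \<Rightarrow> (nat \<Rightarrow> nat \<Rightarrow> nat \<Rightarrow> real) \<Rightarrow> nat \<Rightarrow> nat \<Rightarrow> real"
    and Z :: "(nat \<Rightarrow> nat) \<Rightarrow> (nat \<Rightarrow> nat \<Rightarrow> nat \<Rightarrow> real) \<Rightarrow> nat \<Rightarrow> nat \<Rightarrow> nat \<Rightarrow> real"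
  assumes N2: "N \<ge> 2" and valid: "valid_graphs N h E" and connected: "union_connected N h E"
    and stoch: "stochastic_mat h P" and irr: "irreducible_mat h P" and stat: "stationary_dist h P \<pi>"
    and \<sigma>: "\<sigma> > 0"
    and dist: "\<And>i j t. (i, j) \<in> pairs N h E \<Longrightarrow>
           distributed M lborel (d i j t) (\<lambda>y. ennreal (normal_density 0 \<sigma> y))"
    and indep_noise: "indep_vars (\<lambda>_. borel) (\<lambda>((i, j), t). d i j t) (pairs N h E \<times> UNIV)"
    and \<beta>: "\<beta> > 0" and \<gamma>: "\<gamma> > 0" and t0: "real t0 > \<gamma> * real (dmax N h E) - 1" and Mb: "Mb > 0"
    and y0: "\<And>i. i < N \<Longrightarrow> \<bar>y0 i\<bar> \<le> Mb" and z0: "\<And>i j. (i, j) \<in> pairs N h E \<Longrightarrow> \<bar>z0 i j\<bar> \<le> Mb"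
    and Y_0: "\<And>ms D i. i < N \<Longrightarrow> Y ms D 0 i = y0 i" and Z_0: "\<And>ms D i j. Z ms D 0 i j = z0 i j"
    and Z_Suc: "\<And>ms D k i j. Z ms D (Suc k) i j = projM Mb (Z ms D k i j
       + \<beta> / real (t0 + 1 + k) * (if j \<in> nbr E (ms (t0 + 1 + k)) i then 1 else 0)
         * (Fcdf \<sigma> (c i j - Z ms D k i j) - (if Y ms D k j + D i j (t0 + 1 + k) \<le> c i j then 1 else 0)))"
    and Y_Suc: "\<And>ms D k i. i < N \<Longrightarrow> Y ms D (Suc k) i = Y ms D k i
       + \<gamma> / (real (t0 + 1 + k) + 1) * (\<Sum>j\<in>nbr E (ms (t0 + 1 + k)) i. Z ms D (Suc k) i j - Y ms D k i)"
begin

section \<open>Boundedness and causality of the state\<close>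

definition "\<tau> k = real (t0 + 1 + k)"

definition "sbit ms D k i j = (if Y ms D k j + D i j (t0 + 1 + k) \<le> c i j then 1 else 0 :: real)"

lemma \<tau>_pos: "\<tau> k > 0" "\<tau> k \<ge> 1" "\<tau> (Suc k) = \<tau> k + 1"
  by (auto simp: \<tau>_def)

lemma pairs_iff: "(i, j) \<in> pairs N h E \<longleftrightarrow> i < N \<and> j \<in> nbrU h E i"
  by (auto simp: pairs_def)

lemma nbrU_less: "j \<in> nbrU h E i \<Longrightarrow> j < N"
  using nbrU_subset[OF valid] by blast

lemma degree_bound:
  assumes u: "u < h"
  shows "\<gamma> * real (card (nbr E u i)) \<le> \<tau> k + 1"
proof (cases "i < N")
  case True
  have "card (nbr E u i) \<le> card (nbrU h E i)"
    using nbr_subset_nbrU[OF u] nbrU_subset[OF valid] by (intro card_mono)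
  also have "\<dots> \<le> dmax N h E" unfolding dmax_def using True by (intro Max_ge) auto
  finally have "\<gamma> * real (card (nbr E u i)) \<le> \<gamma> * real (dmax N h E)" using \<gamma> by simp
  then show ?thesis using t0 by (simp add: \<tau>_def)
next
  case False
  then have "nbr E u i = {}" using valid_graphs_edge(1)[OF valid u] by (auto simp: nbr_def)
  then show ?thesis using \<tau>_pos(1)[of k] by simp
qed

definition "good_path ms = (\<forall>t. ms t < h)"

lemma good_path_paths: "s \<in> paths h t \<Longrightarrow> good_path s"
  using h_pos unfolding paths_def good_path_def by (metis (mono_tags, lifting) mem_Collect_eq not_le)

lemma good_path_chain: "\<omega> \<in> space M \<Longrightarrow> good_path (\<lambda>t. m t \<omega>)"
  using m_less by (simp add: good_path_def)

text \<open>The one-step locale needs the bounds at index \<open>k\<close> and yields those at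
  \<open>k + 1\<close>. Stating it with the bounds as hypotheses breaks the circle; the induction
  follows in \<open>state_bounds\<close>.\<close>

lemma step_if_bounded:
  assumes "good_path ms" "\<And>i. i < N \<Longrightarrow> \<bar>Y ms D k i\<bar> \<le> Mb"
    "\<And>i j. i < N \<Longrightarrow> j \<in> nbrU h E i \<Longrightarrow> \<bar>Z ms D k i j\<bar> \<le> Mb"
  shows "consensus_step N h E \<beta> \<gamma> Mb (\<tau> k) (ms (t0 + 1 + k)) (Y ms D k) (Y ms D (Suc k)) (Z ms D k) (Z ms D (Suc k))
    (\<lambda>i j. Fcdf \<sigma> (c i j - Z ms D k i j) - sbit ms D k i j)"
proof unfold_locales
  show "\<bar>Fcdf \<sigma> (c i j - Z ms D k i j) - sbit ms D k i j\<bar> \<le> 1" for i j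
    using Fcdf_range[OF \<sigma>, of "c i j - Z ms D k i j"] by (auto simp: sbit_def)
qed (use assms N2 valid \<beta> \<gamma> Mb \<tau>_pos degree_bound Z_Suc Y_Suc in \<open>auto simp: \<tau>_def sbit_def good_path_def\<close>)

lemma state_bounds:
  assumes "good_path ms"
  shows "i < N \<Longrightarrow> \<bar>Y ms D k i\<bar> \<le> Mb" "i < N \<Longrightarrow> j \<in> nbrU h E i \<Longrightarrow> \<bar>Z ms D k i j\<bar> \<le> Mb"
proof (induction k arbitrary: i j)
  case 0
  { case 1 then show ?case using Y_0 y0 by simp }
  { case 2 then show ?case using Z_0 z0 by (simp add: pairs_iff) }
next
  case (Suc k)
  interpret consensus_step N h E \<beta> \<gamma> Mb "\<tau> k" "ms (t0 + 1 + k)" "Y ms D k" "Y ms D (Suc k)" "Z ms D k" "Z ms D (Suc k)"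
    "\<lambda>i j. Fcdf \<sigma> (c i j - Z ms D k i j) - sbit ms D k i j"
    by (rule step_if_bounded[OF assms Suc.IH])
  { case 1 then show ?case by (rule y'_bound) }
  { case 2 then show ?case by (rule z'_bound) }
qed

lemma step:
  assumes "good_path ms"
  shows "consensus_step N h E \<beta> \<gamma> Mb (\<tau> k) (ms (t0 + 1 + k)) (Y ms D k) (Y ms D (Suc k)) (Z ms D k) (Z ms D (Suc k))
    (\<lambda>i j. Fcdf \<sigma> (c i j - Z ms D k i j) - sbit ms D k i j)"
  by (rule step_if_bounded[OF assms state_bounds[OF assms]])

text \<open>Causality with the off-by-one that matters: \<open>Y\<close> at index \<open>k\<close>
  is the output at time \<open>t0 + 1 + k\<close>, yet it uses graphs and noise only up to time
  \<open>t0 + k\<close>.\<close>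

lemma state_cong:
  assumes "good_path ms" "good_path ms'" "\<And>t. t \<le> t0 + k \<Longrightarrow> ms t = ms' t"
    "\<And>i j t. (i, j) \<in> pairs N h E \<Longrightarrow> t \<le> t0 + k \<Longrightarrow> D i j t = D' i j t"
  shows "i < N \<Longrightarrow> Y ms D k i = Y ms' D' k i"
    "i < N \<Longrightarrow> j \<in> nbrU h E i \<Longrightarrow> Z ms D k i j = Z ms' D' k i j"
  using assms(3,4)
proof (induction k arbitrary: i j)
  case 0
  { case 1 then show ?case using Y_0 by simp }
  { case 2 then show ?case using Z_0 by simp }
next
  case (Suc k)
  have IH: "i < N \<Longrightarrow> Y ms D k i = Y ms' D' k i"
     "i < N \<Longrightarrow> j \<in> nbrU h E i \<Longrightarrow> Z ms D k i j = Z ms' D' k i j"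
    if "\<And>t. t \<le> t0 + Suc k \<Longrightarrow> ms t = ms' t"
      "\<And>i j t. (i, j) \<in> pairs N h E \<Longrightarrow> t \<le> t0 + Suc k \<Longrightarrow> D i j t = D' i j t" for i j
    using Suc.IH that by auto
  have Z: "Z ms D (Suc k) i j = Z ms' D' (Suc k) i j"
    if "i < N" "j \<in> nbrU h E i" "\<And>t. t \<le> t0 + Suc k \<Longrightarrow> ms t = ms' t"
      "\<And>i j t. (i, j) \<in> pairs N h E \<Longrightarrow> t \<le> t0 + Suc k \<Longrightarrow> D i j t = D' i j t" for i j
  proof -
    have "D i j (t0 + 1 + k) = D' i j (t0 + 1 + k)" "ms (t0 + 1 + k) = ms' (t0 + 1 + k)"
      using that by (auto simp: pairs_iff)
    then show ?thesis using IH(1)[OF that(3,4) nbrU_less[OF that(2)]] IH(2)[OF that(3,4,1,2)] by (simp only: Z_Suc)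
  qed
  { case 2 then show ?case using Z by blast }
  { case 1
    have "ms (t0 + 1 + k) = ms' (t0 + 1 + k)" using 1 by simp
    moreover have "j \<in> nbrU h E i" if "j \<in> nbr E (ms' (t0 + 1 + k)) i" for j
      using assms(2) that nbr_subset_nbrU[of "ms' (t0 + 1 + k)" h E i] unfolding good_path_def by blast
    ultimately show ?case unfolding Y_Suc[OF 1(1)]
      using Z[OF 1(1) _ 1(2,3)] IH(1)[OF 1(2,3) 1(1)] by (simp cong: sum.cong) }
qed

section \<open>Measurability of the state and independence of the next noise\<close>

abbreviation "dec X \<equiv> (\<lambda>i j t. X ((i, j), t) :: real)"

text \<open>The set \<open>T\<close> of times is left free so that the same product space serves all
  earlier indices in the induction.\<close>

lemma state_measurable_product:
  assumes ms: "good_path ms" and T: "{..t0 + k} \<subseteq> T"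
  shows "i < N \<Longrightarrow> (\<lambda>X. Y ms (dec X) k i) \<in> borel_measurable (PiM (pairs N h E \<times> T) (\<lambda>_. borel))"
    "i < N \<Longrightarrow> j \<in> nbrU h E i \<Longrightarrow> (\<lambda>X. Z ms (dec X) k i j) \<in> borel_measurable (PiM (pairs N h E \<times> T) (\<lambda>_. borel))"
  using T
proof (induction k arbitrary: i j)
  case 0
  { case 1 then show ?case using Y_0 by simp }
  { case 2 then show ?case using Z_0 by simp }
next
  case (Suc k)
  let ?PM = "PiM (pairs N h E \<times> T) (\<lambda>_. borel :: real measure)"
  have IH: "i < N \<Longrightarrow> (\<lambda>X. Y ms (dec X) k i) \<in> borel_measurable ?PM"
    "i < N \<Longrightarrow> j \<in> nbrU h E i \<Longrightarrow> (\<lambda>X. Z ms (dec X) k i j) \<in> borel_measurable ?PM"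
    if T: "{..t0 + Suc k} \<subseteq> T" for i j
  proof -
    have "{..t0 + k} \<subseteq> T" using T by (auto simp: subset_iff)
    then show "i < N \<Longrightarrow> (\<lambda>X. Y ms (dec X) k i) \<in> borel_measurable ?PM"
      "i < N \<Longrightarrow> j \<in> nbrU h E i \<Longrightarrow> (\<lambda>X. Z ms (dec X) k i j) \<in> borel_measurable ?PM"
      using Suc.IH by blast+
  qed
  have [measurable]: "Fcdf \<sigma> \<in> borel_measurable borel" by (rule Fcdf_measurable[OF \<sigma>])
  have Z: "(\<lambda>X. Z ms (dec X) (Suc k) i j) \<in> borel_measurable ?PM"
    if "i < N" "j \<in> nbrU h E i" "{..t0 + Suc k} \<subseteq> T" for i j
  proof -
    have "((i, j), t0 + 1 + k) \<in> pairs N h E \<times> T" using that by (auto simp: pairs_iff)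
    then have [measurable]: "(\<lambda>X. X ((i, j), t0 + 1 + k)) \<in> borel_measurable ?PM"
      by (rule measurable_component_singleton)
    have [measurable]: "(\<lambda>X. Z ms (dec X) k i j) \<in> borel_measurable ?PM"
      "(\<lambda>X. Y ms (dec X) k j) \<in> borel_measurable ?PM"
      using IH[OF that(3)] that nbrU_less by auto
    show ?thesis unfolding Z_Suc projM_def by measurable
  qed
  { case 2 then show ?case using Z by blast }
  { case 1
    have "j \<in> nbrU h E i" if "j \<in> nbr E (ms (t0 + 1 + k)) i" for j
      using ms that nbr_subset_nbrU[of "ms (t0 + 1 + k)" h E i] unfolding good_path_def by blast
    then show ?case unfolding Y_Suc[OF 1(1)]
      using Z[OF 1(1) _ 1(2)] IH(1)[OF 1(2,1)]
      by (intro borel_measurable_add borel_measurable_times borel_measurable_sum borel_measurable_diff) auto }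
qed

text \<open>The noise on which the state of index \<open>k\<close> depends. Factoring the state
  through it gives both its measurability and its independence of later noise.\<close>

definition "obs k \<omega> = restrict (\<lambda>p. (case_prod (case_prod d)) p \<omega>) (pairs N h E \<times> {..t0 + k})"

lemma d_noise_alg: "(i, j) \<in> pairs N h E \<Longrightarrow> d i j t \<in> borel_measurable noise_alg"
proof (rule measurableI)
  fix A :: "real set" assume "(i, j) \<in> pairs N h E" "A \<in> sets borel"
  then have "d i j t -` A \<inter> space M \<in> (\<Union>((i, j), t)\<in>pairs N h E \<times> UNIV. {d i j t -` A \<inter> space M | A. A \<in> sets borel})"
    by fastforce
  then show "d i j t -` A \<inter> space noise_alg \<in> sets noise_alg"
    unfolding sets_measure_of[OF noise] space_measure_of_conv by (rule sigma_sets.Basic)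
qed simp

lemma obs_measurable: "obs k \<in> measurable noise_alg (PiM (pairs N h E \<times> {..t0 + k}) (\<lambda>_. borel))"
  unfolding obs_def
  by (rule measurable_restrict) (use d_noise_alg in auto)

abbreviation "dn \<omega> \<equiv> (\<lambda>i j t. d i j t \<omega>)"

lemma state_obs:
  assumes ms: "good_path ms"
  shows "i < N \<Longrightarrow> Y ms (dn \<omega>) k i = Y ms (dec (obs k \<omega>)) k i"
    "i < N \<Longrightarrow> j \<in> nbrU h E i \<Longrightarrow> Z ms (dn \<omega>) k i j = Z ms (dec (obs k \<omega>)) k i j"
  by (rule state_cong[OF ms ms]; simp add: obs_def)+

lemma state_measurable:
  assumes ms: "good_path ms"
  shows "i < N \<Longrightarrow> (\<lambda>\<omega>. Y ms (dn \<omega>) k i) \<in> borel_measurable noise_alg"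
    "i < N \<Longrightarrow> j \<in> nbrU h E i \<Longrightarrow> (\<lambda>\<omega>. Z ms (dn \<omega>) k i j) \<in> borel_measurable noise_alg"
  using measurable_compose[OF obs_measurable state_measurable_product(1)[OF ms order_refl]]
    measurable_compose[OF obs_measurable state_measurable_product(2)[OF ms order_refl]]
  by (simp_all add: state_obs[OF ms])

text \<open>The bit is compared with \<open>Fcdf\<close> at the true output, which is its
  conditional mean. The state depends on noise up to \<open>t0 + k\<close> and the bit on fresh
  noise at \<open>t0 + 1 + k\<close>.\<close>

lemma noise_mean_zero:
  assumes ms: "good_path ms" and i: "i < N" and j: "j \<in> nbrU h E i"
  shows "(\<integral>\<omega>. (Z ms (dn \<omega>) k i j - Y ms (dn \<omega>) k j) * (Fcdf \<sigma> (c i j - Y ms (dn \<omega>) k j) - sbit ms (dn \<omega>) k i j) \<partial>M) = 0"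
proof -
  have jN: "j < N" by (rule nbrU_less[OF j])
  have p: "(i, j) \<in> pairs N h E" using i j by (simp add: pairs_iff)
  let ?X = "case_prod (case_prod d)"
  \<comment> \<open>Disjoint blocks of indices for the past noise and the single fresh variable;
    independence of the whole family passes to functions of the two blocks.\<close>
  let ?A = "pairs N h E \<times> {..t0 + k}" and ?B = "{((i, j), t0 + 1 + k)}"
  let ?f = "\<lambda>X. (Y ms (dec X) k j, Z ms (dec X) k i j - Y ms (dec X) k j)"
  let ?g = "\<lambda>X. (X ((i, j), t0 + 1 + k), 0 :: real)"
  have "indep_var (PiM ?A (\<lambda>_. borel)) (\<lambda>\<omega>. restrict (\<lambda>p. ?X p \<omega>) ?A) (PiM ?B (\<lambda>_. borel)) (\<lambda>\<omega>. restrict (\<lambda>p. ?X p \<omega>) ?B)"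
    by (rule indep_var_restrict[OF indep_noise]) (use p in auto)
  moreover have "?f \<in> measurable (PiM ?A (\<lambda>_. borel)) (borel \<Otimes>\<^sub>M borel)"
    using state_measurable_product[OF ms order_refl] i j jN
    by (intro measurable_Pair borel_measurable_diff) auto
  moreover have "?g \<in> measurable (PiM ?B (\<lambda>_. borel)) (borel \<Otimes>\<^sub>M borel)"
    by (intro measurable_Pair measurable_component_singleton) auto
  ultimately have "indep_var (borel \<Otimes>\<^sub>M borel) (?f \<circ> (\<lambda>\<omega>. restrict (\<lambda>p. ?X p \<omega>) ?A))
      (borel \<Otimes>\<^sub>M borel) (?g \<circ> (\<lambda>\<omega>. restrict (\<lambda>p. ?X p \<omega>) ?B))"
    by (rule indep_var_compose)
  moreover have "?f \<circ> (\<lambda>\<omega>. restrict (\<lambda>p. ?X p \<omega>) ?A) = (\<lambda>\<omega>. (Y ms (dn \<omega>) k j, Z ms (dn \<omega>) k i j - Y ms (dn \<omega>) k j))"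
    by (simp add: fun_eq_iff obs_def[symmetric] state_obs[OF ms] i j jN)
  moreover have "?g \<circ> (\<lambda>\<omega>. restrict (\<lambda>p. ?X p \<omega>) ?B) = (\<lambda>\<omega>. (d i j (t0 + 1 + k) \<omega>, 0))"
    by (simp add: fun_eq_iff)
  ultimately have ind: "indep_var (borel \<Otimes>\<^sub>M borel) (\<lambda>\<omega>. (Y ms (dn \<omega>) k j, Z ms (dn \<omega>) k i j - Y ms (dn \<omega>) k j))
     (borel \<Otimes>\<^sub>M borel) (\<lambda>\<omega>. (d i j (t0 + 1 + k) \<omega>, 0))" by simp
  have "\<bar>Z ms (dn \<omega>) k i j - Y ms (dn \<omega>) k j\<bar> \<le> 2 * Mb" for \<omega>
    using state_bounds(1)[OF ms jN, of "dn \<omega>" k] state_bounds(2)[OF ms i j, of "dn \<omega>" k] by linarith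
  then show ?thesis unfolding sbit_def
    using Mb by (intro threshold_mean_zero[OF \<sigma> _ ind dist[OF p], where B="2 * Mb"]) auto
qed

text \<open>What a functional of the state must satisfy for the sum over histories: it looks only at
  genuine agents and pairs, it is bounded on the invariant box, and it preserves measurability. The
  last clause is phrased through measurable components, so no sigma-algebra on the state functions
  has to be chosen.\<close>

definition admissible :: "((nat \<Rightarrow> real) \<Rightarrow> (nat \<Rightarrow> nat \<Rightarrow> real) \<Rightarrow> real) \<Rightarrow> bool" where
  "admissible \<phi> \<longleftrightarrow>
    (\<forall>y y' z z'. (\<forall>i<N. y i = y' i) \<longrightarrow> (\<forall>i<N. \<forall>j\<in>nbrU h E i. z i j = z' i j) \<longrightarrow> \<phi> y z = \<phi> y' z') \<and>
    (\<exists>B. \<forall>y z. (\<forall>i<N. \<bar>y i\<bar> \<le> Mb) \<longrightarrow> (\<forall>i<N. \<forall>j\<in>nbrU h E i. \<bar>z i j\<bar> \<le> Mb) \<longrightarrow> \<bar>\<phi> y z\<bar> \<le> B) \<and>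
    (\<forall>(K :: 'w measure) f g. (\<forall>i<N. (\<lambda>\<omega>. f \<omega> i) \<in> borel_measurable K) \<longrightarrow>
      (\<forall>i<N. \<forall>j\<in>nbrU h E i. (\<lambda>\<omega>. g \<omega> i j) \<in> borel_measurable K) \<longrightarrow>
      (\<lambda>\<omega>. \<phi> (f \<omega>) (g \<omega>)) \<in> borel_measurable K)"

definition "Yw k \<omega> = Y (\<lambda>t. m t \<omega>) (dn \<omega>) k"

definition "Zw k \<omega> = Z (\<lambda>t. m t \<omega>) (dn \<omega>) k"

lemma cyl_agree: "\<omega> \<in> cyl t s \<Longrightarrow> k \<le> t \<Longrightarrow> m k \<omega> = s k"
  by (simp add: cyl_def)

lemma admissible_path:
  assumes ad: "admissible \<phi>"
  shows "\<lbrakk>\<omega> \<in> space M; s \<in> paths h (t0 + k); \<omega> \<in> cyl (t0 + k) s\<rbrakk> \<Longrightarrow>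
      \<phi> (Y (\<lambda>t. m t \<omega>) (dn \<omega>) k) (Z (\<lambda>t. m t \<omega>) (dn \<omega>) k) = \<phi> (Y s (dn \<omega>) k) (Z s (dn \<omega>) k)"
    and "good_path s \<Longrightarrow> (\<lambda>\<omega>. \<phi> (Y s (dn \<omega>) k) (Z s (dn \<omega>) k)) \<in> borel_measurable noise_alg"
    and "\<exists>B. \<forall>s \<omega> k. good_path s \<longrightarrow> \<bar>\<phi> (Y s (dn \<omega>) k) (Z s (dn \<omega>) k)\<bar> \<le> B"
proof -
  assume \<omega>: "\<omega> \<in> space M" and s: "s \<in> paths h (t0 + k)" and cy: "\<omega> \<in> cyl (t0 + k) s"
  note cong = state_cong[OF good_path_chain[OF \<omega>] good_path_paths[OF s] cyl_agree[OF cy] refl]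
  have "\<forall>i<N. Y (\<lambda>t. m t \<omega>) (dn \<omega>) k i = Y s (dn \<omega>) k i"
    "\<forall>i<N. \<forall>j\<in>nbrU h E i. Z (\<lambda>t. m t \<omega>) (dn \<omega>) k i j = Z s (dn \<omega>) k i j"
    using cong by blast+
  then show "\<phi> (Y (\<lambda>t. m t \<omega>) (dn \<omega>) k) (Z (\<lambda>t. m t \<omega>) (dn \<omega>) k) = \<phi> (Y s (dn \<omega>) k) (Z s (dn \<omega>) k)"
    using ad unfolding admissible_def by blast
next
  show "good_path s \<Longrightarrow> (\<lambda>\<omega>. \<phi> (Y s (dn \<omega>) k) (Z s (dn \<omega>) k)) \<in> borel_measurable noise_alg"
    using ad[unfolded admissible_def, THEN conjunct2, THEN conjunct2, rule_format, where K=noise_alg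
        and f="\<lambda>\<omega>. Y s (dn \<omega>) k" and g="\<lambda>\<omega>. Z s (dn \<omega>) k"] state_measurable[of s] by blast
next
  obtain B where "\<And>y z. (\<forall>i<N. \<bar>y i\<bar> \<le> Mb) \<Longrightarrow> (\<forall>i<N. \<forall>j\<in>nbrU h E i. \<bar>z i j\<bar> \<le> Mb) \<Longrightarrow> \<bar>\<phi> y z\<bar> \<le> B"
    using ad[unfolded admissible_def, THEN conjunct2, THEN conjunct1] by blast
  then show "\<exists>B. \<forall>s \<omega> k. good_path s \<longrightarrow> \<bar>\<phi> (Y s (dn \<omega>) k) (Z s (dn \<omega>) k)\<bar> \<le> B"
    using state_bounds by (intro exI[of _ B] allI impI) blast
qed

lemma admissible_measurable:
  assumes ad: "admissible \<phi>"
  shows "(\<lambda>\<omega>. \<phi> (Yw k \<omega>) (Zw k \<omega>)) \<in> borel_measurable M"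
proof -
  obtain B where B: "\<And>s \<omega>. good_path s \<Longrightarrow> \<bar>\<phi> (Y s (dn \<omega>) k) (Z s (dn \<omega>) k)\<bar> \<le> B"
    using admissible_path(3)[OF ad] by blast
  show ?thesis unfolding Yw_def Zw_def
    by (rule path_measurable[where \<Psi>="\<lambda>s \<omega>. \<phi> (Y s (dn \<omega>) k) (Z s (dn \<omega>) k)" and t="t0 + k" and B=B])
      (auto intro: admissible_path[OF ad] good_path_paths B)
qed

lemma admissible_bounded:
  assumes ad: "admissible \<phi>"
  shows "\<exists>B. \<forall>k. \<forall>\<omega>\<in>space M. \<bar>\<phi> (Yw k \<omega>) (Zw k \<omega>)\<bar> \<le> B"
  using admissible_path(3)[OF ad] good_path_chain unfolding Yw_def Zw_def by blast

lemma chain_measurable: "(\<lambda>\<omega>. G (m t \<omega>) :: real) \<in> borel_measurable M"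
  by (rule chain_alg_measurable) measurable

lemma admissible_integrable:
  assumes ad: "admissible \<phi>"
  shows "integrable M (\<lambda>\<omega>. G (m t \<omega>) * \<phi> (Yw k \<omega>) (Zw k \<omega>))"
proof -
  obtain B where B: "\<And>\<omega>. \<omega> \<in> space M \<Longrightarrow> \<bar>\<phi> (Yw k \<omega>) (Zw k \<omega>)\<bar> \<le> B"
    using admissible_bounded[OF ad] by blast
  obtain B1 where B1: "\<And>u. u < h \<Longrightarrow> \<bar>G u\<bar> \<le> B1" using finite_values_bounded by blast
  have "\<bar>G (m t \<omega>) * \<phi> (Yw k \<omega>) (Zw k \<omega>)\<bar> \<le> B1 * B" if "\<omega> \<in> space M" for \<omega>
  proof -
    have "\<bar>G (m t \<omega>)\<bar> \<le> B1" "\<bar>\<phi> (Yw k \<omega>) (Zw k \<omega>)\<bar> \<le> B" using B1 B m_less that by auto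
    moreover from this have "0 \<le> B1" by linarith
    ultimately show ?thesis unfolding abs_mult by (intro mult_mono) auto
  qed
  then show ?thesis
    using admissible_measurable[OF ad, of k] chain_measurable[of G t]
    by (intro integrable_const_bound[where B="B1 * B"]) auto
qed

text \<open>The state of index \<open>k\<close> depends on the chain up to \<open>t0 + k\<close>, so
  the transition out of that time can be averaged while the state stays fixed.\<close>

lemma admissible_markov:
  assumes ad: "admissible \<phi>"
  shows "(\<integral>\<omega>. G (m (Suc (t0 + k)) \<omega>) * \<phi> (Yw k \<omega>) (Zw k \<omega>) \<partial>M)
    = (\<integral>\<omega>. (\<Sum>v<h. P $$ (m (t0 + k) \<omega>, v) * G v) * \<phi> (Yw k \<omega>) (Zw k \<omega>) \<partial>M)"
proof -
  obtain B where B: "\<And>s \<omega>. good_path s \<Longrightarrow> \<bar>\<phi> (Y s (dn \<omega>) k) (Z s (dn \<omega>) k)\<bar> \<le> B"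
    using admissible_path(3)[OF ad] by blast
  show ?thesis unfolding Yw_def Zw_def
    by (rule markov_mean[where \<Psi>="\<lambda>s \<omega>. \<phi> (Y s (dn \<omega>) k) (Z s (dn \<omega>) k)" and t="t0 + k" and B=B])
      (auto intro: admissible_path[OF ad] good_path_paths B)
qed

lemma avg_measurable:
  "(\<And>i. i < N \<Longrightarrow> (\<lambda>\<omega>. f \<omega> i) \<in> borel_measurable K) \<Longrightarrow> (\<lambda>\<omega>. avg N (f \<omega>)) \<in> borel_measurable K"
  unfolding avg_def by (intro borel_measurable_divide borel_measurable_sum) auto

lemma admissible_lyap:
  assumes w: "w \<ge> 0"
  shows "admissible (lyap N h E w)"
  unfolding admissible_def
proof (intro conjI allI impI)
  fix y y' :: "nat \<Rightarrow> real" and z z' :: "nat \<Rightarrow> nat \<Rightarrow> real"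
  assume y: "\<forall>i<N. y i = y' i" and z: "\<forall>i<N. \<forall>j\<in>nbrU h E i. z i j = z' i j"
  have "avg N y = avg N y'" unfolding avg_def using y by simp
  then have "disagreement N y = disagreement N y'"
    unfolding disagreement_def using y by (intro sum.cong) auto
  moreover have "(z i j - y j)\<^sup>2 = (z' i j - y' j)\<^sup>2" if "i < N" "j \<in> nbrU h E i" for i j
    using y z that nbrU_less[OF that(2)] by simp
  then have "est_error N h E y z = est_error N h E y' z'"
    unfolding est_error_def by (intro sum.cong) auto
  ultimately show "lyap N h E w y z = lyap N h E w y' z'" by (simp add: lyap_def)
next
  show "\<exists>B. \<forall>y z. (\<forall>i<N. \<bar>y i\<bar> \<le> Mb) \<longrightarrow> (\<forall>i<N. \<forall>j\<in>nbrU h E i. \<bar>z i j\<bar> \<le> Mb) \<longrightarrow> \<bar>lyap N h E w y z\<bar> \<le> B"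
    using lyap_abs_le[OF _ valid w, of Mb] N2 Mb
    by (intro exI[of _ "real N * (2 * Mb)\<^sup>2 + w * (real N * (real N * (2 * Mb)\<^sup>2))"]) auto
next
  fix K :: "'w measure" and f :: "'w \<Rightarrow> nat \<Rightarrow> real" and g :: "'w \<Rightarrow> nat \<Rightarrow> nat \<Rightarrow> real"
  assume f: "\<forall>i<N. (\<lambda>\<omega>. f \<omega> i) \<in> borel_measurable K"
    and g: "\<forall>i<N. \<forall>j\<in>nbrU h E i. (\<lambda>\<omega>. g \<omega> i j) \<in> borel_measurable K"
  have "(\<lambda>\<omega>. avg N (f \<omega>)) \<in> borel_measurable K" using f by (intro avg_measurable) auto
  then show "(\<lambda>\<omega>. lyap N h E w (f \<omega>) (g \<omega>)) \<in> borel_measurable K"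
    unfolding lyap_def disagreement_def est_error_def using f g nbrU_less
    by (intro borel_measurable_add borel_measurable_times borel_measurable_sum borel_measurable_power borel_measurable_diff) auto
qed

lemma admissible_sw_drift:
  assumes u: "u < h" and \<rho>: "\<rho> \<ge> 0"
  shows "admissible (sw_drift N E \<gamma> \<rho> u)"
  unfolding admissible_def
proof (intro conjI allI impI)
  have nU: "j \<in> nbr E u i \<Longrightarrow> j \<in> nbrU h E i" for i j using nbr_subset_nbrU[OF u] by blast
  have nN: "j \<in> nbr E u i \<Longrightarrow> j < N" for i j using nbr_subset[OF valid u] by blast
  {
    fix y y' :: "nat \<Rightarrow> real" and z z' :: "nat \<Rightarrow> nat \<Rightarrow> real"
    assume y: "\<forall>i<N. y i = y' i" and z: "\<forall>i<N. \<forall>j\<in>nbrU h E i. z i j = z' i j"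
    show "sw_drift N E \<gamma> \<rho> u y z = sw_drift N E \<gamma> \<rho> u y' z'"
      unfolding sw_drift_pairs using y z nU nN by (intro sum.cong refl) simp
  next
    show "\<exists>B. \<forall>y z. (\<forall>i<N. \<bar>y i\<bar> \<le> Mb) \<longrightarrow> (\<forall>i<N. \<forall>j\<in>nbrU h E i. \<bar>z i j\<bar> \<le> Mb) \<longrightarrow> \<bar>sw_drift N E \<gamma> \<rho> u y z\<bar> \<le> B"
      using sw_drift_abs_le[OF valid u _ \<rho>, of \<gamma> Mb] \<gamma> Mb
      by (intro exI[of _ "real N * (real N * (4 * \<gamma> * Mb\<^sup>2 + 8 * \<rho> * Mb\<^sup>2))"]) auto
  next
    fix K :: "'w measure" and f :: "'w \<Rightarrow> nat \<Rightarrow> real" and g :: "'w \<Rightarrow> nat \<Rightarrow> nat \<Rightarrow> real"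
    assume f: "\<forall>i<N. (\<lambda>\<omega>. f \<omega> i) \<in> borel_measurable K"
      and g: "\<forall>i<N. \<forall>j\<in>nbrU h E i. (\<lambda>\<omega>. g \<omega> i j) \<in> borel_measurable K"
    show "(\<lambda>\<omega>. sw_drift N E \<gamma> \<rho> u (f \<omega>) (g \<omega>)) \<in> borel_measurable K"
      unfolding sw_drift_pairs using f g nU nN
      by (intro borel_measurable_add borel_measurable_times borel_measurable_sum borel_measurable_power borel_measurable_diff) auto
  }
qed

text \<open>The innovation recentred at the true output \<open>Y\<close> instead of the estimate
  \<open>Z\<close>: this version has mean zero, and the remaining difference of two values of
  \<open>Fcdf\<close> is the strongly monotone part.\<close>

definition "zeta ms D k i j = (Z ms D k i j - Y ms D k j) * (Fcdf \<sigma> (c i j - Y ms D k j) - sbit ms D k i j)"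

definition "noise_sum ms D k = (\<Sum>i<N. \<Sum>j\<in>nbr E (ms (t0 + 1 + k)) i. zeta ms D k i j)"

lemma zeta_bound:
  assumes ms: "good_path ms" and i: "i < N" and j: "j \<in> nbrU h E i"
  shows "\<bar>zeta ms D k i j\<bar> \<le> 2 * Mb"
proof -
  have "\<bar>Z ms D k i j - Y ms D k j\<bar> \<le> 2 * Mb"
    using state_bounds(1)[OF ms nbrU_less[OF j], of D k] state_bounds(2)[OF ms i j, of D k] by linarith
  moreover have "\<bar>Fcdf \<sigma> (c i j - Y ms D k j) - sbit ms D k i j\<bar> \<le> 1"
    using Fcdf_range[OF \<sigma>, of "c i j - Y ms D k j"] by (auto simp: sbit_def)
  ultimately have "\<bar>zeta ms D k i j\<bar> \<le> 2 * Mb * 1"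
    unfolding zeta_def abs_mult using Mb by (intro mult_mono) auto
  then show ?thesis by simp
qed

lemma noise_sum_bound:
  assumes ms: "good_path ms"
  shows "\<bar>noise_sum ms D k\<bar> \<le> real N * (real N * (2 * Mb))"
proof -
  have u: "ms (t0 + 1 + k) < h" using ms by (simp add: good_path_def)
  show ?thesis unfolding noise_sum_def
    using Mb nbr_subset_nbrU[OF u] by (intro sum_agents_abs_le sum_nbr_abs_le[OF valid u] zeta_bound[OF ms]) auto
qed

lemma zeta_measurable:
  assumes ms: "good_path ms" and i: "i < N" and j: "j \<in> nbrU h E i"
  shows "(\<lambda>\<omega>. zeta ms (dn \<omega>) k i j) \<in> borel_measurable noise_alg"
proof -
  have [measurable]: "Fcdf \<sigma> \<in> borel_measurable borel" by (rule Fcdf_measurable[OF \<sigma>])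
  have [measurable]: "(\<lambda>\<omega>. Y ms (dn \<omega>) k j) \<in> borel_measurable noise_alg" "(\<lambda>\<omega>. Z ms (dn \<omega>) k i j) \<in> borel_measurable noise_alg"
    "(\<lambda>\<omega>. d i j (t0 + 1 + k) \<omega>) \<in> borel_measurable noise_alg"
    using state_measurable[OF ms] i j nbrU_less d_noise_alg[of i j "t0 + 1 + k"] by (auto simp: pairs_iff)
  show ?thesis unfolding zeta_def sbit_def by measurable
qed

lemma noise_sum_properties:
  "(\<lambda>\<omega>. noise_sum (\<lambda>t. m t \<omega>) (dn \<omega>) k) \<in> borel_measurable M" (is ?meas)
  "(\<integral>\<omega>. noise_sum (\<lambda>t. m t \<omega>) (dn \<omega>) k \<partial>M) = 0" (is ?int)
proof -
  \<comment> \<open>Histories one step longer than for the state, because the graph at time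
    \<open>t0 + 1 + k\<close> selects the pairs in the sum.\<close>
  let ?t = "t0 + 1 + k"
  have nU: "j \<in> nbrU h E i" if "good_path s" "j \<in> nbr E (s ?t) i" for s i j
    using that nbr_subset_nbrU[of "s ?t" h E i] unfolding good_path_def by blast
  have cong: "noise_sum (\<lambda>t. m t \<omega>) (dn \<omega>) k = noise_sum s (dn \<omega>) k"
    if \<omega>: "\<omega> \<in> space M" and s: "s \<in> paths h ?t" and cy: "\<omega> \<in> cyl ?t s" for \<omega> s
  proof -
    note gs = good_path_paths[OF s] and gm = good_path_chain[OF \<omega>]
    have agree: "m t \<omega> = s t" if "t \<le> t0 + k" for t using cy that by (simp add: cyl_def)
    have "m ?t \<omega> = s ?t" using cy by (simp add: cyl_def)
    moreover have "zeta (\<lambda>t. m t \<omega>) (dn \<omega>) k i j = zeta s (dn \<omega>) k i j" if "i < N" "j \<in> nbr E (s ?t) i" for i j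
    proof -
      have j: "j \<in> nbrU h E i" by (rule nU[OF gs that(2)])
      have "Y (\<lambda>t. m t \<omega>) (dn \<omega>) k j = Y s (dn \<omega>) k j"
        by (rule state_cong(1)[OF gm gs agree refl nbrU_less[OF j]])
      moreover have "Z (\<lambda>t. m t \<omega>) (dn \<omega>) k i j = Z s (dn \<omega>) k i j"
        by (rule state_cong(2)[OF gm gs agree refl that(1) j])
      ultimately show ?thesis by (simp add: zeta_def sbit_def)
    qed
    ultimately show ?thesis unfolding noise_sum_def by simp
  qed
  have meas: "(\<lambda>\<omega>. noise_sum s (dn \<omega>) k) \<in> borel_measurable noise_alg" if "s \<in> paths h ?t" for s
    unfolding noise_sum_def using good_path_paths[OF that]
    by (intro borel_measurable_sum zeta_measurable nU) auto
  have bound: "\<bar>noise_sum s (dn \<omega>) k\<bar> \<le> real N * (real N * (2 * Mb))" if "s \<in> paths h ?t" for s \<omega>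
    by (rule noise_sum_bound[OF good_path_paths[OF that]])
  show ?meas
    by (rule path_measurable[where \<Psi>="\<lambda>s \<omega>. noise_sum s (dn \<omega>) k", OF cong meas bound])
  have zero: "(\<integral>\<omega>. noise_sum s (dn \<omega>) k \<partial>M) = 0" if s: "s \<in> paths h ?t" for s
  proof -
    note gs = good_path_paths[OF s]
    have int: "integrable M (\<lambda>\<omega>. zeta s (dn \<omega>) k i j)" if "i < N" "j \<in> nbr E (s ?t) i" for i j
      using zeta_bound[OF gs that(1) nU[OF gs that(2)]] noise_alg_measurable[OF zeta_measurable[OF gs that(1) nU[OF gs that(2)]]]
      by (intro integrable_const_bound[where B="2 * Mb"]) auto
    have "(\<integral>\<omega>. noise_sum s (dn \<omega>) k \<partial>M) = (\<Sum>i<N. \<integral>\<omega>. (\<Sum>j\<in>nbr E (s ?t) i. zeta s (dn \<omega>) k i j) \<partial>M)"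
      unfolding noise_sum_def using int by (intro Bochner_Integration.integral_sum Bochner_Integration.integrable_sum) auto
    also have "\<dots> = (\<Sum>i<N. \<Sum>j\<in>nbr E (s ?t) i. \<integral>\<omega>. zeta s (dn \<omega>) k i j \<partial>M)"
      using int by (intro sum.cong refl Bochner_Integration.integral_sum) auto
    also have "\<dots> = 0" unfolding zeta_def using noise_mean_zero[OF gs _ nU[OF gs]] by simp
    finally show ?thesis .
  qed
  show ?int
    by (rule path_integral_zero[where \<Psi>="\<lambda>s \<omega>. noise_sum s (dn \<omega>) k", OF cong meas bound zero])
qed

end

section \<open>Decrease of the Lyapunov function in expectation\<close>

lemma finite_values_bounded2: "\<exists>B\<ge>0. \<forall>v<(h::nat). \<forall>u<(h::nat). \<bar>F v u :: real\<bar> \<le> B"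
proof (intro exI conjI allI impI)
  show "0 \<le> (\<Sum>v<h. \<Sum>u<h. \<bar>F v u\<bar>)" by (intro sum_nonneg) auto
  fix v u assume "v < h" "u < h"
  then have "\<bar>F v u\<bar> \<le> (\<Sum>u<h. \<bar>F v u\<bar>)" by (intro member_le_sum) auto
  also have "\<dots> \<le> (\<Sum>v<h. \<Sum>u<h. \<bar>F v u\<bar>)" using \<open>v < h\<close> by (intro member_le_sum sum_nonneg) auto
  finally show "\<bar>F v u\<bar> \<le> (\<Sum>v<h. \<Sum>u<h. \<bar>F v u\<bar>)" .
qed

context binary_consensus
begin

abbreviation "l2 \<equiv> lambda2 N h E \<pi>"

abbreviation "lG \<equiv> lambdaG N h E"

abbreviation "fM \<equiv> fM_const N h E c \<sigma> Mb"

abbreviation "pm \<equiv> Min (\<pi> ` {..<h})"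

lemma pi_pos: "u < h \<Longrightarrow> \<pi> u > 0"
  by (rule stationary_pos[OF stoch irr stat])

lemma pm_pos: "pm > 0"
  using pi_pos h_pos by (subst Min_gr_iff) auto

lemma l2_pos: "l2 > 0"
  by (rule lambda2_properties(1)[OF N2 valid connected pi_pos])

lemma lG_pos: "lG > 0"
  by (rule lambdaG_pos[OF N2 valid connected])

lemma finite_pairs: "finite (pairs N h E)"
  by (rule finite_subset[of _ "{..<N} \<times> {..<N}"]) (auto simp: pairs_iff nbrU_less)

lemma fM_le: "i < N \<Longrightarrow> j \<in> nbrU h E i \<Longrightarrow> fM \<le> normal_density 0 \<sigma> (\<bar>c i j\<bar> + Mb)"
  unfolding fM_const_def using finite_pairs by (intro Min_le finite_imageI) (force simp: pairs_iff)+

lemma fM_pos: "fM > 0"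
proof -
  obtain u i where u: "u < h" "{0, i} \<in> E u" using union_connected_edge[OF N2 connected] .
  then have "(0, i) \<in> pairs N h E" using N2 by (auto simp: pairs_def nbrU_def)
  then show ?thesis unfolding fM_const_def
    using finite_pairs by (subst Min_gr_iff) (auto intro!: normal_density_pos[OF \<sigma>])
qed

text \<open>Adding and subtracting the stationary average isolates the fluctuation of the drift. The
  hypotheses on \<kappa> are the coefficient conditions on \<open>disagreement\<close> and
  \<open>est_error\<close> under which the averaged drift is at most \<kappa> times the Lyapunov
  function with negative sign.\<close>

lemma lyapunov_decrease:
  assumes w: "w \<ge> 0"
    and \<kappa>1: "\<kappa> \<le> \<gamma> * l2 - w * (\<gamma> * (lG / l2))"
    and \<kappa>2: "\<kappa> * w \<le> w * (2 * \<beta> * fM * pm - \<gamma> * alpha_const N h E \<pi>) - \<gamma> * (lG / l2)"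
  defines "\<rho> \<equiv> w * \<beta> * fM"
  shows "\<exists>C\<ge>0. \<forall>ms D k. good_path ms \<longrightarrow>
    lyap N h E w (Y ms D (Suc k)) (Z ms D (Suc k)) \<le> (1 - \<kappa> / \<tau> k) * lyap N h E w (Y ms D k) (Z ms D k)
      - (sw_drift N E \<gamma> \<rho> (ms (t0 + 1 + k)) (Y ms D k) (Z ms D k)
         - (\<Sum>v<h. \<pi> v * sw_drift N E \<gamma> \<rho> v (Y ms D k) (Z ms D k))) / \<tau> k
      + 2 * w * \<beta> * noise_sum ms D k / \<tau> k + C / (\<tau> k)\<^sup>2"
proof -
  \<comment> \<open>Copies of the constants of the one-step locale, fixed outside it so that
    \<open>C\<close> is visibly the same for all histories, noises and indices.\<close>
  define A' where "A' = 2 * \<gamma> * real N * Mb"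
  define B' where "B' = \<gamma> * real N * \<beta> + 2 * \<gamma> * real N * Mb"
  define C where "C = 4 * real N * Mb * B' + real N * A'\<^sup>2 + w * (real N * (real N * (4 * Mb * B' + 2 * \<beta> * A' + A'\<^sup>2 + \<beta>\<^sup>2)))"
  have "A' \<ge> 0" "B' \<ge> 0" using \<gamma> \<beta> Mb by (auto simp: A'_def B'_def)
  then have C: "C \<ge> 0" unfolding C_def using \<beta> Mb w by (intro add_nonneg_nonneg mult_nonneg_nonneg) auto
  have "lyap N h E w (Y ms D (Suc k)) (Z ms D (Suc k)) \<le> (1 - \<kappa> / \<tau> k) * lyap N h E w (Y ms D k) (Z ms D k)
      - (sw_drift N E \<gamma> \<rho> (ms (t0 + 1 + k)) (Y ms D k) (Z ms D k)
         - (\<Sum>v<h. \<pi> v * sw_drift N E \<gamma> \<rho> v (Y ms D k) (Z ms D k))) / \<tau> k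
      + 2 * w * \<beta> * noise_sum ms D k / \<tau> k + C / (\<tau> k)\<^sup>2" if ms: "good_path ms" for ms D k
  proof -
    define y z where "y = Y ms D k" and "z = Z ms D k"
    define u where "u = ms (t0 + 1 + k)"
    define V R where "V = disagreement N y" and "R = est_error N h E y z"
    define S where "S = sw_drift N E \<gamma> \<rho> u y z"
    define Sb where "Sb = (\<Sum>v<h. \<pi> v * sw_drift N E \<gamma> \<rho> v y z)"
    define p where "p = lG / l2"
    define al where "al = alpha_const N h E \<pi>"
    interpret st: consensus_step N h E \<beta> \<gamma> Mb "\<tau> k" u y "Y ms D (Suc k)" z "Z ms D (Suc k)"
      "\<lambda>i j. Fcdf \<sigma> (c i j - z i j) - sbit ms D k i j"
      unfolding u_def y_def z_def by (rule step[OF ms])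
    have AB: "st.A = A'" "st.B = B'" by (auto simp: st.A_def st.B_def A'_def B'_def)
    have al: "2 * sqrt (lambdaQW N h E) + lambdaQL N h E / (lG / l2) = al"
      using lG_pos by (simp add: al_def alpha_const_def)
    have \<zeta>: "(z i j - y j) * (Fcdf \<sigma> (c i j - z i j) - sbit ms D k i j) \<le> - fM * (z i j - y j)\<^sup>2 + zeta ms D k i j"
      if i: "i < N" and j: "j \<in> nbr E u i" for i j
    proof -
      have jU: "j \<in> nbrU h E i" using st.nbr_nbrU[OF j] .
      have "(z i j - y j) * (Fcdf \<sigma> (c i j - z i j) - Fcdf \<sigma> (c i j - y j)) \<le> - fM * (z i j - y j)\<^sup>2"
        by (rule Fcdf_monotonicity[OF \<sigma> fM_le[OF i jU] st.zb[OF i jU] st.yb[OF nbrU_less[OF jU]]])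
      then show ?thesis by (simp add: zeta_def y_def z_def algebra_simps)
    qed
    have 1: "lyap N h E w (Y ms D (Suc k)) (Z ms D (Suc k)) \<le> V + w * R
       + (- S + (\<gamma> * l2 + w * (\<gamma> * p)) * V + (\<gamma> * p + w * (\<gamma> * al)) * R) / \<tau> k
       + 2 * w * \<beta> * noise_sum ms D k / \<tau> k + C / (\<tau> k)\<^sup>2"
      using st.lyapunov_step[OF l2_pos lG_pos w \<zeta>]
      unfolding AB al C_def V_def R_def S_def p_def \<rho>_def noise_sum_def u_def lyap_def by simp
    have VR: "V \<ge> 0" "R \<ge> 0" unfolding V_def R_def disagreement_def est_error_def by (auto intro!: sum_nonneg)
    have Sb: "2 * \<gamma> * l2 * V + 2 * \<rho> * pm * R \<le> Sb"
      unfolding Sb_def V_def R_def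
      by (rule stationary_drift_ge[OF N2 valid connected pi_pos])
        (use \<gamma> \<beta> w fM_pos in \<open>auto simp: \<rho>_def\<close>)
    have "\<kappa> * V \<le> (\<gamma> * l2 - w * (\<gamma> * p)) * V" using \<kappa>1 VR by (intro mult_right_mono) (auto simp: p_def)
    moreover have "\<kappa> * w * R \<le> (w * (2 * \<beta> * fM * pm - \<gamma> * al) - \<gamma> * p) * R"
      using \<kappa>2 VR by (intro mult_right_mono) (auto simp: p_def al_def)
    ultimately have "- S + (\<gamma> * l2 + w * (\<gamma> * p)) * V + (\<gamma> * p + w * (\<gamma> * al)) * R
        \<le> - (S - Sb) - \<kappa> * (V + w * R)"
      using Sb unfolding \<rho>_def by (simp add: algebra_simps)
    then have "(- S + (\<gamma> * l2 + w * (\<gamma> * p)) * V + (\<gamma> * p + w * (\<gamma> * al)) * R) / \<tau> k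
        \<le> (- (S - Sb) - \<kappa> * (V + w * R)) / \<tau> k"
      using \<tau>_pos(1)[of k] by (intro divide_right_mono) auto
    also have "\<dots> = - (S - Sb) / \<tau> k - \<kappa> / \<tau> k * (V + w * R)" by (simp add: diff_divide_distrib)
    finally have "V + w * R + (- S + (\<gamma> * l2 + w * (\<gamma> * p)) * V + (\<gamma> * p + w * (\<gamma> * al)) * R) / \<tau> k
        \<le> (1 - \<kappa> / \<tau> k) * (V + w * R) - (S - Sb) / \<tau> k" by (simp add: left_diff_distrib diff_divide_distrib)
    with 1 show ?thesis
      unfolding V_def R_def S_def Sb_def lyap_def y_def z_def u_def by linarith
  qed
  then show ?thesis using C by blast
qed

text \<open>With \<open>G v\<close> solving the Poisson equation for the indicator of \<open>v\<close>, the fluctuation of the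
  drift is \<open>\<Sum>v. (G v - P G v)(m) * D v k\<close>. Replacing \<open>D v k\<close> by \<open>D v (k + 1)\<close> in the second part costs
  \<open>O(1/\<tau>)\<close>, and the Markov property then turns \<open>P G v\<close> into \<open>G v\<close> at the next time.\<close>

lemma expectation_recursion:
  assumes w: "w \<ge> 0"
    and \<kappa>1: "\<kappa> \<le> \<gamma> * l2 - w * (\<gamma> * (lG / l2))"
    and \<kappa>2: "\<kappa> * w \<le> w * (2 * \<beta> * fM * pm - \<gamma> * alpha_const N h E \<pi>) - \<gamma> * (lG / l2)"
  defines "L \<equiv> \<lambda>k. \<integral>\<omega>. lyap N h E w (Yw k \<omega>) (Zw k \<omega>) \<partial>M"
  shows "\<exists>Q K C. C \<ge> 0 \<and> (\<forall>k. \<bar>Q k\<bar> \<le> K) \<and>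
    (\<forall>k. L (Suc k) \<le> (1 - \<kappa> / \<tau> k) * L k - (Q k - Q (Suc k)) / \<tau> k + C / (\<tau> k)\<^sup>2)"
proof -
  define \<rho> where "\<rho> = w * \<beta> * fM"
  have \<rho>: "\<rho> \<ge> 0" using w \<beta> fM_pos by (simp add: \<rho>_def)
  define D where "D = (\<lambda>v k \<omega>. sw_drift N E \<gamma> \<rho> v (Yw k \<omega>) (Zw k \<omega>))"
  have adL: "admissible (lyap N h E w)" by (rule admissible_lyap[OF w])
  have adD: "admissible (sw_drift N E \<gamma> \<rho> v)" if "v < h" for v by (rule admissible_sw_drift[OF that \<rho>])
  \<comment> \<open>The equation is solved once for each indicator, not for the drift at each state;
    the solutions are therefore deterministic and bounded uniformly in time.\<close>
  have "\<forall>v. \<exists>G. \<forall>u<h. (if u = v then 1 else 0) - (\<Sum>x<h. \<pi> x * (if x = v then 1 else 0)) = G u - (\<Sum>x<h. P $$ (u, x) * G x)"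
    by (intro allI poisson_equation[OF stoch irr stat])
  from choice[OF this] obtain G where G: "\<And>v u. u < h \<Longrightarrow> (if u = v then 1 else 0) - (\<Sum>x<h. \<pi> x * (if x = v then 1 else 0)) = G v u - (\<Sum>x<h. P $$ (u, x) * G v x)"
    by blast
  define PG where "PG = (\<lambda>v u. \<Sum>x<h. P $$ (u, x) * G v x)"
  have poisson: "(if u = v then 1 else 0) - \<pi> v = G v u - PG v u" if "u < h" "v < h" for u v
  proof -
    have "(\<Sum>x<h. \<pi> x * (if x = v then 1 else 0)) = (\<Sum>x<h. if x = v then \<pi> x else 0)" by (intro sum.cong) auto
    then show ?thesis using G[OF that(1), of v] that(2) by (simp add: PG_def)
  qed
  obtain KG where KG: "KG \<ge> 0" "\<And>v u. v < h \<Longrightarrow> u < h \<Longrightarrow> \<bar>G v u\<bar> \<le> KG" using finite_values_bounded2[of h G] by blast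
  obtain KP where KP: "KP \<ge> 0" "\<And>v u. v < h \<Longrightarrow> u < h \<Longrightarrow> \<bar>PG v u\<bar> \<le> KP" using finite_values_bounded2[of h PG] by blast
  define BD where "BD = real N * (real N * (4 * \<gamma> * Mb\<^sup>2 + 8 * \<rho> * Mb\<^sup>2))"
  define r where "r = 2 * \<gamma> * real N * Mb + \<beta>"
  define LD where "LD = real N * (real N * ((8 * \<gamma> * Mb + 16 * \<rho> * Mb) * r))"
  have r0: "r \<ge> 0" using \<gamma> \<beta> Mb by (simp add: r_def)
  have BD: "\<bar>D v k \<omega>\<bar> \<le> BD" if "\<omega> \<in> space M" "v < h" for v k \<omega>
    unfolding D_def BD_def Yw_def Zw_def
    by (rule sw_drift_abs_le[OF valid that(2)])
      (use \<gamma> \<rho> Mb state_bounds[OF good_path_chain[OF that(1)]] in auto)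
  have LD: "\<bar>D v (Suc k) \<omega> - D v k \<omega>\<bar> \<le> LD / \<tau> k" if \<omega>: "\<omega> \<in> space M" and v: "v < h" for v k \<omega>
  proof -
    note gp = good_path_chain[OF \<omega>]
    interpret st: consensus_step N h E \<beta> \<gamma> Mb "\<tau> k" "m (t0 + 1 + k) \<omega>" "Yw k \<omega>" "Yw (Suc k) \<omega>" "Zw k \<omega>" "Zw (Suc k) \<omega>"
      "\<lambda>i j. Fcdf \<sigma> (c i j - Zw k \<omega> i j) - sbit (\<lambda>t. m t \<omega>) (dn \<omega>) k i j"
      unfolding Yw_def Zw_def by (rule step[OF gp])
    have "st.A \<le> r" "\<beta> \<le> r" using \<beta> \<gamma> Mb by (auto simp: st.A_def r_def)
    then have le: "st.A / \<tau> k \<le> r / \<tau> k" "\<beta> / \<tau> k \<le> r / \<tau> k"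
      using \<tau>_pos(1)[of k] by (auto intro!: divide_right_mono)
    have "\<bar>D v (Suc k) \<omega> - D v k \<omega>\<bar> \<le> real N * (real N * ((8 * \<gamma> * Mb + 16 * \<rho> * Mb) * (r / \<tau> k)))"
      unfolding D_def
      by (rule sw_drift_lipschitz[OF valid v])
        (use \<gamma> \<rho> Mb r0 \<tau>_pos(1)[of k] st.yb st.zb st.y'_bound st.z'_bound
          order_trans[OF st.y'_diff le(1)] order_trans[OF st.z'_diff le(2)] in auto)
    then show ?thesis by (simp add: LD_def)
  qed
  obtain C where C: "C \<ge> 0" "\<And>ms Dn k. good_path ms \<Longrightarrow>
    lyap N h E w (Y ms Dn (Suc k)) (Z ms Dn (Suc k)) \<le> (1 - \<kappa> / \<tau> k) * lyap N h E w (Y ms Dn k) (Z ms Dn k)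
      - (sw_drift N E \<gamma> \<rho> (ms (t0 + 1 + k)) (Y ms Dn k) (Z ms Dn k)
         - (\<Sum>v<h. \<pi> v * sw_drift N E \<gamma> \<rho> v (Y ms Dn k) (Z ms Dn k))) / \<tau> k
      + 2 * w * \<beta> * noise_sum ms Dn k / \<tau> k + C / (\<tau> k)\<^sup>2"
    using lyapunov_decrease[OF w \<kappa>1 \<kappa>2] unfolding \<rho>_def by blast
  define C' where "C' = C + real h * (KP * LD)"
  have LD0: "LD \<ge> 0" using \<gamma> \<rho> Mb r0 by (simp add: LD_def)
  have C'0: "C' \<ge> 0" using C(1) KP(1) LD0 by (simp add: C'_def)
  \<comment> \<open>The telescoping quantity: the fluctuation of the drift at index \<open>k\<close>
    has expectation \<open>Q k - Q (Suc k)\<close> up to \<open>O(1/\<tau>)\<close>.\<close>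
  define Q where "Q = (\<lambda>k. \<Sum>v<h. \<integral>\<omega>. G v (m (t0 + 1 + k) \<omega>) * D v k \<omega> \<partial>M)"
  have intG: "integrable M (\<lambda>\<omega>. F (m t \<omega>) * D v k \<omega>)" if "v < h" for F t v k
    unfolding D_def by (rule admissible_integrable[OF adD[OF that]])
  have Qb: "\<bar>Q k\<bar> \<le> real h * (KG * BD)" for k
    unfolding Q_def
  proof (rule sum_agents_abs_le)
    fix v assume v: "v < h"
    have "\<bar>G v (m (t0 + 1 + k) \<omega>) * D v k \<omega>\<bar> \<le> KG * BD" if "\<omega> \<in> space M" for \<omega>
      unfolding abs_mult using KG BD m_less that v by (intro mult_mono) auto
    then have "(\<integral>\<omega>. \<bar>G v (m (t0 + 1 + k) \<omega>) * D v k \<omega>\<bar> \<partial>M) \<le> (\<integral>\<omega>. KG * BD \<partial>M)"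
      using intG[OF v] by (intro integral_mono) auto
    then show "\<bar>\<integral>\<omega>. G v (m (t0 + 1 + k) \<omega>) * D v k \<omega> \<partial>M\<bar> \<le> KG * BD"
      by (intro order_trans[OF integral_abs_bound]) (simp add: prob_space)
  qed
  have rec: "L (Suc k) \<le> (1 - \<kappa> / \<tau> k) * L k - (Q k - Q (Suc k)) / \<tau> k + C' / (\<tau> k)\<^sup>2" for k
  proof -
    let ?m = "\<lambda>\<omega>. m (t0 + 1 + k) \<omega>"
    let ?l = "\<lambda>k \<omega>. lyap N h E w (Yw k \<omega>) (Zw k \<omega>)"
    let ?n = "\<lambda>\<omega>. noise_sum (\<lambda>t. m t \<omega>) (dn \<omega>) k"
    let ?g = "\<lambda>\<omega>. \<Sum>v<h. G v (?m \<omega>) * D v k \<omega>" and ?p = "\<lambda>\<omega>. \<Sum>v<h. PG v (?m \<omega>) * D v (Suc k) \<omega>"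
    have ptw: "?l (Suc k) \<omega> \<le> (1 - \<kappa> / \<tau> k) * ?l k \<omega> - (?g \<omega> - ?p \<omega>) / \<tau> k + 2 * w * \<beta> / \<tau> k * ?n \<omega> + C' / (\<tau> k)\<^sup>2"
      if \<omega>: "\<omega> \<in> space M" for \<omega>
    proof -
      have mh: "?m \<omega> < h" by (rule m_less[OF \<omega>])
      have "D (?m \<omega>) k \<omega> - (\<Sum>v<h. \<pi> v * D v k \<omega>) = (\<Sum>v<h. (if v = ?m \<omega> then D v k \<omega> else 0) - \<pi> v * D v k \<omega>)"
        using mh by (simp add: sum_subtractf)
      also have "\<dots> = (\<Sum>v<h. ((if ?m \<omega> = v then 1 else 0) - \<pi> v) * D v k \<omega>)"
        by (intro sum.cong) (auto simp: left_diff_distrib)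
      also have "\<dots> = (\<Sum>v<h. (G v (?m \<omega>) - PG v (?m \<omega>)) * D v k \<omega>)"
        using poisson[OF mh] by (intro sum.cong) auto
      also have "\<dots> = ?g \<omega> - ?p \<omega> + (\<Sum>v<h. PG v (?m \<omega>) * (D v (Suc k) \<omega> - D v k \<omega>))"
        by (simp add: sum_subtractf[symmetric] sum.distrib[symmetric] algebra_simps)
      finally have eq: "D (?m \<omega>) k \<omega> - (\<Sum>v<h. \<pi> v * D v k \<omega>)
         = ?g \<omega> - ?p \<omega> + (\<Sum>v<h. PG v (?m \<omega>) * (D v (Suc k) \<omega> - D v k \<omega>))" .
      have "\<bar>\<Sum>v<h. PG v (?m \<omega>) * (D v (Suc k) \<omega> - D v k \<omega>)\<bar> \<le> real h * (KP * (LD / \<tau> k))"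
      proof (rule sum_agents_abs_le)
        fix v assume v: "v < h"
        show "\<bar>PG v (?m \<omega>) * (D v (Suc k) \<omega> - D v k \<omega>)\<bar> \<le> KP * (LD / \<tau> k)"
          unfolding abs_mult using KP(1) KP(2)[OF v mh] LD[OF \<omega> v] by (intro mult_mono) auto
      qed
      with eq have "?g \<omega> - ?p \<omega> - real h * (KP * (LD / \<tau> k)) \<le> D (?m \<omega>) k \<omega> - (\<Sum>v<h. \<pi> v * D v k \<omega>)"
        by linarith
      then have "(?g \<omega> - ?p \<omega> - real h * (KP * (LD / \<tau> k))) / \<tau> k \<le> (D (?m \<omega>) k \<omega> - (\<Sum>v<h. \<pi> v * D v k \<omega>)) / \<tau> k"
        using \<tau>_pos(1)[of k] by (intro divide_right_mono) auto
      also have "(?g \<omega> - ?p \<omega> - real h * (KP * (LD / \<tau> k))) / \<tau> k = (?g \<omega> - ?p \<omega>) / \<tau> k - real h * (KP * LD) / (\<tau> k)\<^sup>2"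
        by (simp add: diff_divide_distrib power2_eq_square)
      finally have "(?g \<omega> - ?p \<omega>) / \<tau> k - real h * (KP * LD) / (\<tau> k)\<^sup>2 \<le> (D (?m \<omega>) k \<omega> - (\<Sum>v<h. \<pi> v * D v k \<omega>)) / \<tau> k" .
      moreover have "?l (Suc k) \<omega> \<le> (1 - \<kappa> / \<tau> k) * ?l k \<omega>
         - (D (?m \<omega>) k \<omega> - (\<Sum>v<h. \<pi> v * D v k \<omega>)) / \<tau> k + 2 * w * \<beta> * ?n \<omega> / \<tau> k + C / (\<tau> k)\<^sup>2"
        using C(2)[OF good_path_chain[OF \<omega>], of "dn \<omega>" k] unfolding D_def Yw_def Zw_def by simp
      moreover have "C' / (\<tau> k)\<^sup>2 = C / (\<tau> k)\<^sup>2 + real h * (KP * LD) / (\<tau> k)\<^sup>2" by (simp add: C'_def add_divide_distrib)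
      moreover have "2 * w * \<beta> * ?n \<omega> / \<tau> k = 2 * w * \<beta> / \<tau> k * ?n \<omega>" by simp
      ultimately show ?thesis by linarith
    qed
    have il: "integrable M (?l k)" for k using admissible_integrable[OF adL, of "\<lambda>_. 1" 0 k] by simp
    have ig: "integrable M ?g" and ip: "integrable M ?p" using intG by (auto intro!: Bochner_Integration.integrable_sum)
    have inn: "integrable M ?n"
      using noise_sum_properties(1) noise_sum_bound[OF good_path_chain]
      by (intro integrable_const_bound[where B="real N * (real N * (2 * Mb))"]) auto
    have "L (Suc k) \<le> (\<integral>\<omega>. (1 - \<kappa> / \<tau> k) * ?l k \<omega> - (?g \<omega> - ?p \<omega>) / \<tau> k + 2 * w * \<beta> / \<tau> k * ?n \<omega> + C' / (\<tau> k)\<^sup>2 \<partial>M)"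
      unfolding L_def by (intro integral_mono il ptw) (use il ig ip inn in auto)
    also have "\<dots> = (1 - \<kappa> / \<tau> k) * L k - ((\<integral>\<omega>. ?g \<omega> \<partial>M) - (\<integral>\<omega>. ?p \<omega> \<partial>M)) / \<tau> k + 2 * w * \<beta> / \<tau> k * (\<integral>\<omega>. ?n \<omega> \<partial>M) + C' / (\<tau> k)\<^sup>2"
      unfolding L_def using il[of k] ig ip inn prob_space by simp
    also have "(\<integral>\<omega>. ?n \<omega> \<partial>M) = 0" by (rule noise_sum_properties(2))
    also have "(\<integral>\<omega>. ?g \<omega> \<partial>M) = Q k" unfolding Q_def using intG by (intro Bochner_Integration.integral_sum) auto
    \<comment> \<open>The chain value at \<open>t0 + 1 + k\<close> is the last one on which the
      state of index \<open>Suc k\<close> depends, so the Markov property applies exactly at this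
      time.\<close>
    also have "(\<integral>\<omega>. ?p \<omega> \<partial>M) = Q (Suc k)"
    proof -
      have "(\<integral>\<omega>. ?p \<omega> \<partial>M) = (\<Sum>v<h. \<integral>\<omega>. PG v (?m \<omega>) * D v (Suc k) \<omega> \<partial>M)"
        using intG by (intro Bochner_Integration.integral_sum) auto
      also have "\<dots> = Q (Suc k)" unfolding Q_def
      proof (rule sum.cong[OF refl])
        fix v assume "v \<in> {..<h}"
        then show "(\<integral>\<omega>. PG v (?m \<omega>) * D v (Suc k) \<omega> \<partial>M) = (\<integral>\<omega>. G v (m (t0 + 1 + Suc k) \<omega>) * D v (Suc k) \<omega> \<partial>M)"
          using admissible_markov[OF adD, of v "G v" "Suc k"] by (simp add: D_def PG_def)
      qed
      finally show ?thesis .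
    qed
    finally show ?thesis by simp
  qed
  show ?thesis using C'0 Qb rec by blast
qed

lemma lyapunov_rate:
  assumes w: "w \<ge> 0"
    and \<kappa>1: "\<kappa> \<le> \<gamma> * l2 - w * (\<gamma> * (lG / l2))"
    and \<kappa>2: "\<kappa> * w \<le> w * (2 * \<beta> * fM * pm - \<gamma> * alpha_const N h E \<pi>) - \<gamma> * (lG / l2)"
    and q: "0 < q" "q \<le> 1" "q < \<kappa>"
  shows "\<exists>D\<ge>0. \<forall>k. (\<integral>\<omega>. lyap N h E w (Yw k \<omega>) (Zw k \<omega>) \<partial>M) \<le> D * \<tau> k powr (- q)"
proof -
  define L where "L = (\<lambda>k. \<integral>\<omega>. lyap N h E w (Yw k \<omega>) (Zw k \<omega>) \<partial>M)"
  obtain Q K C where C: "C \<ge> 0" and Q: "\<And>k. \<bar>Q k\<bar> \<le> K"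
    and rec: "\<And>k. L (Suc k) \<le> (1 - \<kappa> / \<tau> k) * L k - (Q k - Q (Suc k)) / \<tau> k + C / (\<tau> k)\<^sup>2"
    using expectation_recursion[OF w \<kappa>1 \<kappa>2] unfolding L_def by blast
  have K: "K \<ge> 0" using Q[of 0] by linarith
  have \<kappa>: "\<kappa> > 0" using q by simp
  \<comment> \<open>Subtracting \<open>Q k / \<tau> k\<close> cancels the telescoping term; what
    remains comes from \<open>1/\<tau> k - 1/\<tau> (k + 1)\<close> and from the contraction factor
    acting on \<open>Q k / \<tau> k\<close>, both \<open>O(1/\<tau>^2)\<close>.\<close>
  define T where "T = (\<lambda>k. L k - Q k / \<tau> k)"
  define C' where "C' = C + K + \<kappa> * K"
  have Trec: "T (Suc k) \<le> (1 - \<kappa> / \<tau> k) * T k + C' / (\<tau> k)\<^sup>2" for k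
  proof -
    define t where "t = \<tau> k"
    have t: "t > 0" "\<tau> (Suc k) = t + 1" using \<tau>_pos by (auto simp: t_def)
    have "Q (Suc k) * (1 / (t * (t + 1))) \<le> K * (1 / t\<^sup>2)"
      using Q[of "Suc k"] K t by (intro mult_mono) (auto simp: power2_eq_square frac_le)
    then have 1: "Q (Suc k) / t - Q (Suc k) / (t + 1) \<le> K / t\<^sup>2" using t by (simp add: field_simps)
    have "- Q k * (\<kappa> / t\<^sup>2) \<le> K * (\<kappa> / t\<^sup>2)"
      using Q[of k] \<kappa> by (intro mult_right_mono) auto
    then have 2: "- (\<kappa> / t * (Q k / t)) \<le> \<kappa> * K / t\<^sup>2" by (simp add: power2_eq_square mult_ac)
    have "T (Suc k) \<le> (1 - \<kappa> / t) * L k - (Q k - Q (Suc k)) / t + C / t\<^sup>2 - Q (Suc k) / (t + 1)"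
      using rec[of k] t by (simp add: T_def t_def)
    also have "\<dots> = (1 - \<kappa> / t) * T k + (Q (Suc k) / t - Q (Suc k) / (t + 1)) + (- (\<kappa> / t * (Q k / t))) + C / t\<^sup>2"
      by (simp add: T_def t_def algebra_simps diff_divide_distrib)
    also have "\<dots> \<le> (1 - \<kappa> / t) * T k + K / t\<^sup>2 + \<kappa> * K / t\<^sup>2 + C / t\<^sup>2" using 1 2 by simp
    also have "\<dots> = (1 - \<kappa> / t) * T k + C' / t\<^sup>2" by (simp add: C'_def add_divide_distrib)
    finally show ?thesis by (simp add: t_def)
  qed
  have adL: "admissible (lyap N h E w)" by (rule admissible_lyap[OF w])
  obtain B where B: "\<And>k \<omega>. \<omega> \<in> space M \<Longrightarrow> \<bar>lyap N h E w (Yw k \<omega>) (Zw k \<omega>)\<bar> \<le> B"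
    using admissible_bounded[OF adL] by blast
  have QK: "\<bar>Q k / \<tau> k\<bar> \<le> K / \<tau> k" for k
    using Q[of k] \<tau>_pos(1)[of k] by (simp add: divide_right_mono)
  have "K / \<tau> k \<le> K" for k using K \<tau>_pos[of k] divide_left_mono[of 1 "\<tau> k" K] by simp
  then have QK1: "\<bar>Q k / \<tau> k\<bar> \<le> K" for k by (rule order_trans[OF QK])
  have "T k \<le> B + K" for k
  proof -
    have "L k \<le> (\<integral>\<omega>. B \<partial>M)" unfolding L_def
      using admissible_integrable[OF adL, of "\<lambda>_. 1" 0 k] B by (intro integral_mono) (auto simp: abs_le_iff)
    then have "L k \<le> B" using prob_space by simp
    then show ?thesis unfolding T_def using QK1[of k] by linarith
  qed
  then obtain D where D: "D \<ge> 0" "\<And>k. T k \<le> D * \<tau> k powr (- q)"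
    using perturbed_recursion_rate[of q \<kappa> C' T t0 "B + K"] q Trec C K \<kappa>
    unfolding \<tau>_def C'_def by auto
  have "L k \<le> (D + K) * \<tau> k powr (- q)" for k
  proof -
    \<comment> \<open>Returning from \<open>T\<close> to \<open>L\<close> costs a term of order
      \<open>1/\<tau>\<close>, which \<open>q \<le> 1\<close> makes harmless.\<close>
    have "1 / \<tau> k = \<tau> k powr (- 1)" using \<tau>_pos[of k] by (simp add: powr_minus_divide)
    also have "\<dots> \<le> \<tau> k powr (- q)" using q \<tau>_pos[of k] by (intro powr_mono) auto
    finally have "K * (1 / \<tau> k) \<le> K * \<tau> k powr (- q)" using K by (intro mult_left_mono)
    then have "Q k / \<tau> k \<le> K * \<tau> k powr (- q)" using abs_le_D1[OF QK[of k]] by simp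
    then show ?thesis using D(2)[of k] by (simp add: T_def distrib_right)
  qed
  then show ?thesis unfolding L_def using D(1) K by (intro exI[of _ "D + K"]) auto
qed

lemma consensus_rate:
  assumes w: "w > 0"
    and \<kappa>1: "\<kappa> \<le> \<gamma> * l2 - w * (\<gamma> * (lG / l2))"
    and \<kappa>2: "\<kappa> * w \<le> w * (2 * \<beta> * fM * pm - \<gamma> * alpha_const N h E \<pi>) - \<gamma> * (lG / l2)"
    and q: "0 < q" "q \<le> 1" "q < \<kappa>"
  shows "\<exists>D\<ge>0. \<forall>k. \<forall>i<N. (\<integral>\<omega>. (Yw k \<omega> i - avg N (Yw k \<omega>))\<^sup>2 \<partial>M) \<le> D * \<tau> k powr (- q) \<and>
    (\<forall>j\<in>nbrU h E i. (\<integral>\<omega>. (Zw (Suc k) \<omega> i j - Yw k \<omega> j)\<^sup>2 \<partial>M) \<le> D * \<tau> k powr (- q))"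
proof -
  let ?l = "\<lambda>k \<omega>. lyap N h E w (Yw k \<omega>) (Zw k \<omega>)"
  obtain D where D: "D \<ge> 0" "\<And>k. (\<integral>\<omega>. ?l k \<omega> \<partial>M) \<le> D * \<tau> k powr (- q)"
    using lyapunov_rate[OF less_imp_le[OF w] \<kappa>1 \<kappa>2 q] by blast
  have il: "integrable M (?l k)" for k
    using admissible_integrable[OF admissible_lyap[OF less_imp_le[OF w]], of "\<lambda>_. 1" 0 k] by simp
  define A where "A = 2 * \<gamma> * real N * Mb"
  define D' where "D' = D + 2 / w * D + 2 * A\<^sup>2"
  have D': "D \<le> D'" "2 / w * D + 2 * A\<^sup>2 \<le> D'" using D(1) w by (auto simp: D'_def)
  have est0: "0 \<le> est_error N h E y z" "0 \<le> disagreement N y" for y z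
    by (auto simp: est_error_def disagreement_def intro!: sum_nonneg)
  have lyap0: "0 \<le> lyap N h E w y z" for y z using est0 w by (simp add: lyap_def)
  have 1: "(\<integral>\<omega>. (Yw k \<omega> i - avg N (Yw k \<omega>))\<^sup>2 \<partial>M) \<le> D' * \<tau> k powr (- q)" if i: "i < N" for i k
  proof -
    have "(y i - avg N y)\<^sup>2 \<le> lyap N h E w y z" for y z
    proof -
      have "(y i - avg N y)\<^sup>2 \<le> disagreement N y" unfolding disagreement_def using i by (intro member_le_sum) auto
      also have "\<dots> \<le> lyap N h E w y z" using est0(1)[of y z] w by (simp add: lyap_def)
      finally show ?thesis .
    qed
    then have "(\<integral>\<omega>. (Yw k \<omega> i - avg N (Yw k \<omega>))\<^sup>2 \<partial>M) \<le> (\<integral>\<omega>. ?l k \<omega> \<partial>M)"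
      using il[of k] est0 w by (intro integral_mono') (auto simp: lyap_def)
    also have "\<dots> \<le> D * \<tau> k powr (- q)" by (rule D(2))
    also have "\<dots> \<le> D' * \<tau> k powr (- q)" using D' by (intro mult_right_mono) auto
    finally show ?thesis .
  qed
  have 2: "(\<integral>\<omega>. (Zw (Suc k) \<omega> i j - Yw k \<omega> j)\<^sup>2 \<partial>M) \<le> D' * \<tau> k powr (- q)"
    if i: "i < N" and j: "j \<in> nbrU h E i" for i j k
  proof -
    \<comment> \<open>The Lyapunov function at index \<open>Suc k\<close> compares this estimate
      with the output one time unit later. That output has moved by at most
      \<open>A / \<tau> k\<close>, which adds \<open>O(1/\<tau>^2)\<close> after squaring.\<close>
    have ptw: "(Zw (Suc k) \<omega> i j - Yw k \<omega> j)\<^sup>2 \<le> 2 / w * ?l (Suc k) \<omega> + 2 * A\<^sup>2 / (\<tau> k)\<^sup>2" if \<omega>: "\<omega> \<in> space M" for \<omega>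
    proof -
      interpret st: consensus_step N h E \<beta> \<gamma> Mb "\<tau> k" "m (t0 + 1 + k) \<omega>" "Yw k \<omega>" "Yw (Suc k) \<omega>" "Zw k \<omega>" "Zw (Suc k) \<omega>"
        "\<lambda>i j. Fcdf \<sigma> (c i j - Zw k \<omega> i j) - sbit (\<lambda>t. m t \<omega>) (dn \<omega>) k i j"
        unfolding Yw_def Zw_def by (rule step[OF good_path_chain[OF \<omega>]])
      define e \<eta> where "e = Yw (Suc k) \<omega> j - Yw k \<omega> j" and "\<eta> = Zw (Suc k) \<omega> i j - Yw (Suc k) \<omega> j"
      have "0 \<le> (\<eta> - e)\<^sup>2" by simp
      then have "(\<eta> + e)\<^sup>2 \<le> 2 * \<eta>\<^sup>2 + 2 * e\<^sup>2" by (simp add: power2_sum power2_diff)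
      moreover have "Zw (Suc k) \<omega> i j - Yw k \<omega> j = \<eta> + e" by (simp add: \<eta>_def e_def)
      moreover have "e\<^sup>2 \<le> A\<^sup>2 / (\<tau> k)\<^sup>2" using st.y'_sq[OF nbrU_less[OF j]] by (simp add: e_def A_def st.A_def)
      moreover have "\<eta>\<^sup>2 \<le> 1 / w * ?l (Suc k) \<omega>"
      proof -
        have "\<eta>\<^sup>2 \<le> (\<Sum>j\<in>nbrU h E i. (Zw (Suc k) \<omega> i j - Yw (Suc k) \<omega> j)\<^sup>2)"
          unfolding \<eta>_def using j nbrU_subset[OF valid] by (intro member_le_sum) auto
        also have "\<dots> \<le> est_error N h E (Yw (Suc k) \<omega>) (Zw (Suc k) \<omega>)"
          unfolding est_error_def using i by (intro member_le_sum sum_nonneg) auto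
        finally have "w * \<eta>\<^sup>2 \<le> w * est_error N h E (Yw (Suc k) \<omega>) (Zw (Suc k) \<omega>)"
          using w by (intro mult_left_mono) auto
        then have "w * \<eta>\<^sup>2 \<le> ?l (Suc k) \<omega>" unfolding lyap_def
          using est0(2)[of "Yw (Suc k) \<omega>"] by linarith
        then show ?thesis using w by (simp add: field_simps)
      qed
      ultimately show ?thesis by simp
    qed
    have "(\<integral>\<omega>. (Zw (Suc k) \<omega> i j - Yw k \<omega> j)\<^sup>2 \<partial>M) \<le> (\<integral>\<omega>. 2 / w * ?l (Suc k) \<omega> + 2 * A\<^sup>2 / (\<tau> k)\<^sup>2 \<partial>M)"
      using il[of "Suc k"] lyap0 w ptw by (intro integral_mono') auto
    also have "\<dots> = 2 / w * (\<integral>\<omega>. ?l (Suc k) \<omega> \<partial>M) + 2 * A\<^sup>2 / (\<tau> k)\<^sup>2"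
      using il[of "Suc k"] prob_space by simp
    also have "\<dots> \<le> 2 / w * (D * \<tau> k powr (- q)) + 2 * A\<^sup>2 * \<tau> k powr (- q)"
    proof (rule add_mono)
      have "\<tau> (Suc k) powr (- q) \<le> \<tau> k powr (- q)" using q \<tau>_pos[of k] by (intro powr_mono2') auto
      then have "D * \<tau> (Suc k) powr (- q) \<le> D * \<tau> k powr (- q)" using D(1) by (rule mult_left_mono)
      then have "(\<integral>\<omega>. ?l (Suc k) \<omega> \<partial>M) \<le> D * \<tau> k powr (- q)" using D(2)[of "Suc k"] by linarith
      then show "2 / w * (\<integral>\<omega>. ?l (Suc k) \<omega> \<partial>M) \<le> 2 / w * (D * \<tau> k powr (- q))" using w by (intro mult_left_mono) auto
      have "1 / (\<tau> k)\<^sup>2 = \<tau> k powr (- 2)" using \<tau>_pos[of k] by (simp add: powr_minus_divide)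
      also have "\<dots> \<le> \<tau> k powr (- q)" using q \<tau>_pos[of k] by (intro powr_mono) auto
      finally have "2 * A\<^sup>2 * (1 / (\<tau> k)\<^sup>2) \<le> 2 * A\<^sup>2 * \<tau> k powr (- q)" by (intro mult_left_mono) auto
      then show "2 * A\<^sup>2 / (\<tau> k)\<^sup>2 \<le> 2 * A\<^sup>2 * \<tau> k powr (- q)" by simp
    qed
    also have "\<dots> = (2 / w * D + 2 * A\<^sup>2) * \<tau> k powr (- q)" by (simp add: algebra_simps)
    also have "\<dots> \<le> D' * \<tau> k powr (- q)" using D' by (intro mult_right_mono) auto
    finally show ?thesis .
  qed
  show ?thesis using 1 2 D D' by (intro exI[of _ D']) auto
qed

end

section \<open>Reduction of the vector dynamics\<close>

text \<open>Entry by entry \<open>K1\<close> is \<open>K2 - K2 A\<close>: the last row of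
  \<open>A\<close> contributes the coefficients \<open>a\<close>, and its superdiagonal shifts the
  coefficients \<open>b\<close> by one place.\<close>

lemma K2_invariance:
  assumes n: "n \<ge> 2" and x: "x \<in> carrier_vec n"
  shows "scalar_prod (K2v n b) (Amat n a *\<^sub>v x) + scalar_prod (K1v n a b) x = scalar_prod (K2v n b) x"
proof -
  obtain p where p: "n = Suc p" "p \<ge> 1" using n by (cases n) auto
  have A: "Amat n a \<in> carrier_mat n n" by (simp add: Amat_def)
  have Ax: "vec_index (Amat n a *\<^sub>v x) r = (if r < p then vec_index x (Suc r) else (\<Sum>k<n. a k * vec_index x k))"
    if r: "r < n" for r
  proof (cases "r < p")
    case True
    have "vec_index (Amat n a *\<^sub>v x) r = (\<Sum>k<n. if k = Suc r then vec_index x k else 0)"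
      unfolding index_mult_mat_vec_sum[OF A x r]
      using True p r by (intro sum.cong) (auto simp: Amat_def)
    then show ?thesis using True p by (simp del: sum.lessThan_Suc)
  next
    case False
    have "vec_index (Amat n a *\<^sub>v x) r = (\<Sum>k<n. a k * vec_index x k)"
      unfolding index_mult_mat_vec_sum[OF A x r]
      using False p r by (intro sum.cong) (auto simp: Amat_def)
    then show ?thesis using False by simp
  qed
  have "scalar_prod (K2v n b) (Amat n a *\<^sub>v x) = (\<Sum>r<n. vec_index (K2v n b) r * vec_index (Amat n a *\<^sub>v x) r)"
    using A x by (intro scalar_prod_sum) auto
  also have "\<dots> = (\<Sum>r<p. b r * vec_index x (Suc r)) + (\<Sum>k<n. a k * vec_index x k)"
    using Ax p by (simp add: K2v_def)
  finally have 1: "scalar_prod (K2v n b) (Amat n a *\<^sub>v x)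
     = (\<Sum>r<p. b r * vec_index x (Suc r)) + (\<Sum>k<n. a k * vec_index x k)" .
  have "vec_index (K1v n a b) k = - a k + vec_index (K2v n b) k - (if k = 0 then 0 else b (k - 1))" if "k < n" for k
    using that p by (cases "k = p") (auto simp: K1v_def K2v_def)
  then have "scalar_prod (K1v n a b) x
     = (\<Sum>k<n. (- a k + vec_index (K2v n b) k - (if k = 0 then 0 else b (k - 1))) * vec_index x k)"
    unfolding scalar_prod_sum[OF x] by (intro sum.cong) auto
  also have "\<dots> = - (\<Sum>k<n. a k * vec_index x k) + scalar_prod (K2v n b) x
      - (\<Sum>k<n. (if k = 0 then 0 else b (k - 1)) * vec_index x k)"
    unfolding scalar_prod_sum[OF x]
    by (simp add: left_diff_distrib distrib_right sum_subtractf sum.distrib sum_negf del: sum.lessThan_Suc)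
  also have "(\<Sum>k<n. (if k = 0 then 0 else b (k - 1)) * vec_index x k) = (\<Sum>r<p. b r * vec_index x (Suc r))"
    unfolding p(1) sum.lessThan_Suc_shift by simp
  finally show ?thesis using 1 by simp
qed

lemma K2_step:
  assumes n: "n \<ge> 2" and x: "x \<in> carrier_vec n"
  shows "scalar_prod (K2v n b) (Amat n a *\<^sub>v x + (scalar_prod (K1v n a b) x + v) \<cdot>\<^sub>v Bvec n)
    = scalar_prod (K2v n b) x + v"
proof -
  have c: "K2v n b \<in> carrier_vec n" "Amat n a *\<^sub>v x \<in> carrier_vec n" "Bvec n \<in> carrier_vec n"
    using x mult_mat_vec_carrier[of "Amat n a" n n x] by (auto simp: K2v_def Amat_def Bvec_def)
  have "scalar_prod (K2v n b) (Bvec n) = 1"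
    using n c(1) unfolding Bvec_def by (subst scalar_prod_right_unit) (auto simp: K2v_def)
  moreover have "scalar_prod (K2v n b) (Amat n a *\<^sub>v x + (scalar_prod (K1v n a b) x + v) \<cdot>\<^sub>v Bvec n)
    = scalar_prod (K2v n b) (Amat n a *\<^sub>v x) + (scalar_prod (K1v n a b) x + v) * scalar_prod (K2v n b) (Bvec n)"
    using c by (simp add: scalar_prod_add_distrib[of _ n])
  ultimately show ?thesis using K2_invariance[OF n x, of b a] by simp
qed

lemma scalar_prod_xbar:
  assumes "\<And>i. i < N \<Longrightarrow> x i \<in> carrier_vec n"
  shows "scalar_prod (K2v n b) (xbar n N x) = avg N (\<lambda>i. scalar_prod (K2v n b) (x i))"
proof -
  have "scalar_prod (K2v n b) (xbar n N x)
     = (\<Sum>k<n. vec_index (K2v n b) k * ((1 / real N) * (\<Sum>i<N. vec_index (x i) k)))"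
    by (subst scalar_prod_sum[of _ n]) (auto simp: xbar_def)
  also have "\<dots> = (1 / real N) * (\<Sum>k<n. \<Sum>i<N. vec_index (K2v n b) k * vec_index (x i) k)"
    by (simp add: sum_distrib_left mult_ac)
  also have "\<dots> = (1 / real N) * (\<Sum>i<N. scalar_prod (K2v n b) (x i))"
    by (subst sum.swap) (simp add: scalar_prod_sum[OF assms])
  finally show ?thesis by (simp add: avg_def)
qed

lemma traj_carrier:
  assumes "\<And>i. i < N \<Longrightarrow> x0 i \<in> carrier_vec n" "i < N"
  shows "fst (traj n a b E c \<sigma> \<beta> \<gamma> t0 Mb x0 z0 ms dp k) i \<in> carrier_vec n"
proof (induction k)
  case 0
  then show ?case using assms by simp
next
  case (Suc k)
  have "Amat n a \<in> carrier_mat n n" "Bvec n \<in> carrier_vec n" by (auto simp: Amat_def Bvec_def)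
  then show ?case using Suc by (simp add: Let_def)
qed

theorem theorem3:
  fixes M :: "'w measure"
    and n N h t0 :: nat
    and a b :: "nat \<Rightarrow> real"
    and E :: "nat \<Rightarrow> nat set set"
    and P :: "real mat" and \<pi> :: "nat \<Rightarrow> real"
    and m :: "nat \<Rightarrow> 'w \<Rightarrow> nat"
    and d :: "nat \<Rightarrow> nat \<Rightarrow> nat \<Rightarrow> 'w \<Rightarrow> real"
    and c :: "nat \<Rightarrow> nat \<Rightarrow> real"
    and \<sigma> \<beta> \<gamma> Mb :: real
    and x0 :: "nat \<Rightarrow> real vec" and z0 :: "nat \<Rightarrow> nat \<Rightarrow> real"
  defines "x \<equiv> (\<lambda>\<omega>. xstate n a b E c \<sigma> \<beta> \<gamma> t0 Mb x0 z0 (\<lambda>t. m t \<omega>) (\<lambda>i j t. d i j t \<omega>))"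
    and "z \<equiv> (\<lambda>\<omega>. zstate n a b E c \<sigma> \<beta> \<gamma> t0 Mb x0 z0 (\<lambda>t. m t \<omega>) (\<lambda>i j t. d i j t \<omega>))"
    and "K2 \<equiv> K2v n b"
    and "lam2 \<equiv> lambda2 N h E \<pi>"
    and "lamG \<equiv> lambdaG N h E"
    and "\<alpha> \<equiv> alpha_const N h E \<pi>"
    and "fM \<equiv> fM_const N h E c \<sigma> Mb"
    and "pimin \<equiv> Min (\<pi> ` {..<h})"
  assumes "n \<ge> 2" and "N \<ge> 2"
    and "valid_graphs N h E" and "union_connected N h E"
    and "prob_space M"
    and "stochastic_mat h P" and "irreducible_mat h P" and "aperiodic_mat h P"
    and "stationary_dist h P \<pi>"
    and "markov_chain M h P m"
    and "\<sigma> > 0"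
    and "\<And>i j t. (i, j) \<in> pairs N h E \<Longrightarrow>
           distributed M lborel (d i j t) (\<lambda>y. ennreal (normal_density 0 \<sigma> y))"
    and "prob_space.indep_vars M (\<lambda>_. borel) (\<lambda>((i, j), t). d i j t) (pairs N h E \<times> UNIV)"
    and "prob_space.indep_set M
           (sigma_sets (space M) (\<Union>t. {m t -` A \<inter> space M | A. A \<in> sets (count_space UNIV)}))
           (sigma_sets (space M) (\<Union>((i, j), t)\<in>pairs N h E \<times> UNIV.
                                     {d i j t -` A \<inter> space M | A. A \<in> sets borel}))"
    and "\<beta> > 0" and "\<gamma> > 0"
    and "real t0 > \<gamma> * real (dmax N h E) - 1"
    and "Mb > 0"
    and "\<And>i. i < N \<Longrightarrow> x0 i \<in> carrier_vec n"
    and "\<And>i. i < N \<Longrightarrow> \<bar>scalar_prod K2 (x0 i)\<bar> \<le> Mb"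
    and "\<And>i j. (i, j) \<in> pairs N h E \<Longrightarrow> \<bar>z0 i j\<bar> \<le> Mb"
  shows
    "(\<beta> > 1 / (2 * fM * pimin) * (\<gamma> * lamG\<^sup>2 / lam2 ^ 3 + \<gamma> * \<alpha>) \<longrightarrow>
      (\<forall>i<N. \<forall>j\<in>nbrU h E i.
         (\<lambda>t. integral\<^sup>L M (\<lambda>\<omega>. (scalar_prod K2 (x \<omega> t i)
                 - scalar_prod K2 (xbar n N (x \<omega> t)))\<^sup>2)) \<longlonglongrightarrow> 0
       \<and> (\<lambda>t. integral\<^sup>L M (\<lambda>\<omega>. (z \<omega> t i j - scalar_prod K2 (x \<omega> t j))\<^sup>2)) \<longlonglongrightarrow> 0))
   \<and> (\<gamma> > 1 / lam2 \<and>
      \<beta> > 1 / (2 * fM * pimin) *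
            (\<gamma>\<^sup>2 * lamG\<^sup>2 / (lam2\<^sup>2 * (\<gamma> * lam2 - 1)) + \<gamma> * \<alpha> + 1) \<longrightarrow>
      (\<exists>C>0. \<forall>i<N. \<forall>j\<in>nbrU h E i. \<forall>t\<ge>t0 + 1.
         integral\<^sup>L M (\<lambda>\<omega>. (scalar_prod K2 (x \<omega> t i)
                 - scalar_prod K2 (xbar n N (x \<omega> t)))\<^sup>2) \<le> C / real t
       \<and> integral\<^sup>L M (\<lambda>\<omega>. (z \<omega> t i j - scalar_prod K2 (x \<omega> t j))\<^sup>2) \<le> C / real t))"
proof -
  define Y where "Y = (\<lambda>ms dp k i. scalar_prod (K2v n b) (fst (traj n a b E c \<sigma> \<beta> \<gamma> t0 Mb x0 z0 ms dp k) i))"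
  define Z where "Z = (\<lambda>ms dp k i j. snd (traj n a b E c \<sigma> \<beta> \<gamma> t0 Mb x0 z0 ms dp k) i j)"
  have carrier: "fst (traj n a b E c \<sigma> \<beta> \<gamma> t0 Mb x0 z0 ms dp k) i \<in> carrier_vec n" if "i < N" for ms dp k i
    using traj_carrier[of N x0 n i] assms(27) that by blast
  interpret prob_space M by (rule assms(13))
  interpret bc: binary_consensus M h P m N E d \<pi> c \<sigma> \<beta> \<gamma> Mb t0 "\<lambda>i. scalar_prod (K2v n b) (x0 i)" z0 Y Z
  proof unfold_locales
    show "Y ms D (Suc k) i = Y ms D k i + \<gamma> / (real (t0 + 1 + k) + 1)
        * (\<Sum>j\<in>nbr E (ms (t0 + 1 + k)) i. Z ms D (Suc k) i j - Y ms D k i)" if "i < N" for ms D k i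
      unfolding Y_def Z_def traj.simps(2) Let_def fst_conv snd_conv K2_step[OF assms(9) carrier[OF that]]
      by (simp only: of_nat_add of_nat_1)
    show "Z ms D (Suc k) i j = projM Mb (Z ms D k i j
       + \<beta> / real (t0 + 1 + k) * (if j \<in> nbr E (ms (t0 + 1 + k)) i then 1 else 0)
         * (Fcdf \<sigma> (c i j - Z ms D k i j) - (if Y ms D k j + D i j (t0 + 1 + k) \<le> c i j then 1 else 0)))" for ms D k i j
      unfolding Y_def Z_def traj.simps(2) Let_def snd_conv by simp
  qed (use assms in \<open>auto simp: Y_def Z_def\<close>)
  have K2x: "scalar_prod K2 (x \<omega> t i) = bc.Yw (t - t0 - 1) \<omega> i" for \<omega> t i
    unfolding bc.Yw_def by (simp add: Y_def K2_def x_def xstate_def)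
  \<comment> \<open>Outputs have index \<open>t - t0 - 1\<close> and estimates
    \<open>t - t0\<close>. Writing the latter as a successor is correct only from
    \<open>t0 + 1\<close> on, because subtraction is truncated.\<close>
  have zz: "z \<omega> t i j = bc.Zw (Suc (t - t0 - 1)) \<omega> i j" if "t \<ge> t0 + 1" for \<omega> t i j
    using that unfolding bc.Zw_def by (simp add: Z_def z_def zstate_def Suc_diff_Suc)
  have K2bar: "scalar_prod K2 (xbar n N (x \<omega> t)) = avg N (bc.Yw (t - t0 - 1) \<omega>)" for \<omega> t
  proof -
    have "x \<omega> t i \<in> carrier_vec n" if "i < N" for i
      unfolding x_def xstate_def by (rule carrier[OF that])
    then have "scalar_prod K2 (xbar n N (x \<omega> t)) = avg N (\<lambda>i. scalar_prod K2 (x \<omega> t i))"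
      unfolding K2_def by (rule scalar_prod_xbar)
    then show ?thesis by (simp only: K2x)
  qed
  have pos: "lam2 > 0" "lamG > 0" "fM > 0" "pimin > 0"
    unfolding lam2_def lamG_def fM_def pimin_def by (rule bc.l2_pos bc.lG_pos bc.fM_pos bc.pm_pos)+
  have \<gamma>: "\<gamma> > 0" by (rule assms(24))
  define decay where "decay q D \<longleftrightarrow> (\<forall>i<N. \<forall>j\<in>nbrU h E i. \<forall>t\<ge>t0 + 1.
      (\<integral>\<omega>. (scalar_prod K2 (x \<omega> t i) - scalar_prod K2 (xbar n N (x \<omega> t)))\<^sup>2 \<partial>M) \<le> D * real t powr (- q)
    \<and> (\<integral>\<omega>. (z \<omega> t i j - scalar_prod K2 (x \<omega> t j))\<^sup>2 \<partial>M) \<le> D * real t powr (- q))" for q D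
  \<comment> \<open>Serves both parts: \<kappa>0 = 0 for mere convergence, \<kappa>0 = 1 for the
    rate \<open>1/t\<close>.\<close>
  have rate: "\<exists>\<kappa>>\<kappa>0. \<forall>q. 0 < q \<longrightarrow> q \<le> 1 \<longrightarrow> q < \<kappa> \<longrightarrow> (\<exists>D\<ge>0. decay q D)"
    if \<kappa>0: "\<kappa>0 < \<gamma> * lam2"
      and det: "(\<gamma> * (lamG / lam2))\<^sup>2 < (\<gamma> * lam2 - \<kappa>0) * (2 * \<beta> * fM * pimin - \<gamma> * \<alpha> - \<kappa>0)" for \<kappa>0
  proof -
    have "\<gamma> * (lamG / lam2) > 0" using \<gamma> pos by simp
    from lyapunov_weight[OF this \<kappa>0 det] obtain w \<kappa> where w: "w > 0" and \<kappa>: "\<kappa> > \<kappa>0"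
      and \<kappa>1: "\<kappa> \<le> \<gamma> * lam2 - w * (\<gamma> * (lamG / lam2))"
      and \<kappa>2: "\<kappa> * w \<le> w * (2 * \<beta> * fM * pimin - \<gamma> * \<alpha>) - \<gamma> * (lamG / lam2)"
      by blast
    have "\<exists>D\<ge>0. decay q D"
      if q: "0 < q" "q \<le> 1" "q < \<kappa>" for q
    proof -
      obtain D where D: "D \<ge> 0"
        and D1: "\<And>k i. i < N \<Longrightarrow> (\<integral>\<omega>. (bc.Yw k \<omega> i - avg N (bc.Yw k \<omega>))\<^sup>2 \<partial>M) \<le> D * bc.\<tau> k powr (- q)"
        and D2: "\<And>k i j. i < N \<Longrightarrow> j \<in> nbrU h E i \<Longrightarrow>
          (\<integral>\<omega>. (bc.Zw (Suc k) \<omega> i j - bc.Yw k \<omega> j)\<^sup>2 \<partial>M) \<le> D * bc.\<tau> k powr (- q)"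
        using bc.consensus_rate[OF w \<kappa>1[unfolded lam2_def lamG_def]
          \<kappa>2[unfolded lam2_def lamG_def fM_def pimin_def \<alpha>_def] q] by blast
      have \<tau>: "bc.\<tau> (t - t0 - 1) = real t" if "t \<ge> t0 + 1" for t using that by (simp add: bc.\<tau>_def)
      show ?thesis
        unfolding decay_def
      proof (intro exI[of _ D] conjI D allI impI ballI)
        fix i j t assume i: "i < N" and j: "j \<in> nbrU h E i" and t: "t0 + 1 \<le> t"
        show "(\<integral>\<omega>. (scalar_prod K2 (x \<omega> t i) - scalar_prod K2 (xbar n N (x \<omega> t)))\<^sup>2 \<partial>M) \<le> D * real t powr (- q)"
          using D1[OF i, of "t - t0 - 1"] unfolding K2x K2bar \<tau>[OF t] .
        show "(\<integral>\<omega>. (z \<omega> t i j - scalar_prod K2 (x \<omega> t j))\<^sup>2 \<partial>M) \<le> D * real t powr (- q)"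
          using D2[OF i j, of "t - t0 - 1"] unfolding K2x zz[OF t] \<tau>[OF t] .
      qed
    qed
    then show ?thesis using \<kappa> by blast
  qed
  have thr: "2 * \<beta> * fM * pimin > r" if "\<beta> > 1 / (2 * fM * pimin) * r" for r
    using that pos by (simp add: field_simps)
  show ?thesis
  proof (intro conjI impI)
    assume "\<beta> > 1 / (2 * fM * pimin) * (\<gamma> * lamG\<^sup>2 / lam2 ^ 3 + \<gamma> * \<alpha>)"
    from thr[OF this] have d: "2 * \<beta> * fM * pimin - \<gamma> * \<alpha> - 0 > \<gamma> * lamG\<^sup>2 / lam2 ^ 3" by simp
    have "(\<gamma> * (lamG / lam2))\<^sup>2 = (\<gamma> * lam2 - 0) * (\<gamma> * lamG\<^sup>2 / lam2 ^ 3)"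
      using pos by (simp add: power_mult_distrib power_divide power2_eq_square power3_eq_cube field_simps)
    also have "\<dots> < (\<gamma> * lam2 - 0) * (2 * \<beta> * fM * pimin - \<gamma> * \<alpha> - 0)"
      using d \<gamma> pos by (intro mult_strict_left_mono) auto
    finally obtain \<kappa> where \<kappa>: "\<kappa> > 0" and r: "\<forall>q. 0 < q \<longrightarrow> q \<le> 1 \<longrightarrow> q < \<kappa> \<longrightarrow> (\<exists>D\<ge>0. decay q D)"
      using rate[of 0] \<gamma> pos by auto
    \<comment> \<open>Any positive exponent below \<kappa> and at most 1 gives convergence.\<close>
    define q where "q = min 1 (\<kappa> / 2)"
    have q: "0 < q" "q \<le> 1" "q < \<kappa>" using \<kappa> by (auto simp: q_def)
    from r q obtain D where "decay q D" by blast
    note D = this[unfolded decay_def]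
    have "(\<lambda>t. D * real t powr (- q)) \<longlonglongrightarrow> D * 0"
      using q by (intro tendsto_mult tendsto_const tendsto_neg_powr filterlim_real_sequentially) auto
    then have lim0: "(\<lambda>t. D * real t powr (- q)) \<longlonglongrightarrow> 0" by simp
    have lim: "f \<longlonglongrightarrow> 0" if "\<And>t. 0 \<le> f t" "\<And>t. t \<ge> t0 + 1 \<Longrightarrow> f t \<le> D * real t powr (- q)" for f :: "nat \<Rightarrow> real"
      by (rule tendsto_sandwich[OF _ _ tendsto_const lim0])
        (use that in \<open>auto intro: eventually_sequentiallyI[of "t0 + 1"]\<close>)
    show "\<forall>i<N. \<forall>j\<in>nbrU h E i.
         (\<lambda>t. integral\<^sup>L M (\<lambda>\<omega>. (scalar_prod K2 (x \<omega> t i)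
                 - scalar_prod K2 (xbar n N (x \<omega> t)))\<^sup>2)) \<longlonglongrightarrow> 0
       \<and> (\<lambda>t. integral\<^sup>L M (\<lambda>\<omega>. (z \<omega> t i j - scalar_prod K2 (x \<omega> t j))\<^sup>2)) \<longlonglongrightarrow> 0"
      using D by (intro allI impI ballI conjI lim integral_nonneg_AE) auto
  next
    assume as: "\<gamma> > 1 / lam2 \<and> \<beta> > 1 / (2 * fM * pimin) *
            (\<gamma>\<^sup>2 * lamG\<^sup>2 / (lam2\<^sup>2 * (\<gamma> * lam2 - 1)) + \<gamma> * \<alpha> + 1)"
    then have g: "\<gamma> * lam2 > 1" using pos by (simp add: field_simps)
    have d: "2 * \<beta> * fM * pimin - \<gamma> * \<alpha> - 1 > \<gamma>\<^sup>2 * lamG\<^sup>2 / (lam2\<^sup>2 * (\<gamma> * lam2 - 1))"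
      using thr[OF conjunct2[OF as]] by simp
    have "(\<gamma> * (lamG / lam2))\<^sup>2 = (\<gamma> * lam2 - 1) * (\<gamma>\<^sup>2 * lamG\<^sup>2 / (lam2\<^sup>2 * (\<gamma> * lam2 - 1)))"
      using pos g by (simp add: power_mult_distrib power_divide)
    also have "\<dots> < (\<gamma> * lam2 - 1) * (2 * \<beta> * fM * pimin - \<gamma> * \<alpha> - 1)"
      using d g by (intro mult_strict_left_mono) auto
    finally obtain \<kappa> where "\<kappa> > 1" "\<forall>q. 0 < q \<longrightarrow> q \<le> 1 \<longrightarrow> q < \<kappa> \<longrightarrow> (\<exists>D\<ge>0. decay q D)"
      using rate[of 1] g by blast
    then obtain D where "D \<ge> 0" "decay 1 D"
      by (auto dest!: spec[of _ 1])
    note D = this[unfolded decay_def]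
    \<comment> \<open>\<open>D\<close> may be 0 while the constant claimed must be positive, hence
      \<open>D + 1\<close>.\<close>
    have le: "D * real t powr (- 1) \<le> (D + 1) / real t" for t
      by (cases "t = 0") (simp_all add: powr_minus_divide divide_right_mono)
    show "\<exists>C>0. \<forall>i<N. \<forall>j\<in>nbrU h E i. \<forall>t\<ge>t0 + 1.
         integral\<^sup>L M (\<lambda>\<omega>. (scalar_prod K2 (x \<omega> t i)
                 - scalar_prod K2 (xbar n N (x \<omega> t)))\<^sup>2) \<le> C / real t
       \<and> integral\<^sup>L M (\<lambda>\<omega>. (z \<omega> t i j - scalar_prod K2 (x \<omega> t j))\<^sup>2) \<le> C / real t"
      using D by (intro exI[of _ "D + 1"] conjI allI impI ballI; (intro order_trans[OF _ le])?) auto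
  qed
qed

end
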